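(* There is an algorithm that, given a prime $p$, an element $k\in\mathbb{Z}_p$, and elements $a_1,\ldots,a_{p-1}\in\mathbb{Z}_p$ none of which is $0$, outputs a subset $I\subseteq\{1,\ldots,p-1\}$ with $\sum_{i\in I}a_i=k$ in $\mathbb{Z}_p$, and runs in time $O(n\log\log\log n)$, where $n=p$.
   Context: $\mathbb{Z}_p=\mathbb{Z}/p\mathbb{Z}$. Such a subset $I$ always exists (this follows from the Cauchy–Davenport theorem); the result concerns the running time of finding one. Running times are measured in the standard word-RAM model, in which arithmetic on integers of $O(\log n)$ bits takes constant time. *)

theory Defs
  imports
    Complex_Main
    "HOL-Library.Landau_Symbols"
    "HOL-Library.Log_Nat"
    "HOL-Number_Theory.Cong"
begin

text \<open>
  A word RAM with word length \<open>w\<close>: registers and memory cells hold natural numbers below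
  \<open>2 ^ w\<close>, and every instruction takes one unit of time. A program is a fixed list of
  instructions, so it mentions only finitely many registers and constants. Since \<open>w\<close> depends on
  the input, words are represented by \<^typ>\<open>nat\<close> and results are truncated to \<open>w\<close> bits.
\<close>

datatype binop = WAdd | WSub | WMul | WDiv | WMod | WAnd | WOr | WXor | WShl | WShr

fun word_op :: "nat \<Rightarrow> binop \<Rightarrow> nat \<Rightarrow> nat \<Rightarrow> nat" where
  "word_op w WAdd x y = take_bit w (x + y)"
| "word_op w WSub x y = take_bit w (2 ^ w + x - y)"
| "word_op w WMul x y = take_bit w (x * y)"
| "word_op w WDiv x y = take_bit w (x div y)"
| "word_op w WMod x y = take_bit w (x mod y)"
| "word_op w WAnd x y = take_bit w (Bit_Operations.and x y)"
| "word_op w WOr x y = take_bit w (Bit_Operations.or x y)"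
| "word_op w WXor x y = take_bit w (Bit_Operations.xor x y)"
| "word_op w WShl x y = take_bit w (push_bit y x)"
| "word_op w WShr x y = take_bit w (drop_bit y x)"

type_synonym reg = nat

datatype instr =
    Set_Const reg nat         \<comment> \<open>\<open>R\<^sub>d := n\<close>\<close>
  | Set_Op binop reg reg reg  \<comment> \<open>\<open>R\<^sub>d := R\<^sub>x op R\<^sub>y\<close>\<close>
  | Load reg reg              \<comment> \<open>\<open>R\<^sub>d := M[R\<^sub>x]\<close>\<close>
  | Store reg reg             \<comment> \<open>\<open>M[R\<^sub>d] := R\<^sub>x\<close>\<close>
  | Jump nat
  | Jump_Eq reg reg nat       \<comment> \<open>jump if \<open>R\<^sub>x = R\<^sub>y\<close>\<close>
  | Jump_Less reg reg nat     \<comment> \<open>jump if \<open>R\<^sub>x < R\<^sub>y\<close>\<close>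

type_synonym program = "instr list"

record config =
  pc :: nat
  regs :: "reg \<Rightarrow> nat"
  mem :: "nat \<Rightarrow> nat"

fun exec_instr :: "nat \<Rightarrow> instr \<Rightarrow> config \<Rightarrow> config" where
  "exec_instr w (Set_Const d n) s =
     s\<lparr>pc := pc s + 1, regs := (regs s)(d := take_bit w n)\<rparr>"
| "exec_instr w (Set_Op f d x y) s =
     s\<lparr>pc := pc s + 1, regs := (regs s)(d := word_op w f (regs s x) (regs s y))\<rparr>"
| "exec_instr w (Load d x) s =
     s\<lparr>pc := pc s + 1, regs := (regs s)(d := mem s (regs s x))\<rparr>"
| "exec_instr w (Store d x) s =
     s\<lparr>pc := pc s + 1, mem := (mem s)(regs s d := regs s x)\<rparr>"
| "exec_instr w (Jump l) s = s\<lparr>pc := l\<rparr>"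
| "exec_instr w (Jump_Eq x y l) s =
     s\<lparr>pc := if regs s x = regs s y then l else pc s + 1\<rparr>"
| "exec_instr w (Jump_Less x y l) s =
     s\<lparr>pc := if regs s x < regs s y then l else pc s + 1\<rparr>"

text \<open>
  \<open>run w P s t s'\<close>: started in \<open>s\<close>, the program halts after exactly \<open>t\<close> steps in \<open>s'\<close>.
  Halting means that the program counter has left the program.
\<close>

inductive run :: "nat \<Rightarrow> program \<Rightarrow> config \<Rightarrow> nat \<Rightarrow> config \<Rightarrow> bool" for w P where
  halt: "pc s \<ge> length P \<Longrightarrow> run w P s 0 s"
| step: "pc s < length P \<Longrightarrow> run w P (exec_instr w (P ! pc s) s) t s' \<Longrightarrow> run w P s (Suc t) s'"

lemma run_deterministic:
  "run w P s t s' \<Longrightarrow> run w P s u s'' \<Longrightarrow> t = u \<and> s' = s''"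
proof (induction arbitrary: u s'' rule: run.induct)
  case (halt s)
  then show ?case by (auto elim: run.cases)
next
  case (step s t s')
  from step.prems step.hyps(1) step.IH show ?case
    by (cases rule: run.cases) auto
qed

text \<open>
  Elements of the integers modulo \<open>p\<close> are given by their representatives in \<open>{0..<p}\<close>. The input
  occupies the cells \<open>0..p\<close> as \<open>p, k, a\<^sub>1, \<dots>, a\<^sub>p\<^sub>-\<^sub>1\<close>; everything else is initially zero.
\<close>

definition input_config :: "nat \<Rightarrow> nat \<Rightarrow> (nat \<Rightarrow> nat) \<Rightarrow> config" where
  "input_config p k a =
     \<lparr>pc = 0, regs = (\<lambda>_. 0),
      mem = (\<lambda>j. if j = 0 then p else if j = 1 then k else if j \<le> p then a (j - 1) else 0)\<rparr>"

text \<open>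
  The output is the characteristic vector of \<open>I\<close>, in the cells \<open>2..p\<close> that held the \<open>a\<^sub>i\<close>.
\<close>

definition outputs_subset :: "nat \<Rightarrow> config \<Rightarrow> nat set \<Rightarrow> bool" where
  "outputs_subset p s I \<longleftrightarrow>
     I \<subseteq> {1..p - 1} \<and> (\<forall>i\<in>{1..p - 1}. mem s (i + 1) = (if i \<in> I then 1 else 0))"

end

theory Submission
  imports Defs
begin

text \<open>
  Replacing \<open>a\<^sub>i\<close> by \<open>- a\<^sub>i\<close> only shifts the target, so elements matter up to sign. Scale so that the
  most frequent class, of multiplicity \<open>m\<close>, becomes \<open>1\<close>, and represent all others by values in
  \<open>{2..p div 2}\<close>. The ones reach the interval \<open>{0..m}\<close>. Choosing one of two elements whose values
  differ by \<open>d \<le> L + 1\<close> prolongs a reached interval \<open>{0..L}\<close> by \<open>d\<close>. Sort the elements into buckets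
  of width \<open>m + 1\<close> and pair different values within a bucket: at most \<open>m\<close> elements of each bucket
  are left over, so the pairs suffice for \<open>L \<ge> p / 4 - 1\<close>.

  From then on every element is used separately. The reached set is a union of runs of length at
  least \<open>L + 1\<close>, so its complement meets each of the at most four blocks of length \<open>L + 1\<close> in
  a single gap, and adding an element only advances the ends of the gaps: the cost is \<open>O(1)\<close> plus the
  number of new residues. Every step reaches a new residue, and the first step that does not prolong
  the interval doubles the reached set, which makes up for the second elements of the pairs. Hence all
  residues are reached; remembering for each the move that first reached it, one traces the target
  back to \<open>0\<close>. The total time is \<open>O(p)\<close>.
\<close>

subsection \<open>A structured language with unit cost\<close>

text \<open>The threshold of a quarter has two uses: it makes the number of blocks constant, and it
  limits what the pairs may waste. After the m ones and P pairs, L \<ge> m + P, and j = p - 1 - m -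
  2 P elements of value at least 2 remain. If the reached set stays an interval, L + 1 + 2 j \<ge> p
  is needed; this holds for P = 0 since m < p, and for P > 0 because pairing stops once L is at p /
  4, so that m + P \<le> p / 4. If the interval breaks, 2 L + 1 + j \<ge> p suffices, and 2 (m + P)
  + 1 + j = p + m. Signs cost nothing: flipping a bit adds or subtracts the element according to its
  current state, so a suitable initial selection turns every flip into the addition of the wanted
  value, and the target is corrected for this selection afterwards. Each step must test membership
  in the old set while the new set is written into the same array. Hence the decreasing numbers:
  unreached residues carry 0 and those reached by the current move \<open>t\<close> carry
  \<open>t\<close>, so the old ones are exactly those with a number above \<open>t\<close>.\<close>

datatype ('v, 'a) expr =
    Num nat
  | Var 'v
  | Get 'a "('v, 'a) expr"
  | Op binop "('v, 'a) expr" "('v, 'a) expr"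

datatype ('v, 'a) bexp =
    Lt "('v, 'a) expr" "('v, 'a) expr"
  | Neq "('v, 'a) expr" "('v, 'a) expr"
  | And "('v, 'a) bexp" "('v, 'a) bexp"

datatype ('v, 'a) com =
    Skip
  | Assign 'v "('v, 'a) expr" (\<open>(_ ::= _)\<close> [1000, 61] 61)
  | Put 'a "('v, 'a) expr" "('v, 'a) expr" (\<open>(_[_] ::= _)\<close> [1000, 0, 61] 61)
  | Seq "('v, 'a) com" "('v, 'a) com" (infixr \<open>;;\<close> 60)
  | If "('v, 'a) bexp" "('v, 'a) com" "('v, 'a) com" (\<open>(IF _ THEN _ ELSE _)\<close> [0, 61, 61] 61)
  | While "('v, 'a) bexp" "('v, 'a) com" (\<open>(WHILE _ DO _)\<close> [0, 61] 61)

type_synonym 'v store = "'v \<Rightarrow> nat"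
type_synonym 'a heap = "'a \<Rightarrow> nat \<Rightarrow> nat"

fun nat_op :: "binop \<Rightarrow> nat \<Rightarrow> nat \<Rightarrow> nat" where
  "nat_op WAdd x y = x + y"
| "nat_op WSub x y = x - y"
| "nat_op WMul x y = x * y"
| "nat_op WDiv x y = x div y"
| "nat_op WMod x y = x mod y"
| "nat_op _ x y = 0"

text \<open>Each clause excludes exactly the wrap-around of the machine operation. Bit operations
  and shifts are kept out of the source language; only the compiler uses one of them,
  \<open>WOr\<close>, for copying.\<close>

fun op_ok :: "nat \<Rightarrow> binop \<Rightarrow> nat \<Rightarrow> nat \<Rightarrow> bool" where
  "op_ok M WAdd x y \<longleftrightarrow> x + y < M"
| "op_ok M WSub x y \<longleftrightarrow> y \<le> x"
| "op_ok M WMul x y \<longleftrightarrow> x * y < M"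
| "op_ok M WDiv x y \<longleftrightarrow> True"
| "op_ok M WMod x y \<longleftrightarrow> True"
| "op_ok M _ x y \<longleftrightarrow> False"

primrec val :: "('v, 'a) expr \<Rightarrow> 'v store \<Rightarrow> 'a heap \<Rightarrow> nat" where
  "val (Num k) S H = k"
| "val (Var x) S H = S x"
| "val (Get A e) S H = H A (val e S H)"
| "val (Op f e e') S H = nat_op f (val e S H) (val e' S H)"

text \<open>
  \<open>M\<close> bounds the words and \<open>N\<close> the array indices, so that an admissible expression is evaluated
  without truncation.
\<close>

primrec ok :: "nat \<Rightarrow> nat \<Rightarrow> ('v, 'a) expr \<Rightarrow> 'v store \<Rightarrow> 'a heap \<Rightarrow> bool" where
  "ok M N (Num k) S H \<longleftrightarrow> k < M"
| "ok M N (Var x) S H \<longleftrightarrow> True"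
| "ok M N (Get A e) S H \<longleftrightarrow> ok M N e S H \<and> val e S H < N"
| "ok M N (Op f e e') S H \<longleftrightarrow>
     ok M N e S H \<and> ok M N e' S H \<and> op_ok M f (val e S H) (val e' S H)"

primrec bval :: "('v, 'a) bexp \<Rightarrow> 'v store \<Rightarrow> 'a heap \<Rightarrow> bool" where
  "bval (Lt e e') S H \<longleftrightarrow> val e S H < val e' S H"
| "bval (Neq e e') S H \<longleftrightarrow> val e S H \<noteq> val e' S H"
| "bval (And b b') S H \<longleftrightarrow> bval b S H \<and> bval b' S H"

primrec bok :: "nat \<Rightarrow> nat \<Rightarrow> ('v, 'a) bexp \<Rightarrow> 'v store \<Rightarrow> 'a heap \<Rightarrow> bool" where
  "bok M N (Lt e e') S H \<longleftrightarrow> ok M N e S H \<and> ok M N e' S H"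
| "bok M N (Neq e e') S H \<longleftrightarrow> ok M N e S H \<and> ok M N e' S H"
| "bok M N (And b b') S H \<longleftrightarrow> bok M N b S H \<and> (bval b S H \<longrightarrow> bok M N b' S H)"

text \<open>An assignment or a test costs 1 whatever the size of its expressions: for a fixed
  program this differs from machine time by a constant factor only. There is no rule for
  inadmissible expressions, so an execution also certifies that no word or index overflows.\<close>

inductive exec ::
  "nat \<Rightarrow> nat \<Rightarrow> ('v, 'a) com \<Rightarrow> 'v store \<Rightarrow> 'a heap \<Rightarrow> nat \<Rightarrow> 'v store \<Rightarrow> 'a heap \<Rightarrow> bool"
  for M N where
  Skip: "exec M N Skip S H 0 S H"
| Assign: "ok M N e S H \<Longrightarrow> exec M N (x ::= e) S H 1 (S(x := val e S H)) H"
| Put: "ok M N i S H \<Longrightarrow> ok M N e S H \<Longrightarrow> val i S H < N \<Longrightarrow>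
    exec M N (A[i] ::= e) S H 1 S (H(A := (H A)(val i S H := val e S H)))"
| Seq: "exec M N c S H t S' H' \<Longrightarrow> exec M N c' S' H' t' S'' H'' \<Longrightarrow>
    exec M N (c ;; c') S H (t + t') S'' H''"
| If: "bok M N b S H \<Longrightarrow> exec M N (if bval b S H then c else c') S H t S' H' \<Longrightarrow>
    exec M N (IF b THEN c ELSE c') S H (Suc t) S' H'"
| WhileF: "bok M N b S H \<Longrightarrow> \<not> bval b S H \<Longrightarrow> exec M N (WHILE b DO c) S H 1 S H"
| WhileT: "bok M N b S H \<Longrightarrow> bval b S H \<Longrightarrow> exec M N c S H t S' H' \<Longrightarrow>
    exec M N (WHILE b DO c) S' H' t' S'' H'' \<Longrightarrow>
    exec M N (WHILE b DO c) S H (Suc (t + t')) S'' H''"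

inductive_cases exec_elims:
  "exec M N Skip S H t S' H'"
  "exec M N (x ::= e) S H t S' H'"
  "exec M N (A[i] ::= e) S H t S' H'"
  "exec M N (c ;; c') S H t S' H'"
  "exec M N (IF b THEN c ELSE c') S H t S' H'"

text \<open>Total correctness with a clock: \<open>n\<close> is the time already spent, and
  \<open>Q\<close> sees the time at the end. Time bounds can thus be stated in loop invariants and
  amortised there like any other property.\<close>

definition wp ::
  "nat \<Rightarrow> nat \<Rightarrow> ('v, 'a) com \<Rightarrow> ('v store \<Rightarrow> 'a heap \<Rightarrow> nat \<Rightarrow> bool) \<Rightarrow>
   'v store \<Rightarrow> 'a heap \<Rightarrow> nat \<Rightarrow> bool" where
  "wp M N c Q S H n \<longleftrightarrow> (\<exists>t S' H'. exec M N c S H t S' H' \<and> Q S' H' (n + t))"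

lemma wp_Skip [simp]: "wp M N Skip Q S H n \<longleftrightarrow> Q S H n"
  unfolding wp_def
  by (metis Nat.add_0_right exec.Skip exec_elims(1))

lemma wp_Assign [simp]:
  "wp M N (x ::= e) Q S H n \<longleftrightarrow> ok M N e S H \<and> Q (S(x := val e S H)) H (Suc n)"
  unfolding wp_def
  by (force intro: exec.Assign elim: exec_elims(2))

lemma wp_Put [simp]:
  "wp M N (A[i] ::= e) Q S H n \<longleftrightarrow> ok M N i S H \<and> ok M N e S H \<and> val i S H < N \<and>
     Q S (H(A := (H A)(val i S H := val e S H))) (Suc n)"
  unfolding wp_def
  by (force intro: exec.Put elim: exec_elims(3))

lemma wp_Seq [simp]: "wp M N (c ;; c') Q S H n \<longleftrightarrow> wp M N c (wp M N c' Q) S H n"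
proof
  show "wp M N (c ;; c') Q S H n" if "wp M N c (wp M N c' Q) S H n"
    using that unfolding wp_def by (metis exec.Seq add.assoc)
  show "wp M N c (wp M N c' Q) S H n" if "wp M N (c ;; c') Q S H n"
    using that unfolding wp_def by (auto elim!: exec_elims(4) simp: add.assoc) blast
qed

lemma wp_If [simp]:
  "wp M N (IF b THEN c ELSE c') Q S H n \<longleftrightarrow>
     bok M N b S H \<and> (if bval b S H then wp M N c Q S H (Suc n) else wp M N c' Q S H (Suc n))"
proof
  show "wp M N (IF b THEN c ELSE c') Q S H n"
    if "bok M N b S H \<and> (if bval b S H then wp M N c Q S H (Suc n) else wp M N c' Q S H (Suc n))"
    using that unfolding wp_def
    by (auto split: if_splits)
      (metis exec.If add_Suc_right add_Suc)+
  show "bok M N b S H \<and> (if bval b S H then wp M N c Q S H (Suc n) else wp M N c' Q S H (Suc n))"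
    if "wp M N (IF b THEN c ELSE c') Q S H n"
    using that unfolding wp_def by (auto elim!: exec_elims(5) split: if_splits) blast+
qed

lemma wp_While:
  fixes \<mu> :: "'v store \<Rightarrow> 'a heap \<Rightarrow> nat"
  assumes "I S H n"
    and "\<And>S H n. I S H n \<Longrightarrow> bok M N b S H"
    and "\<And>S H n. I S H n \<Longrightarrow> bval b S H \<Longrightarrow>
      wp M N c (\<lambda>S' H' n'. I S' H' n' \<and> \<mu> S' H' < \<mu> S H) S H (Suc n)"
    and "\<And>S H n. I S H n \<Longrightarrow> \<not> bval b S H \<Longrightarrow> Q S H (Suc n)"
  shows "wp M N (WHILE b DO c) Q S H n"
  using assms(1)
proof (induction "\<mu> S H" arbitrary: S H n rule: less_induct)
  case less
  show ?case
  proof (cases "bval b S H")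
    case False
    then show ?thesis
      using assms(2,4) less.prems exec.WhileF unfolding wp_def by fastforce
  next
    case True
    from assms(3)[OF less.prems True] obtain t S' H' where body: "exec M N c S H t S' H'"
      and I': "I S' H' (Suc n + t)" and "\<mu> S' H' < \<mu> S H"
      unfolding wp_def by blast
    with less.hyps[of S' H'] obtain t' S'' H'' where
      "exec M N (WHILE b DO c) S' H' t' S'' H''" "Q S'' H'' (Suc n + t + t')"
      unfolding wp_def by blast
    then show ?thesis
      using exec.WhileT[OF assms(2)[OF less.prems] True body] unfolding wp_def
      by (metis add.assoc add_Suc add_Suc_right)
  qed
qed

subsection \<open>Compilation to the word RAM\<close>

text \<open>
  Register 0 holds the index bound \<open>N\<close>, which is also the distance of consecutive arrays in
  memory; program variables live in the positive even registers, temporaries in the odd ones.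
\<close>

abbreviation tmp :: "nat \<Rightarrow> reg" where
  "tmp d \<equiv> 2 * d + 1"

primrec cexp :: "('v \<Rightarrow> nat) \<Rightarrow> ('a \<Rightarrow> nat) \<Rightarrow> nat \<Rightarrow> ('v, 'a) expr \<Rightarrow> program" where
  "cexp vn an d (Num k) = [Set_Const (tmp d) k]"
| "cexp vn an d (Var x) = [Set_Op WOr (tmp d) (2 * vn x + 2) (2 * vn x + 2)]"
| "cexp vn an d (Get A e) = cexp vn an d e @
     [Set_Const (tmp (Suc d)) (an A), Set_Op WMul (tmp (Suc d)) (tmp (Suc d)) 0,
      Set_Op WAdd (tmp d) (tmp d) (tmp (Suc d)), Load (tmp d) (tmp d)]"
| "cexp vn an d (Op f e e') = cexp vn an d e @ cexp vn an (Suc d) e' @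
     [Set_Op f (tmp d) (tmp d) (tmp (Suc d))]"

primrec elen :: "('v, 'a) expr \<Rightarrow> nat" where
  "elen (Num k) = 1"
| "elen (Var x) = 1"
| "elen (Get A e) = elen e + 4"
| "elen (Op f e e') = elen e + elen e' + 1"

lemma length_cexp [simp]: "length (cexp vn an d e) = elen e"
  by (induction e arbitrary: d) auto

primrec blen :: "('v, 'a) bexp \<Rightarrow> nat" where
  "blen (Lt e e') = elen e + elen e' + 2"
| "blen (Neq e e') = elen e + elen e' + 1"
| "blen (And b b') = blen b + blen b'"

text \<open>The code of a condition falls through if it holds, and otherwise jumps to \<open>f\<close>.\<close>

primrec cbexp :: "('v \<Rightarrow> nat) \<Rightarrow> ('a \<Rightarrow> nat) \<Rightarrow> nat \<Rightarrow> nat \<Rightarrow> ('v, 'a) bexp \<Rightarrow> program" where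
  "cbexp vn an l f (Lt e e') = cexp vn an 0 e @ cexp vn an 1 e' @
     [Jump_Less (tmp 0) (tmp 1) (l + elen e + elen e' + 2), Jump f]"
| "cbexp vn an l f (Neq e e') = cexp vn an 0 e @ cexp vn an 1 e' @
     [Jump_Eq (tmp 0) (tmp 1) f]"
| "cbexp vn an l f (And b b') = cbexp vn an l f b @ cbexp vn an (l + blen b) f b'"

lemma length_cbexp [simp]: "length (cbexp vn an l f b) = blen b"
  by (induction b arbitrary: l) auto

primrec clen :: "('v, 'a) com \<Rightarrow> nat" where
  "clen Skip = 0"
| "clen (x ::= e) = elen e + 1"
| "clen (A[i] ::= e) = elen i + elen e + 4"
| "clen (c ;; c') = clen c + clen c'"
| "clen (IF b THEN c ELSE c') = blen b + clen c + clen c' + 1"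
| "clen (WHILE b DO c) = blen b + clen c + 1"

primrec comp :: "('v \<Rightarrow> nat) \<Rightarrow> ('a \<Rightarrow> nat) \<Rightarrow> nat \<Rightarrow> ('v, 'a) com \<Rightarrow> program" where
  "comp vn an l Skip = []"
| "comp vn an l (x ::= e) = cexp vn an 0 e @ [Set_Op WOr (2 * vn x + 2) (tmp 0) (tmp 0)]"
| "comp vn an l (A[i] ::= e) = cexp vn an 0 i @ cexp vn an 1 e @
     [Set_Const (tmp 2) (an A), Set_Op WMul (tmp 2) (tmp 2) 0,
      Set_Op WAdd (tmp 0) (tmp 0) (tmp 2), Store (tmp 0) (tmp 1)]"
| "comp vn an l (c ;; c') = comp vn an l c @ comp vn an (l + clen c) c'"
| "comp vn an l (IF b THEN c ELSE c') =
     cbexp vn an l (l + blen b + clen c + 1) b @ comp vn an (l + blen b) c @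
     [Jump (l + blen b + clen c + 1 + clen c')] @ comp vn an (l + blen b + clen c + 1) c'"
| "comp vn an l (WHILE b DO c) =
     cbexp vn an l (l + blen b + clen c + 1) b @ comp vn an (l + blen b) c @ [Jump l]"

lemma length_comp [simp]: "length (comp vn an l c) = clen c"
  by (induction c arbitrary: l) auto

primrec code_at :: "program \<Rightarrow> nat \<Rightarrow> program \<Rightarrow> bool" where
  "code_at P l [] \<longleftrightarrow> True"
| "code_at P l (c # cs) \<longleftrightarrow> l < length P \<and> P ! l = c \<and> code_at P (Suc l) cs"

lemma code_at_append [simp]:
  "code_at P l (cs @ cs') \<longleftrightarrow> code_at P l cs \<and> code_at P (l + length cs) cs'"
  by (induction cs arbitrary: l) auto

text \<open>\<open>run\<close> speaks only of runs up to the halt. A finite piece of a run is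
  therefore described by its effect on every halting continuation, which makes composition
  immediate.\<close>

definition reaches :: "nat \<Rightarrow> program \<Rightarrow> config \<Rightarrow> nat \<Rightarrow> config \<Rightarrow> bool" where
  "reaches w P s t s' \<longleftrightarrow> (\<forall>u f. run w P s' u f \<longrightarrow> run w P s (t + u) f)"

lemma reaches_refl: "reaches w P s 0 s"
  by (simp add: reaches_def)

lemma reaches_trans: "reaches w P s t s' \<Longrightarrow> reaches w P s' t' s'' \<Longrightarrow> reaches w P s (t + t') s''"
  by (simp add: reaches_def add.assoc)

lemma reaches_step:
  "pc s < length P \<Longrightarrow> P ! pc s = i \<Longrightarrow> reaches w P (exec_instr w i s) t s' \<Longrightarrow> reaches w P s (Suc t) s'"
  unfolding reaches_def by (auto intro: run.step)

text \<open>\<open>space\<close> says that every array, up to its last cell, lies at addresses below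
  \<open>2 ^ w\<close>.\<close>

locale compiler =
  fixes w N :: nat and vn :: "'v \<Rightarrow> nat" and an :: "'a \<Rightarrow> nat"
  assumes vn: "inj vn" and an: "inj an" and space: "(an A + 1) * N \<le> 2 ^ w"
begin

abbreviation "M \<equiv> 2 ^ w :: nat"

definition rel :: "'v store \<Rightarrow> 'a heap \<Rightarrow> config \<Rightarrow> bool" where
  "rel S H s \<longleftrightarrow> regs s 0 = N \<and> (\<forall>x. regs s (2 * vn x + 2) = S x \<and> S x < M) \<and>
     (\<forall>A i. i < N \<longrightarrow> mem s (an A * N + i) = H A i \<and> H A i < M)"

lemma relD:
  assumes "rel S H s"
  shows "regs s 0 = N" "regs s (2 * vn x + 2) = S x" "S x < M"
    "i < N \<Longrightarrow> mem s (an A * N + i) = H A i" "i < N \<Longrightarrow> H A i < M"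
  using assms unfolding rel_def by auto

lemma address_less: "i < N \<Longrightarrow> an A * N + i < M"
  using space[of A] by simp

lemma address_less': "0 < N \<Longrightarrow> an A * N < M"
  using address_less[of 0 A] by simp

lemma an_less: "0 < N \<Longrightarrow> an A < M"
proof -
  assume "0 < N"
  then have "an A \<le> an A * N"
    by simp
  then show ?thesis
    using address_less'[OF \<open>0 < N\<close>, of A] by linarith
qed

lemma address_inj:
  assumes "i < N" "j < N" "an A * N + i = an B * N + j"
  shows "A = B \<and> i = j"
proof -
  have "an A = (an A * N + i) div N" "an B = (an B * N + j) div N"
    using assms(1,2) by auto
  then have "an A = an B"
    using assms(3) by simp
  then show ?thesis
    using assms(3) an by (simp add: inj_eq)
qed

lemma val_less: "rel S H s \<Longrightarrow> ok M N e S H \<Longrightarrow> val e S H < M"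
proof (induction e)
  case (Op f e e')
  then show ?case
    by (cases f) (auto intro: le_less_trans[OF div_le_dividend] le_less_trans[OF mod_less_eq_dividend])
qed (auto dest: relD)

lemma word_op_exact:
  "op_ok M f x y \<Longrightarrow> x < M \<Longrightarrow> y < M \<Longrightarrow> word_op w f x y = nat_op f x y"
  \<comment> \<open>The machine subtracts by computing \<open>M + x - y\<close> modulo
    \<open>M\<close>.\<close>
  using mod_add_self1[of M "x - y"]
  by (cases f) (auto simp: take_bit_eq_mod le_less_trans[OF div_le_dividend]
      le_less_trans[OF mod_less_eq_dividend] less_imp_diff_less)

lemma word_or_self: "x < M \<Longrightarrow> word_op w WOr x x = x"
  by (simp add: take_bit_eq_mod)

text \<open>The last conjunct is a stack discipline: code at depth \<open>d\<close> leaves the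
  temporaries below \<open>d\<close> alone, so a left operand survives the evaluation of the right
  one.\<close>

lemma cexp_correct:
  assumes "rel S H s" "ok M N e S H" "code_at P (pc s) (cexp vn an d e)"
  shows "\<exists>s'. reaches w P s (elen e) s' \<and> pc s' = pc s + elen e \<and> rel S H s' \<and>
    regs s' (tmp d) = val e S H \<and> (\<forall>d'<d. regs s' (tmp d') = regs s (tmp d'))"
  using assms
proof (induction e arbitrary: d s)
  case (Num k)
  then show ?case
    by (intro exI[of _ "exec_instr w (Set_Const (tmp d) k) s"] conjI)
      (auto intro!: reaches_step reaches_refl simp: rel_def take_bit_eq_mod, presburger)
next
  case (Var x)
  let ?i = "Set_Op WOr (tmp d) (2 * vn x + 2) (2 * vn x + 2)"
  have "word_op w WOr (S x) (S x) = S x"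
    using word_or_self relD(3)[OF Var(1)] .
  with Var show ?case
    by (intro exI[of _ "exec_instr w ?i s"] conjI)
      (auto intro!: reaches_step[where i = ?i] reaches_refl simp: rel_def simp del: word_op.simps, presburger)
next
  case (Get A e)
  from Get.IH[OF Get.prems(1), of d] Get.prems obtain s1 where s1:
    "reaches w P s (elen e) s1" "pc s1 = pc s + elen e" "rel S H s1"
    "regs s1 (tmp d) = val e S H" "\<forall>d'<d. regs s1 (tmp d') = regs s (tmp d')"
    by auto
  let ?is = "[Set_Const (tmp (Suc d)) (an A), Set_Op WMul (tmp (Suc d)) (tmp (Suc d)) 0,
      Set_Op WAdd (tmp d) (tmp d) (tmp (Suc d)), Load (tmp d) (tmp d)]"
  let ?v = "val e S H"
  have N: "?v < N" "0 < N"
    using Get.prems by auto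
  let ?s' = "s1\<lparr>pc := Suc (Suc (Suc (Suc (pc s1)))),
    regs := (regs s1)(tmp (Suc d) := an A * N, tmp d := H A ?v)\<rparr>"
  have mods: "an A mod M = an A" "an A * N mod M = an A * N" "(an A * N + ?v) mod M = an A * N + ?v"
    "(?v + an A * N) mod M = an A * N + ?v"
    using an_less[OF N(2), of A] address_less'[OF N(2), of A] address_less[OF N(1), of A]
    by (simp_all add: add.commute[of ?v])
  have "code_at P (pc s1) ?is"
    using Get.prems(3) s1(2) by simp
  moreover have "mem s1 (an A * N + ?v) = H A ?v"
    using relD(4)[OF s1(3) N(1)] .
  ultimately have "reaches w P s1 (Suc (Suc (Suc (Suc 0)))) ?s'"
    using s1(4)
    by (auto intro!: reaches_step simp: relD(1)[OF s1(3)] take_bit_eq_mod mods fun_upd_twist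
        simp del: mult_2 intro: reaches_refl)
  note reaches_trans[OF s1(1) this]
  moreover have "rel S H ?s'"
    using s1(3) unfolding rel_def by (auto, presburger+)
  ultimately show ?case
    using s1(2,5) by (intro exI[of _ ?s'] conjI) (auto simp: numeral_eq_Suc)
next
  case (Op f e e')
  from Op.IH(1)[OF Op.prems(1), of d] Op.prems obtain s1 where s1:
    "reaches w P s (elen e) s1" "pc s1 = pc s + elen e" "rel S H s1"
    "regs s1 (tmp d) = val e S H" "\<forall>d'<d. regs s1 (tmp d') = regs s (tmp d')"
    by auto
  from Op.IH(2)[OF s1(3), of "Suc d"] Op.prems s1(2) obtain s2 where s2:
    "reaches w P s1 (elen e') s2" "pc s2 = pc s1 + elen e'" "rel S H s2"
    "regs s2 (tmp (Suc d)) = val e' S H" "\<forall>d'<Suc d. regs s2 (tmp d') = regs s1 (tmp d')"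
    by auto
  let ?i = "Set_Op f (tmp d) (tmp d) (tmp (Suc d))"
  let ?s' = "s2\<lparr>pc := pc s2 + 1, regs := (regs s2)(tmp d := val (Op f e e') S H)\<rparr>"
  have "regs s2 (tmp d) = val e S H"
    using s1(4) s2(5) by simp
  then have "exec_instr w ?i s2 = ?s'"
    using word_op_exact[of f "val e S H" "val e' S H"] Op.prems(1,2) s2(4)
    by (simp add: val_less)
  moreover have "pc s2 < length P" "P ! pc s2 = ?i"
    using Op.prems(3) s1(2) s2(2) by (auto simp: add.assoc)
  ultimately have "reaches w P s2 1 ?s'"
    using reaches_step[OF _ _ reaches_refl] by (metis One_nat_def)
  note reaches_trans[OF reaches_trans[OF s1(1) s2(1)] this]
  moreover have "rel S H ?s'"
    using s2(3) unfolding rel_def by (auto, presburger+)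
  moreover have "\<forall>d'<d. regs ?s' (tmp d') = regs s (tmp d')"
    using s1(5) s2(5) by auto
  ultimately show ?case
    using s1(2) s2(2)
    by (intro exI[of _ ?s'] conjI) (auto simp: add.assoc)
qed

lemma cexp2_correct:
  assumes "rel S H s" "ok M N e S H" "ok M N e' S H"
    and "code_at P (pc s) (cexp vn an 0 e @ cexp vn an 1 e')"
  shows "\<exists>s'. reaches w P s (elen e + elen e') s' \<and> pc s' = pc s + elen e + elen e' \<and> rel S H s' \<and>
    regs s' (tmp 0) = val e S H \<and> regs s' (tmp 1) = val e' S H"
proof -
  from cexp_correct[OF assms(1,2)] assms(4) obtain s1 where s1:
    "reaches w P s (elen e) s1" "pc s1 = pc s + elen e" "rel S H s1" "regs s1 (tmp 0) = val e S H"
    by fastforce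
  from cexp_correct[OF s1(3) assms(3), of P 1] assms(4) s1(2) obtain s2 where s2:
    "reaches w P s1 (elen e') s2" "pc s2 = pc s1 + elen e'" "rel S H s2"
    "regs s2 (tmp 1) = val e' S H" "\<forall>d'<1. regs s2 (tmp d') = regs s1 (tmp d')"
    by auto
  have "regs s2 (tmp 0) = val e S H"
    using s1(4) s2(5) by simp
  then show ?thesis
    using reaches_trans[OF s1(1) s2(1)] s1(2) s2(2,3,4) by (intro exI[of _ s2]) simp
qed

lemma rel_pc [simp]: "rel S H (s\<lparr>pc := l\<rparr>) \<longleftrightarrow> rel S H s"
  by (simp add: rel_def)

lemma cbexp_correct:
  assumes "rel S H s" "bok M N b S H" "code_at P (pc s) (cbexp vn an (pc s) f b)"
  shows "\<exists>s' t. t \<le> blen b \<and> reaches w P s t s' \<and> rel S H s' \<and>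
    pc s' = (if bval b S H then pc s + blen b else f)"
  using assms
proof (induction b arbitrary: s)
  case (Lt e e')
  then obtain s1 where s1: "reaches w P s (elen e + elen e') s1" "pc s1 = pc s + elen e + elen e'"
    "rel S H s1" "regs s1 (tmp 0) = val e S H" "regs s1 (tmp 1) = val e' S H"
    using cexp2_correct[of S H s e e' P] by auto
  have code: "code_at P (pc s1) [Jump_Less (tmp 0) (tmp 1) (pc s1 + 2), Jump f]"
    using Lt.prems(3) s1(2) by (simp add: add.assoc)
  show ?case
  proof (cases "val e S H < val e' S H")
    case True
    then have "reaches w P s1 1 (s1\<lparr>pc := pc s1 + 2\<rparr>)"
      using code s1(4,5) by (auto intro!: reaches_step reaches_refl)
    from reaches_trans[OF s1(1) this] show ?thesis
      using True s1(2,3)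
      by (intro exI[of _ "s1\<lparr>pc := pc s1 + 2\<rparr>"] exI[of _ "elen e + elen e' + 1"]) simp
  next
    case False
    then have "reaches w P s1 2 (s1\<lparr>pc := f\<rparr>)"
      using code s1(4,5) by (auto intro!: reaches_step reaches_refl simp: numeral_2_eq_2)
    from reaches_trans[OF s1(1) this] show ?thesis
      using False s1(2,3)
      by (intro exI[of _ "s1\<lparr>pc := f\<rparr>"] exI[of _ "elen e + elen e' + 2"]) simp
  qed
next
  case (Neq e e')
  then obtain s1 where s1: "reaches w P s (elen e + elen e') s1" "pc s1 = pc s + elen e + elen e'"
    "rel S H s1" "regs s1 (tmp 0) = val e S H" "regs s1 (tmp 1) = val e' S H"
    using cexp2_correct[of S H s e e' P] by auto
  let ?l = "if val e S H = val e' S H then f else pc s1 + 1"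
  have "code_at P (pc s1) [Jump_Eq (tmp 0) (tmp 1) f]"
    using Neq.prems(3) s1(2) by (simp add: add.assoc)
  then have "reaches w P s1 1 (s1\<lparr>pc := ?l\<rparr>)"
    using s1(4,5) by (auto intro!: reaches_step reaches_refl)
  from reaches_trans[OF s1(1) this] show ?case
    using s1(2,3)
    by (intro exI[of _ "s1\<lparr>pc := ?l\<rparr>"] exI[of _ "elen e + elen e' + 1"]) simp
next
  case (And b b')
  from And.IH(1)[OF And.prems(1)] And.prems obtain s1 t where s1: "t \<le> blen b"
    "reaches w P s t s1" "rel S H s1" "pc s1 = (if bval b S H then pc s + blen b else f)"
    by fastforce
  show ?case
  proof (cases "bval b S H")
    case True
    with And.IH(2)[OF s1(3)] And.prems s1(4) obtain s2 t' where s2: "t' \<le> blen b'"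
      "reaches w P s1 t' s2" "rel S H s2" "pc s2 = (if bval b' S H then pc s1 + blen b' else f)"
      by fastforce
    then show ?thesis
      using reaches_trans[OF s1(2) s2(2)] s1 True by (intro exI[of _ s2] exI[of _ "t + t'"]) auto
  next
    case False
    then show ?thesis
      using s1 by (intro exI[of _ s1] exI[of _ t]) auto
  qed
qed

text \<open>Each unit of source cost pays for the code of one assignment, or of one test with its
  closing jump, and such a piece is no longer than the whole program. The bound \<open>Z\<close> is
  separate from \<open>clen c\<close> because in the induction \<open>c\<close> ranges over the
  subcommands of one fixed program.\<close>

lemma comp_correct:
  assumes "exec M N c S H t S' H'" "rel S H s" "code_at P (pc s) (comp vn an (pc s) c)" "clen c \<le> Z"
  shows "\<exists>s' t'. t' \<le> Z * t \<and> reaches w P s t' s' \<and> rel S' H' s' \<and> pc s' = pc s + clen c"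
  using assms
proof (induction arbitrary: s rule: exec.induct)
  case (Skip S H)
  then show ?case
    using reaches_refl by fastforce
next
  case (Assign e S H x)
  from cexp_correct[OF Assign.prems(1) Assign.hyps, of P 0] Assign.prems(2) obtain s1 where s1:
    "reaches w P s (elen e) s1" "pc s1 = pc s + elen e" "rel S H s1" "regs s1 (tmp 0) = val e S H"
    by auto
  let ?i = "Set_Op WOr (2 * vn x + 2) (tmp 0) (tmp 0)"
  let ?s' = "s1\<lparr>pc := pc s1 + 1, regs := (regs s1)(2 * vn x + 2 := val e S H)\<rparr>"
  have v: "val e S H < M"
    using val_less Assign by blast
  have "exec_instr w ?i s1 = ?s'"
    using word_or_self[OF v] s1(4) by simp
  moreover have "pc s1 < length P" "P ! pc s1 = ?i"
    using Assign.prems(2) s1(2) by auto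
  ultimately have "reaches w P s1 1 ?s'"
    using reaches_step[OF _ _ reaches_refl] by (metis One_nat_def)
  note reaches_trans[OF s1(1) this]
  moreover have "rel (S(x := val e S H)) H ?s'"
    using s1(3) v vn unfolding rel_def by (auto simp: inj_eq)
  ultimately show ?case
    using s1(2) Assign.prems(3)
    by (intro exI[of _ ?s'] exI[of _ "elen e + 1"] conjI) (auto simp: fun_upd_def)
next
  case (Put i S H e A)
  from cexp2_correct[OF Put.prems(1) Put.hyps(1,2)] Put.prems(2) obtain s1 where s1:
    "reaches w P s (elen i + elen e) s1" "pc s1 = pc s + elen i + elen e" "rel S H s1"
    "regs s1 (tmp 0) = val i S H" "regs s1 (tmp 1) = val e S H"
    by auto
  let ?is = "[Set_Const (tmp 2) (an A), Set_Op WMul (tmp 2) (tmp 2) 0,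
      Set_Op WAdd (tmp 0) (tmp 0) (tmp 2), Store (tmp 0) (tmp 1)]"
  let ?v = "val i S H"
  let ?s' = "s1\<lparr>regs := (regs s1)(tmp 2 := an A * N, tmp 0 := an A * N + ?v),
    pc := Suc (Suc (Suc (Suc (pc s1)))),
    mem := (mem s1)(an A * N + ?v := val e S H)\<rparr>"
  have N: "?v < N" "0 < N"
    using Put.hyps by auto
  have v: "val e S H < M"
    using val_less Put by blast
  have mods: "an A mod M = an A" "an A * N mod M = an A * N" "(an A * N + ?v) mod M = an A * N + ?v"
    "(?v + an A * N) mod M = an A * N + ?v"
    using an_less[OF N(2), of A] address_less'[OF N(2), of A] address_less[OF N(1), of A]
    by (simp_all add: add.commute[of ?v])
  have "code_at P (pc s1) ?is"
    using Put.prems(2) s1(2) by (simp add: add.assoc)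
  then have "reaches w P s1 (Suc (Suc (Suc (Suc 0)))) ?s'"
    using s1(4,5)
    by (auto intro!: reaches_step simp: relD(1)[OF s1(3)] take_bit_eq_mod mods fun_upd_twist
        intro: reaches_refl)
  note reaches_trans[OF s1(1) this]
  moreover have "rel S (H(A := (H A)(?v := val e S H))) ?s'"
    using s1(3) v N address_inj unfolding rel_def by (auto, presburger+)
  ultimately show ?case
    using s1(2) Put.prems(3)
    by (intro exI[of _ ?s'] exI[of _ "elen i + elen e + 4"] conjI) (auto simp: numeral_eq_Suc fun_upd_def)
next
  case (Seq c S H t S' H' c' t' S'' H'')
  from Seq.IH(1)[OF Seq.prems(1)] Seq.prems obtain s1 u where s1: "u \<le> Z * t"
    "reaches w P s u s1" "rel S' H' s1" "pc s1 = pc s + clen c"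
    by auto
  from Seq.IH(2)[OF s1(3)] Seq.prems s1(4) obtain s2 u' where s2: "u' \<le> Z * t'"
    "reaches w P s1 u' s2" "rel S'' H'' s2" "pc s2 = pc s1 + clen c'"
    by auto
  then show ?case
    using reaches_trans[OF s1(2) s2(2)] s1
    by (intro exI[of _ s2] exI[of _ "u + u'"]) (auto simp: algebra_simps)
next
  case (If b S H c c' t S' H')
  from cbexp_correct[OF If.prems(1) If.hyps(1)] If.prems(2) obtain s1 u where s1: "u \<le> blen b"
    "reaches w P s u s1" "rel S H s1"
    "pc s1 = (if bval b S H then pc s + blen b else pc s + blen b + clen c + 1)"
    by fastforce
  show ?case
  proof (cases "bval b S H")
    case True
    with If.IH[OF s1(3)] If.prems s1(4) obtain s2 u' where s2: "u' \<le> Z * t"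
      "reaches w P s1 u' s2" "rel S' H' s2" "pc s2 = pc s1 + clen c"
      by auto
    let ?s' = "s2\<lparr>pc := pc s + blen b + clen c + 1 + clen c'\<rparr>"
    have "reaches w P s2 1 ?s'"
      using If.prems(2) s1(4) s2(4) True by (auto intro!: reaches_step reaches_refl)
    from reaches_trans[OF reaches_trans[OF s1(2) s2(2)] this] show ?thesis
      using s1(1) s2(1,3) If.prems(3)
      by (intro exI[of _ ?s'] exI[of _ "u + u' + 1"]) auto
  next
    case False
    with If.IH[OF s1(3)] If.prems s1(4) obtain s2 u' where s2: "u' \<le> Z * t"
      "reaches w P s1 u' s2" "rel S' H' s2" "pc s2 = pc s1 + clen c'"
      by auto
    from reaches_trans[OF s1(2) s2(2)] show ?thesis
      using s1 s2 If.prems(3) False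
      by (intro exI[of _ s2] exI[of _ "u + u'"]) auto
  qed
next
  case (WhileF b S H c)
  from cbexp_correct[OF WhileF.prems(1) WhileF.hyps(1)] WhileF.prems(2) WhileF.hyps(2)
  obtain s1 u where s1: "u \<le> blen b"
    "reaches w P s u s1" "rel S H s1" "pc s1 = pc s + blen b + clen c + 1"
    by fastforce
  then show ?case
    using WhileF.prems(3) by (intro exI[of _ s1] exI[of _ u]) auto
next
  case (WhileT b S H c t S' H' t' S'' H'')
  from cbexp_correct[OF WhileT.prems(1) WhileT.hyps(1)] WhileT.prems(2) WhileT.hyps(2)
  obtain s1 u where s1: "u \<le> blen b"
    "reaches w P s u s1" "rel S H s1" "pc s1 = pc s + blen b"
    by fastforce
  from WhileT.IH(1)[OF s1(3)] WhileT.prems s1(4) obtain s2 u' where s2: "u' \<le> Z * t"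
    "reaches w P s1 u' s2" "rel S' H' s2" "pc s2 = pc s1 + clen c"
    by auto
  let ?s3 = "s2\<lparr>pc := pc s\<rparr>"
  have s3: "reaches w P s2 1 ?s3"
    using WhileT.prems(2) s1(4) s2(4) by (auto intro!: reaches_step reaches_refl)
  from WhileT.IH(2)[of ?s3] WhileT.prems s2(3) obtain s4 u'' where s4: "u'' \<le> Z * t'"
    "reaches w P ?s3 u'' s4" "rel S'' H'' s4" "pc s4 = pc s + clen (WHILE b DO c)"
    by auto
  from reaches_trans[OF reaches_trans[OF reaches_trans[OF s1(2) s2(2)] s3] s4(2)] show ?case
    using s1(1) s2(1) s4 WhileT.prems(3)
    by (intro exI[of _ s4] exI[of _ "u + u' + 1 + u''"]) (auto simp: algebra_simps)
qed

end

subsection \<open>Normalisation\<close>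

text \<open>For \<open>0 < x\<close> and \<open>x < p\<close>, the representative in
  \<open>{1..p div 2}\<close> of the class of \<open>x\<close> and \<open>- x\<close>.\<close>

definition absm :: "nat \<Rightarrow> nat \<Rightarrow> nat" where
  "absm p x = min x (p - x)"

lemma absm_eq_iff:
  assumes "0 < x" "x < p" "0 < y" "y < p"
  shows "absm p x = absm p y \<longleftrightarrow> x = y \<or> x + y = p"
  using assms unfolding absm_def by (auto simp: min_def)

lemma absm_bounds: "0 < x \<Longrightarrow> x < p \<Longrightarrow> 0 < absm p x \<and> 2 * absm p x \<le> p"
  unfolding absm_def by (auto simp: min_def)

lemma mod_less_sum_eq:
  assumes "0 < x" "x < p" "0 < y" "y < p" "p dvd x + y"
  shows "x + y = (p :: nat)"
proof -
  from assms(5) obtain q where q: "x + y = p * q" ..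
  then have "p * q < p * 2" "0 < p * q"
    using assms(1-4) by linarith+
  then have "q < 2" "0 < q"
    by (metis mult_less_cancel1, metis nat_0_less_mult_iff)
  then have "q = 1"
    by simp
  then show ?thesis
    using q by simp
qed

lemma scaled_nonzero:
  fixes p a r u :: nat
  assumes "prime p" "r * u mod p = 1" "0 < a" "a < p"
  shows "0 < a * r mod p" "a * r mod p < p"
proof -
  have "\<not> p dvd r"
  proof
    assume "p dvd r"
    then have "r * u mod p = 0"
      by (metis dvd_mult2 mod_0_imp_dvd dvd_imp_mod_0)
    then show False
      using assms(2) by simp
  qed
  moreover have "\<not> p dvd a"
    using assms(3,4) by (auto dest: dvd_imp_le)
  ultimately have "\<not> p dvd a * r"
    using assms(1) by (simp add: prime_dvd_mult_iff)
  then show "0 < a * r mod p"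
    by (simp add: dvd_eq_mod_eq_0)
  show "a * r mod p < p"
    using assms(4) by simp
qed

text \<open>Multiplication by a unit is injective and commutes with negation, so it permutes the
  classes up to sign. The two alternatives of \<open>absm_eq_iff\<close> are carried over one by
  one.\<close>

lemma absm_scaled:
  fixes p r u x y :: nat
  assumes p: "prime p" and r: "r * u mod p = 1" and x: "0 < x" "x < p" and y: "0 < y" "y < p"
  shows "absm p (x * r mod p) = absm p (y * r mod p) \<longleftrightarrow> absm p x = absm p y"
proof -
  have r': "\<not> p dvd r"
    using scaled_nonzero(1)[OF p r, of 1] p by (auto simp: dvd_eq_mod_eq_0 prime_gt_Suc_0_nat)
  have "x * r mod p = y * r mod p \<longleftrightarrow> x = y"
  proof
    assume "x * r mod p = y * r mod p"
    then have "[x * r = y * r] (mod p)"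
      by (simp add: cong_def)
    moreover have "coprime r p"
      using p r' by (metis coprime_commute prime_imp_coprime)
    ultimately have "[x = y] (mod p)"
      by (simp add: cong_mult_rcancel_nat)
    then show "x = y"
      using x y by (simp add: cong_def)
  qed simp
  moreover have "x * r mod p + y * r mod p = p \<longleftrightarrow> x + y = p"
  proof
    assume "x * r mod p + y * r mod p = p"
    then have "(x + y) * r mod p = 0"
      by (metis distrib_right mod_add_eq mod_self)
    then have "p dvd x + y"
      using p r' by (metis mod_0_imp_dvd prime_dvd_mult_iff)
    then show "x + y = p"
      using mod_less_sum_eq x y by blast
  next
    assume "x + y = p"
    then have "p dvd x * r + y * r"
      by (metis distrib_right dvd_triv_left)
    then have "p dvd x * r mod p + y * r mod p"
      by (simp add: dvd_eq_mod_eq_0 mod_add_eq)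
    then show "x * r mod p + y * r mod p = p"
      using mod_less_sum_eq[OF scaled_nonzero[OF p r x] scaled_nonzero[OF p r y]] by simp
  qed
  ultimately show ?thesis
    using scaled_nonzero[OF p r] x y by (simp add: absm_eq_iff)
qed

text \<open>Scaling merely renames the classes up to sign, and it turns that of \<open>u\<close>,
  the most frequent one, into that of 1.\<close>

lemma normalised_multiplicity:
  fixes p r u :: nat and a :: "nat \<Rightarrow> nat"
  assumes p: "prime p" and r: "r * u mod p = 1" and u: "0 < u" "u < p"
    and a: "\<And>i. i \<in> {1..<p} \<Longrightarrow> 0 < a i \<and> a i < p"
    and max: "\<And>v. card {i \<in> {1..<p}. absm p (a i) = v} \<le> card {i \<in> {1..<p}. absm p (a i) = absm p u}"
  shows "card {i \<in> {1..<p}. absm p (a i * r mod p) = x} \<le>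
    card {i \<in> {1..<p}. absm p (a i * r mod p) = 1}"
proof (cases "{i \<in> {1..<p}. absm p (a i * r mod p) = x} = {}")
  case False
  then obtain i where i: "i \<in> {1..<p}" "absm p (a i * r mod p) = x"
    by auto
  have "absm p (u * r mod p) = 1"
    using r p prime_ge_2_nat[OF p] by (simp add: mult.commute absm_def)
  then have one: "absm p (a j * r mod p) = 1 \<longleftrightarrow> absm p (a j) = absm p u" if "j \<in> {1..<p}" for j
    using absm_scaled[OF p r, of "a j" u] a[OF that] u by simp
  have "absm p (a j * r mod p) = x \<longleftrightarrow> absm p (a j) = absm p (a i)" if "j \<in> {1..<p}" for j
    using absm_scaled[OF p r, of "a j" "a i"] a[OF that] a[OF i(1)] i(2) by simp
  then have "{j \<in> {1..<p}. absm p (a j * r mod p) = x} = {j \<in> {1..<p}. absm p (a j) = absm p (a i)}"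
    by auto
  moreover have "{j \<in> {1..<p}. absm p (a j * r mod p) = 1} = {j \<in> {1..<p}. absm p (a j) = absm p u}"
    using one by auto
  ultimately show ?thesis
    using max by simp
next
  case True
  then show ?thesis
    by (metis card.empty le0)
qed

subsection \<open>Growth of sumsets\<close>

text \<open>The residue of \<open>x - d\<close>; adding \<open>p\<close> first keeps the natural
  subtraction exact for \<open>d \<le> p\<close>.\<close>

definition shift :: "nat \<Rightarrow> nat \<Rightarrow> nat \<Rightarrow> nat" where
  "shift p x d = (x + p - d) mod p"

text \<open>The sumset of \<open>S\<close> with the two residues 0 and \<open>d\<close>. It is
  written with preimages because the program decides about \<open>x\<close> by looking at
  \<open>x - d\<close>.\<close>

definition grow :: "nat \<Rightarrow> nat \<Rightarrow> nat set \<Rightarrow> nat set" where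
  "grow p d S = S \<union> {x. x < p \<and> shift p x d \<in> S}"

lemma shift_less: "0 < p \<Longrightarrow> shift p x d < p"
  by (simp add: shift_def)

lemma shift_le: "d \<le> x \<Longrightarrow> x < p \<Longrightarrow> shift p x d = x - d"
  unfolding shift_def by (metis Nat.add_diff_assoc2 less_imp_diff_less mod_add_self2 mod_less)

lemma shift_add: "d < p \<Longrightarrow> shift p ((x + d) mod p) d = x mod p"
  unfolding shift_def
proof -
  assume "d < p"
  then have "((x + d) mod p + p - d) mod p = ((x + d) mod p + (p - d)) mod p"
    by simp
  also have "\<dots> = (x + d + (p - d)) mod p"
    by (simp add: mod_add_left_eq)
  also have "\<dots> = x mod p"
    using \<open>d < p\<close> by simp
  finally show "((x + d) mod p + p - d) mod p = x mod p" .
qed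

lemma grow_subset: "S \<subseteq> {..<p} \<Longrightarrow> grow p d S \<subseteq> {..<p}"
  unfolding grow_def by auto

text \<open>If nothing is gained, \<open>S\<close> is closed under adding \<open>d\<close>. As it
  contains 0, it contains all multiples of \<open>d\<close>, and for prime \<open>p\<close> these
  are all residues.\<close>

lemma grow_card:
  assumes p: "prime p" and d: "0 < d" "d < p" and S: "S \<subseteq> {..<p}" "0 \<in> S"
  shows "S = {..<p} \<or> card S < card (grow p d S)"
proof (rule disjCI)
  assume "\<not> card S < card (grow p d S)"
  moreover have "finite (grow p d S)"
    using grow_subset[OF S(1)] finite_subset by blast
  ultimately have eq: "grow p d S = S"
    by (metis card_seteq grow_def linorder_not_less Un_upper1)
  have closed: "(x + d) mod p \<in> S" if "x \<in> S" for x
  proof -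
    have "shift p ((x + d) mod p) d = x"
      using shift_add[OF d(2), of x] that S(1) by auto
    then have "(x + d) mod p \<in> grow p d S"
      using that d unfolding grow_def by simp
    then show ?thesis
      using eq by simp
  qed
  have mult: "(n * d) mod p \<in> S" for n
  proof (induction n)
    case (Suc n)
    from closed[OF this] show ?case
      by (simp add: mod_add_left_eq add.commute mod_add_right_eq)
  qed (use S in simp)
  have "coprime d p"
    using p d by (metis coprime_commute nat_dvd_not_less prime_imp_coprime)
  then obtain e where e: "[d * e = 1] (mod p)"
    using cong_solve_coprime_nat by auto
  have "x \<in> S" if "x < p" for x
  proof -
    have "[x * e * d = x * 1] (mod p)"
      using cong_mult[OF cong_refl e, of x] by (simp add: ac_simps)
    then have "x * e * d mod p = x"
      using that by (simp add: cong_def)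
    then show ?thesis
      using mult[of "x * e"] by simp
  qed
  then show "S = {..<p}"
    using S(1) by auto
qed

text \<open>Every element of \<open>S\<close> has some offset \<open>e\<close> in a cyclic interval
  of \<open>W\<close> residues that lies in \<open>S\<close>. Unlike a decomposition into disjoint
  intervals, this property passes to translates and unions at once.\<close>

definition runs :: "nat \<Rightarrow> nat \<Rightarrow> nat set \<Rightarrow> bool" where
  "runs p W S \<longleftrightarrow> (\<forall>x\<in>S. \<exists>e<W. \<forall>f<W. (x + p - e + f) mod p \<in> S)"

lemma runs_interval: "W \<le> p \<Longrightarrow> runs p W {..<W}"
  unfolding runs_def
proof (intro ballI)
  fix x assume "W \<le> p" "x \<in> {..<W}"
  then show "\<exists>e<W. \<forall>f<W. (x + p - e + f) mod p \<in> {..<W}"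
    by (intro exI[of _ x]) auto
qed

lemma shift_shift:
  assumes "d \<le> p" "e \<le> p"
  shows "(shift p x d + p - e + f) mod p = shift p ((x + p - e + f) mod p) d"
proof -
  obtain D E where DE: "p = d + D" "p = e + E"
    using assms le_iff_add by metis
  then have "x + p - d = x + D" "x + p - e + f = x + E + f"
    "shift p x d + p - e + f = shift p x d + (E + f)"
    "(x + p - e + f) mod p + p - d = (x + p - e + f) mod p + D"
    by linarith+
  then have "(shift p x d + p - e + f) mod p = ((x + D) mod p + (E + f)) mod p"
    "shift p ((x + p - e + f) mod p) d = ((x + E + f) mod p + D) mod p"
    unfolding shift_def by (simp_all add: add.assoc)
  then show ?thesis
    unfolding mod_add_left_eq by (simp add: ac_simps)
qed

lemma runs_grow:
  assumes "runs p W S" "W \<le> p" "d < p"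
  shows "runs p W (grow p d S)"
  unfolding runs_def
proof
  fix x assume "x \<in> grow p d S"
  then consider "x \<in> S" | "x < p" "shift p x d \<in> S"
    unfolding grow_def by auto
  then show "\<exists>e<W. \<forall>f<W. (x + p - e + f) mod p \<in> grow p d S"
  proof cases
    case 1
    then show ?thesis
      using assms(1) unfolding runs_def grow_def by fastforce
  next
    case 2
    then obtain e where e: "e < W" "\<And>f. f < W \<Longrightarrow> (shift p x d + p - e + f) mod p \<in> S"
      using assms(1) unfolding runs_def by blast
    have "(x + p - e + f) mod p \<in> grow p d S" if "f < W" for f
      using e(2)[OF that] shift_shift[of d p e x f] assms e(1) unfolding grow_def by simp
    then show ?thesis
      using e(1) by blast
  qed
qed

text \<open>
  A run of length \<open>W\<close> that meets an interval of length at most \<open>W\<close> contains one of its endpoints.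
\<close>

lemma runs_gap:
  assumes "runs p W S" "W \<le> p" "d < p" "lo \<le> x" "x < hi" "hi \<le> p" "hi - lo \<le> W"
    and "shift p lo d \<notin> S" "shift p (hi - 1) d \<notin> S"
  shows "shift p x d \<notin> S"
proof
  assume "shift p x d \<in> S"
  then obtain e where e: "e < W" "\<And>f. f < W \<Longrightarrow> (shift p x d + p - e + f) mod p \<in> S"
    using assms(1) unfolding runs_def by blast
  \<comment> \<open>The member with offset \<open>f\<close> of the run of \<open>x\<close> sits at
    \<open>x - e + f\<close>. If \<open>e\<close> is at least \<open>x - lo\<close>, the run extends
    down to \<open>lo\<close>; otherwise \<open>hi - lo \<le> W\<close> makes it extend up to
    \<open>hi - 1\<close>. Either end contradicts its assumption.\<close>
  show False
  proof (cases "x - lo \<le> e")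
    case True
    have "e - (x - lo) < W"
      using e(1) by simp
    moreover have "(x + p - e + (e - (x - lo))) mod p = lo"
    proof -
      have "x + p - e + (e - (x - lo)) = p + lo"
        using True assms e(1) by linarith
      then show ?thesis
        using assms by simp
    qed
    ultimately show ?thesis
      using e(2)[of "e - (x - lo)"] shift_shift[of d p e x "e - (x - lo)"] assms e(1) by simp
  next
    case False
    then have "e + (hi - 1 - x) < W"
      using assms by linarith
    moreover have "(x + p - e + (e + (hi - 1 - x))) mod p = hi - 1"
    proof -
      have "x + p - e + (e + (hi - 1 - x)) = p + (hi - 1)"
        using False assms e(1) by linarith
      moreover have "hi - 1 < p"
        using assms by linarith
      ultimately show ?thesis
        by (metis mod_add_self1 mod_less)
    qed
    ultimately show ?thesis
      using e(2)[of "e + (hi - 1 - x)"] shift_shift[of d p e x "e + (hi - 1 - x)"] assms e(1) by simp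
  qed
qed

text \<open>
  As long as the set is an interval, a step of size at least 2 gains 2; the step that destroys the
  interval doubles the set, which makes up for the gain of only 1 in all later steps.
\<close>

definition big :: "nat \<Rightarrow> nat \<Rightarrow> nat \<Rightarrow> nat set \<Rightarrow> bool" where
  "big p L j S \<longleftrightarrow> S = {..<p} \<or> (\<exists>c. S = {..<c} \<and> L + 1 + 2 * j \<le> c \<and> c \<le> p) \<or> 2 * L + 1 + j \<le> card S"

text \<open>If \<open>d \<le> c\<close>, the interval and its translate join to an interval that is
  longer by \<open>d\<close>, or to everything. If \<open>c < d\<close>, then
  \<open>d + c < 2 * d \<le> p\<close> keeps the translate from wrapping around, so it is disjoint
  from the interval and the set has at least \<open>2 * c\<close> elements. From then on
  \<open>grow_card\<close> supplies one new residue per step.\<close>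

lemma big_grow:
  assumes p: "prime p" and d: "2 \<le> d" "2 * d \<le> p" and S: "S \<subseteq> {..<p}" "0 \<in> S" and "big p L j S"
  shows "big p L (Suc j) (grow p d S)"
proof -
  have dp: "d < p" "0 < d"
    using d by auto
  consider "S = {..<p}" | c where "S = {..<c}" "L + 1 + 2 * j \<le> c" "c \<le> p" | "2 * L + 1 + j \<le> card S"
    using assms(6) unfolding big_def by blast
  then show ?thesis
  proof cases
    case 1
    then have "grow p d S = {..<p}"
      using grow_subset[OF S(1), of d] unfolding grow_def by auto
    then show ?thesis
      unfolding big_def by simp
  next
    case (2 c)
    show ?thesis
    proof (cases "d \<le> c")
      case True
      have "x \<in> grow p d S \<longleftrightarrow> x < min p (c + d)" for x
      proof (cases "d \<le> x \<and> x < p")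
        case True
        then show ?thesis
          using 2 shift_le[of d x p] unfolding grow_def by auto
      next
        case False
        then show ?thesis
          using 2 \<open>d \<le> c\<close> dp unfolding grow_def by auto
      qed
      then have "grow p d S = {..<min p (c + d)}"
        by (simp add: set_eq_iff)
      then show ?thesis
        using 2(2) d unfolding big_def by (cases "p \<le> c + d") auto
    next
      case False
      have "{..<c} \<union> {d..<d + c} \<subseteq> grow p d S"
        using 2(1) shift_le[of d _ p] False d unfolding grow_def by auto
      then have "card ({..<c} \<union> {d..<d + c}) \<le> card (grow p d S)"
        using grow_subset[OF S(1)] by (intro card_mono) (auto intro: finite_subset)
      moreover have "card ({..<c} \<union> {d..<d + c}) = c + c"
        using False by (subst card_Un_disjoint) auto
      ultimately show ?thesis
        using 2(2) unfolding big_def by simp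
    qed
  next
    case 3
    show ?thesis
      using grow_card[OF p dp(2,1) S] 3 grow_subset[OF S(1), of d] unfolding big_def
      by (auto simp: grow_def)
  qed
qed

lemma big_full:
  assumes "big p L j S" "S \<subseteq> {..<p}" "p \<le> L + 1 + 2 * j" "p \<le> 2 * L + 1 + j"
  shows "S = {..<p}"
  using assms card_seteq[of "{..<p}" S] unfolding big_def by auto

subsection \<open>Moves\<close>

text \<open>
  A move flips the bits of one or two elements and thereby adds \<open>MD t\<close> to the selected sum. Moves are
  numbered downwards from \<open>p - 1\<close> to \<open>\<tau>\<close>, and \<open>T x\<close> is the number of the move that first
  reached the residue \<open>x\<close>, with \<open>T 0 = p\<close> and \<open>T x = 0\<close> for residues not yet reached. Index \<open>0\<close>
  stands for a missing second element, so that \<open>c 0 = 0\<close> makes its flip harmless. \<open>W i\<close> is the move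
  that uses element \<open>i\<close>, or \<open>0\<close>.
\<close>

definition wt :: "(nat \<Rightarrow> nat) \<Rightarrow> (nat \<Rightarrow> nat) \<Rightarrow> nat \<Rightarrow> int" where
  "wt c B i = (1 - 2 * int (B i)) * int (c i)"

definition moves :: "nat \<Rightarrow> (nat \<Rightarrow> nat) \<Rightarrow> nat \<Rightarrow> (nat \<Rightarrow> nat) \<Rightarrow> (nat \<Rightarrow> nat) \<Rightarrow> (nat \<Rightarrow> nat) \<Rightarrow>
    (nat \<Rightarrow> nat) \<Rightarrow> (nat \<Rightarrow> nat) \<Rightarrow> (nat \<Rightarrow> nat) \<Rightarrow> bool" where
  "moves p c \<tau> B W T MI MJ MD \<longleftrightarrow>
     \<tau> \<le> p \<and> T 0 = p \<and>
     (\<forall>x<p. x = 0 \<or> T x = 0 \<or> \<tau> \<le> T x \<and> T x < p \<and> T x < T (shift p x (MD (T x)))) \<and>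
     (\<forall>t. \<tau> \<le> t \<and> t < p \<longrightarrow> 0 < MI t \<and> MI t < p \<and> W (MI t) = t \<and> MJ t < p \<and>
        (MJ t \<noteq> 0 \<longrightarrow> W (MJ t) = t) \<and> MI t \<noteq> MJ t \<and> MD t < p \<and>
        [wt c B (MI t) + wt c B (MJ t) = int (MD t)] (mod int p)) \<and>
     (\<forall>t<\<tau>. MJ t = 0) \<and>
     (\<forall>i<p. B i \<le> 1 \<and> (W i \<noteq> 0 \<longrightarrow> \<tau> \<le> W i) \<and>
        (0 < i \<longrightarrow> W i = 0 \<longrightarrow> [wt c B i = int (absm p (c i))] (mod int p)))"

lemma moves_props:
  assumes "moves p c \<tau> B W T MI MJ MD" "\<tau> \<le> t" "t < p"
  shows "0 < MI t \<and> MI t < p \<and> W (MI t) = t \<and> MJ t < p \<and> (MJ t \<noteq> 0 \<longrightarrow> W (MJ t) = t) \<and>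
    MI t \<noteq> MJ t \<and> MD t < p \<and> [wt c B (MI t) + wt c B (MJ t) = int (MD t)] (mod int p)"
  using assms unfolding moves_def by blast

text \<open>The first elements of the moves are distinct and avoid \<open>i\<close>, so at most
  \<open>p - 2\<close> moves exist. Hence the next number is still positive and cannot be confused
  with the mark 0.\<close>

lemma moves_unused:
  assumes m: "moves p c \<tau> B W T MI MJ MD" and i: "i \<in> {1..<p}" "W i = 0" and "0 < \<tau>"
  shows "2 \<le> \<tau>"
proof -
  have "inj_on MI {\<tau>..<p}" "MI ` {\<tau>..<p} \<subseteq> {1..<p} - {i}"
  proof -
    show "inj_on MI {\<tau>..<p}"
      using m unfolding moves_def inj_on_def by (metis atLeastLessThan_iff)
    show "MI ` {\<tau>..<p} \<subseteq> {1..<p} - {i}"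
      using m i \<open>0 < \<tau>\<close> unfolding moves_def by force
  qed
  then have "card {\<tau>..<p} \<le> card ({1..<p} - {i})"
    by (intro card_inj_on_le[of MI]) auto
  then show ?thesis
    using i m unfolding moves_def by auto
qed

text \<open>The predecessor of \<open>x\<close> must carry a strictly larger number: numbers then
  increase along the way back, and tracing uses every move at most once.\<close>

lemma moves_time:
  assumes m: "moves p c \<tau> B W T MI MJ MD" and "0 < \<tau>" "\<tau> < p"
    and x: "0 < x" "x < p" "T x = 0" "\<tau> < T (shift p x (MD \<tau>))"
  shows "moves p c \<tau> B W (T(x := \<tau>)) MI MJ MD"
proof -
  let ?T = "T(x := \<tau>)"
  have "y = 0 \<or> ?T y = 0 \<or> \<tau> \<le> ?T y \<and> ?T y < p \<and> ?T y < ?T (shift p y (MD (?T y)))"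
    if "y < p" for y
  proof (cases "y = x")
    case True
    then show ?thesis
      using x assms(3) by auto
  next
    case False
    have "y = 0 \<or> T y = 0 \<or> \<tau> \<le> T y \<and> T y < p \<and> T y < T (shift p y (MD (T y)))"
      using m that unfolding moves_def by blast
    then show ?thesis
      using False x by auto
  qed
  moreover have "?T 0 = p"
    using m x unfolding moves_def by auto
  ultimately show ?thesis
    using m unfolding moves_def by blast
qed

lemma moves_single:
  assumes m: "moves p c \<tau> B W T MI MJ MD" and t: "\<tau> = Suc t" and "0 < t"
    and i: "0 < i" "i < p" "W i = 0" and c: "c 0 = 0" "0 < c i" "c i < p"
  shows "moves p c t B (W(i := t)) T (MI(t := i)) MJ (MD(t := absm p (c i)))"
proof -
  have md: "absm p (c i) < p"
    using c unfolding absm_def by simp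
  have zero: "wt c B 0 = 0"
    using c by (simp add: wt_def)
  have "x = 0 \<or> T x = 0 \<or> t \<le> T x \<and> T x < p \<and> T x < T (shift p x ((MD(t := absm p (c i))) (T x)))"
    if "x < p" for x
    using m that t unfolding moves_def by auto
  moreover have "0 < MI' s \<and> MI' s < p \<and> (W(i := t)) (MI' s) = s \<and> MJ s < p \<and>
        (MJ s \<noteq> 0 \<longrightarrow> (W(i := t)) (MJ s) = s) \<and> MI' s \<noteq> MJ s \<and> (MD(t := absm p (c i))) s < p \<and>
        [wt c B (MI' s) + wt c B (MJ s) = int ((MD(t := absm p (c i))) s)] (mod int p)"
    if MI': "MI' = MI(t := i)" and s: "t \<le> s" "s < p" for s MI'
  proof (cases "s = t")
    case True
    \<comment> \<open>Entries of \<open>MJ\<close> below \<open>\<tau>\<close> are untouched, so the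
      new move has no second element.\<close>
    have "MJ t = 0"
      using m t unfolding moves_def by auto
    moreover have "[wt c B i = int (absm p (c i))] (mod int p)"
      using m i unfolding moves_def by auto
    ultimately show ?thesis
      using True md MI' i zero by simp
  next
    case False
    then have s': "\<tau> \<le> s" "s \<noteq> 0"
      using s t by auto
    note H = moves_props[OF m s'(1) s(2)]
    show ?thesis
      using H False s' i MI' by auto
  qed
  moreover have "B j \<le> 1 \<and> ((W(i := t)) j \<noteq> 0 \<longrightarrow> t \<le> (W(i := t)) j) \<and>
        (0 < j \<longrightarrow> (W(i := t)) j = 0 \<longrightarrow> [wt c B j = int (absm p (c j))] (mod int p))" if "j < p" for j
    using m that t \<open>0 < t\<close> unfolding moves_def by auto
  moreover have "t \<le> p" "T 0 = p" "\<forall>s<t. MJ s = 0"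
    using m t unfolding moves_def by auto
  ultimately show ?thesis
    unfolding moves_def by blast
qed

lemma moves_pair:
  assumes m: "moves p c \<tau> B W T MI MJ MD" and t: "\<tau> = Suc t" and "0 < t"
    and i: "0 < i" "i < p" "W i = 0" and j: "0 < j" "j < p" "W j = 0"
    and lt: "absm p (c j) < absm p (c i)" and c: "0 < c i" "c i < p"
  shows "moves p c t (B(j := 1 - B j)) (W(j := t, i := t)) T (MI(t := i)) (MJ(t := j))
    (MD(t := absm p (c i) - absm p (c j)))"
proof -
  let ?B = "B(j := 1 - B j)" and ?W = "W(j := t, i := t)" and ?MI = "MI(t := i)"
    and ?MJ = "MJ(t := j)" and ?d = "absm p (c i) - absm p (c j)"
  let ?MD = "MD(t := ?d)"
  have ij: "i \<noteq> j"
    using lt by auto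
  have md: "?d < p"
    using c unfolding absm_def by simp
  have B: "B j \<le> 1" "B i \<le> 1"
    using m i j unfolding moves_def by auto
  have "x = 0 \<or> T x = 0 \<or> t \<le> T x \<and> T x < p \<and> T x < T (shift p x (?MD (T x)))"
    if "x < p" for x
    using m that t unfolding moves_def by auto
  moreover have "0 < ?MI s \<and> ?MI s < p \<and> ?W (?MI s) = s \<and> ?MJ s < p \<and>
        (?MJ s \<noteq> 0 \<longrightarrow> ?W (?MJ s) = s) \<and> ?MI s \<noteq> ?MJ s \<and> ?MD s < p \<and>
        [wt c ?B (?MI s) + wt c ?B (?MJ s) = int (?MD s)] (mod int p)"
    if s: "t \<le> s" "s < p" for s
  proof (cases "s = t")
    case True
    have "[wt c B i = int (absm p (c i))] (mod int p)" "[wt c B j = int (absm p (c j))] (mod int p)"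
      using m i j unfolding moves_def by auto
    then have "[wt c B i - wt c B j = int (absm p (c i)) - int (absm p (c j))] (mod int p)"
      by (rule cong_diff)
    moreover have "wt c ?B i = wt c B i" "wt c ?B j = - wt c B j"
      using ij B unfolding wt_def by (auto simp: of_nat_diff algebra_simps)
    ultimately show ?thesis
      using True i j ij md lt by (simp add: of_nat_diff)
  next
    case False
    then have s': "\<tau> \<le> s" "s \<noteq> 0"
      using s t by auto
    note H = moves_props[OF m s'(1) s(2)]
    have "MI s \<noteq> j" "MJ s \<noteq> j" "MI s \<noteq> i" "MJ s \<noteq> i"
      using H s' i j by auto
    then show ?thesis
      using False H unfolding wt_def by simp
  qed
  moreover have "?B k \<le> 1 \<and> (?W k \<noteq> 0 \<longrightarrow> t \<le> ?W k) \<and>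
        (0 < k \<longrightarrow> ?W k = 0 \<longrightarrow> [wt c ?B k = int (absm p (c k))] (mod int p))" if "k < p" for k
  proof -
    have H: "B k \<le> 1 \<and> (W k \<noteq> 0 \<longrightarrow> \<tau> \<le> W k) \<and>
        (0 < k \<longrightarrow> W k = 0 \<longrightarrow> [wt c B k = int (absm p (c k))] (mod int p))"
      using m that unfolding moves_def by blast
    show ?thesis
      using H t \<open>0 < t\<close> unfolding wt_def by auto
  qed
  moreover have "t \<le> p" "T 0 = p" "\<forall>s<t. ?MJ s = 0"
    using m t unfolding moves_def by auto
  ultimately show ?thesis
    unfolding moves_def by blast
qed

definition bsum :: "nat \<Rightarrow> (nat \<Rightarrow> nat) \<Rightarrow> (nat \<Rightarrow> nat) \<Rightarrow> int" where
  "bsum p c B = (\<Sum>i<p. int (B i) * int (c i))"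

lemma bsum_flip:
  assumes "i < p" "B i \<le> 1"
  shows "bsum p c (B(i := 1 - B i)) = bsum p c B + wt c B i"
proof -
  have "bsum p c B' = int (B' i) * int (c i) + (\<Sum>j\<in>{..<p} - {i}. int (B' j) * int (c j))" for B'
    unfolding bsum_def using assms by (subst sum.remove[of _ i]) auto
  note this[of B] this[of "B(i := 1 - B i)"]
  moreover have "(\<Sum>j\<in>{..<p} - {i}. int ((B(i := 1 - B i)) j) * int (c j)) =
    (\<Sum>j\<in>{..<p} - {i}. int (B j) * int (c j))"
    by (intro sum.cong) auto
  ultimately show ?thesis
    using assms by (simp add: wt_def of_nat_diff algebra_simps)
qed

lemma shift_cong:
  assumes "d < p"
  shows "[int (shift p x d) = int x - int d] (mod int p)"
proof -
  have "int (shift p x d) = (int x + int p - int d) mod int p"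
    using assms unfolding shift_def by (simp add: of_nat_mod of_nat_diff)
  also have "\<dots> = (int x - int d) mod int p"
    by (metis add_diff_eq diff_add_eq mod_add_self2)
  finally show ?thesis
    by (simp add: cong_def)
qed

text \<open>Applying move \<open>t\<close> adds \<open>MD t\<close> to the selected sum and takes it
  from the residue still to be produced, so the total is unchanged. \<open>B'\<close> agrees with
  \<open>B\<close> on the elements of all moves from \<open>t\<close> on, hence the flips act on the
  very bits for which \<open>MD t\<close> was computed; because \<open>t < T x'\<close>, enough
  agreement is left for the next move.\<close>

lemma moves_backtrace:
  assumes m: "moves p c \<tau> B W T MI MJ MD" and x: "0 < x" "x < p" "T x = t" "t \<noteq> 0" and c: "c 0 = 0"
    and B': "\<And>i. i < p \<Longrightarrow> B' i \<le> 1" "\<And>i. 0 < i \<Longrightarrow> i < p \<Longrightarrow> t \<le> W i \<Longrightarrow> B' i = B i"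
    and B'': "B'' = B'(MI t := 1 - B' (MI t))" "B''' = B''(MJ t := 1 - B'' (MJ t))"
    and x': "x' = shift p x (MD t)"
  shows "MI t < p" "MJ t < p" "MD t < p" "t < T x'" "x' < p"
    "[int x' + bsum p c B''' = int x + bsum p c B'] (mod int p)"
    "i < p \<Longrightarrow> B''' i \<le> 1"
    "0 < i \<Longrightarrow> i < p \<Longrightarrow> t < W i \<Longrightarrow> B''' i = B i"
proof -
  have t: "\<tau> \<le> t" "t < p" "t < T x'"
    using m x x' unfolding moves_def by auto
  have mi: "0 < MI t" "MI t < p" "W (MI t) = t" "MJ t < p" "MJ t \<noteq> 0 \<Longrightarrow> W (MJ t) = t"
    "MI t \<noteq> MJ t" "MD t < p" "[wt c B (MI t) + wt c B (MJ t) = int (MD t)] (mod int p)"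
    using m t unfolding moves_def by auto
  show "MI t < p" "MJ t < p" "MD t < p" "t < T x'" "x' < p"
    using mi t x' x by (auto intro: shift_less)
  have "B'' (MJ t) \<le> 1"
    using B'(1) mi(4) B''(1) by simp
  then have "bsum p c B''' = bsum p c B' + wt c B' (MI t) + wt c B'' (MJ t)"
    unfolding B''(2) using bsum_flip[OF mi(4), of B''] bsum_flip[OF mi(2), of B'] B'(1)[OF mi(2)] B''(1) by simp
  moreover have "wt c B' (MI t) = wt c B (MI t)"
    using B'(2) mi unfolding wt_def by simp
  \<comment> \<open>For \<open>MJ t = 0\<close> both sides vanish, as \<open>c 0 = 0\<close>.
    Otherwise \<open>MI t \<noteq> MJ t\<close> keeps the first flip away from this bit.\<close>
  moreover have "wt c B'' (MJ t) = wt c B (MJ t)"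
    using B'(2)[of "MJ t"] mi c B'' unfolding wt_def by (cases "MJ t = 0") auto
  ultimately have "bsum p c B''' = bsum p c B' + (wt c B (MI t) + wt c B (MJ t))"
    by simp
  then have "[int x' + bsum p c B''' = (int x - int (MD t)) + (bsum p c B' + int (MD t))] (mod int p)"
    using cong_add[OF shift_cong[OF mi(7)] cong_add[OF cong_refl mi(8)]] x' by simp
  then show "[int x' + bsum p c B''' = int x + bsum p c B'] (mod int p)"
    by simp
  show "B''' i \<le> 1" if "i < p"
    using B'(1)[OF that] B'' by auto
  show "B''' i = B i" if "0 < i" "i < p" "t < W i"
    using that B'(2) mi B'' by auto
qed

text \<open>Pairing off different values leaves a single value, hence at most \<open>m\<close> elements, in each bucket.\<close>

lemma leftover_bound:
  fixes v :: "nat \<Rightarrow> nat"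
  assumes U: "U \<subseteq> {1..<p}" and v: "\<And>i. i \<in> U \<Longrightarrow> 2 * v i \<le> p"
    and mult: "\<And>x. card {i \<in> {1..<p}. v i = x} \<le> m"
    and same: "\<And>i j. i \<in> U \<Longrightarrow> j \<in> U \<Longrightarrow> v i div (m + 1) = v j div (m + 1) \<Longrightarrow> v i = v j"
  shows "2 * card U \<le> p + 2 * m"
proof -
  let ?h = "p div 2"
  let ?Q = "?h div (m + 1)"
  have "v i div (m + 1) \<le> ?Q" if "i \<in> U" for i
    using v[OF that] by (intro div_le_mono) simp
  then have "card U = card (\<Union>q\<in>{..?Q}. {i \<in> U. v i div (m + 1) = q})"
    by (intro arg_cong[of _ _ card]) auto
  also have "\<dots> \<le> (\<Sum>q\<le>?Q. card {i \<in> U. v i div (m + 1) = q})"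
    by (rule card_UN_le) simp
  also have "\<dots> \<le> (\<Sum>q\<le>?Q. m)"
  proof (rule sum_mono)
    fix q
    show "card {i \<in> U. v i div (m + 1) = q} \<le> m"
    proof (cases "{i \<in> U. v i div (m + 1) = q} = {}")
      case False
      then obtain i where i: "i \<in> U" "v i div (m + 1) = q"
        by auto
      have "v j = v i" if "j \<in> U" "v j div (m + 1) = q" for j
        using same[OF that(1) i(1)] that(2) i(2) by simp
      then have "{j \<in> U. v j div (m + 1) = q} \<subseteq> {j \<in> {1..<p}. v j = v i}"
        using U by blast
      then show ?thesis
        by (intro order_trans[OF card_mono mult[of "v i"]]) auto
    next
      case True
      then show ?thesis
        by (metis card.empty le0)
    qed
  qed
  also have "\<dots> = ?Q * m + m"
    by simp
  \<comment> \<open>There are \<open>?Q + 1\<close> buckets: since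
    \<open>?Q * (m + 1) \<le> ?h\<close>, all but one are covered by \<open>?h\<close>, and the
    remaining one costs the extra \<open>m\<close>.\<close>
  also have "?Q * m \<le> ?h"
    by (metis add_leD1 div_times_less_eq_dividend mult_Suc_right Suc_eq_plus1 add.commute)
  finally show ?thesis
    by simp
qed

lemma unscale_cong:
  fixes p r u k :: nat and a :: "nat \<Rightarrow> nat"
  assumes "r * u mod p = 1" "[(\<Sum>i\<in>I. a i * r mod p) = k * r] (mod p)"
  shows "[(\<Sum>i\<in>I. a i) = k] (mod p)"
proof -
  have p: "[r * u = 1] (mod p)"
    using assms(1) by (metis cong_def mod_mod_trivial)
  have "[(\<Sum>i\<in>I. a i * r mod p) = (\<Sum>i\<in>I. a i * r)] (mod p)"
    by (intro cong_sum) (simp add: cong_def)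
  then have "[(\<Sum>i\<in>I. a i) * r = k * r] (mod p)"
    using assms(2) by (metis cong_sym cong_trans sum_distrib_right)
  then have "[(\<Sum>i\<in>I. a i) * r * u = k * r * u] (mod p)"
    by (rule cong_scalar_right)
  moreover have "[x * r * u = x] (mod p)" for x
    using cong_scalar_left[OF p, of x] by (simp add: mult.assoc)
  ultimately show ?thesis
    by (meson cong_sym cong_trans)
qed

subsection \<open>The algorithm\<close>

datatype var =
  Vp | Vu | Vr | Vi | Vv | VL | Vx | Vt | Vb | Vn | Vj | Vd | Ve | VW | VC | Vg | Vlo | Vhi

datatype arr =
  AIn | ACnt | AVal | AC | ABit | AOwn | ATime | AI | AJ | AD | AH | ASt | ALo | AHi

text \<open>
  \<open>AC\<close> and \<open>AVal\<close> hold the scaled elements \<open>c i\<close> and their absolute values, \<open>ABit\<close> the current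
  selection. The arrays \<open>AOwn\<close>, \<open>ATime\<close>, \<open>AI\<close>, \<open>AJ\<close>, \<open>AD\<close> are the functions \<open>W\<close>, \<open>T\<close>, \<open>MI\<close>, \<open>MJ\<close>,
  \<open>MD\<close> of \<open>moves\<close>, and \<open>Vt\<close> is its \<open>\<tau>\<close>. Bucket \<open>q\<close> is a stack of height \<open>AH q\<close> in the cells of
  \<open>ASt\<close> from \<open>q * p\<close> on. The interval reached by the pairs is \<open>{0..VL}\<close>; the unreached part of
  the \<open>g\<close>-th block of length \<open>VL + 1\<close> behind it is \<open>{ALo g..<AHi g}\<close>.
\<close>

type_synonym prog = "(var, arr) com"

abbreviation plus_expr (infixl \<open>\<oplus>\<close> 65) where "e \<oplus> e' \<equiv> Op WAdd e e'"
abbreviation minus_expr (infixl \<open>\<ominus>\<close> 65) where "e \<ominus> e' \<equiv> Op WSub e e'"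
abbreviation times_expr (infixl \<open>\<otimes>\<close> 70) where "e \<otimes> e' \<equiv> Op WMul e e'"
abbreviation div_expr (infixl \<open>\<oslash>\<close> 70) where "e \<oslash> e' \<equiv> Op WDiv e e'"
abbreviation mod_expr (infixl \<open>\<odot>\<close> 70) where "e \<odot> e' \<equiv> Op WMod e e'"

text \<open>The idle assignment in the second branch makes both branches take the same time, so that
  \<open>wp_abs_step\<close> is a plain equivalence. The same holds for
  \<open>argmax_step\<close>.\<close>

definition abs_step :: prog where
  "abs_step =
     IF Lt (Var Vp \<ominus> Var Vv) (Var Vv) THEN Vv ::= Var Vp \<ominus> Var Vv ELSE Vv ::= Var Vv"

definition argmax_step :: prog where
  "argmax_step =
     IF Lt (Get ACnt (Var Vu)) (Get ACnt (Var Vv)) THEN Vu ::= Var Vv ELSE Vu ::= Var Vu"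

definition count_body :: prog where
  "count_body =
     Vv ::= Get AIn (Var Vi \<oplus> Num 1);;
     abs_step;;
     ACnt[Var Vv] ::= Get ACnt (Var Vv) \<oplus> Num 1;;
     argmax_step;;
     Vi ::= Var Vi \<oplus> Num 1"

definition count_pass :: prog where
  "count_pass =
     Vp ::= Get AIn (Num 0);;
     Vi ::= Num 1;;
     Vu ::= Num 0;;
     WHILE Lt (Var Vi) (Var Vp) DO count_body"

text \<open>Only one inverse is needed, so a linear search is affordable. The product is never 0
  modulo \<open>p\<close>, hence the test fails only at an inverse.\<close>

definition inverse_pass :: prog where
  "inverse_pass =
     Vr ::= Num 1;;
     WHILE Lt (Num 1) (Var Vr \<otimes> Var Vu \<odot> Var Vp) DO Vr ::= Var Vr \<oplus> Num 1"

text \<open>An element whose scaled value exceeds \<open>p / 2\<close> starts out selected: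
  deselecting it subtracts that value, which modulo \<open>p\<close> adds its absolute
  value.\<close>

definition scale_body :: prog where
  "scale_body =
     Vv ::= Get AIn (Var Vi \<oplus> Num 1) \<otimes> Var Vr \<odot> Var Vp;;
     AC[Var Vi] ::= Var Vv;;
     (IF Lt (Var Vp \<ominus> Var Vv) (Var Vv)
      THEN (Vv ::= Var Vp \<ominus> Var Vv;; ABit[Var Vi] ::= Num 1)
      ELSE (Vv ::= Var Vv;; ABit[Var Vi] ::= Num 0));;
     AVal[Var Vi] ::= Var Vv;;
     Vi ::= Var Vi \<oplus> Num 1"

definition scale_pass :: prog where
  "scale_pass =
     Vx ::= Get AIn (Num 1) \<otimes> Var Vr \<odot> Var Vp;;
     Vi ::= Num 1;;
     WHILE Lt (Var Vi) (Var Vp) DO scale_body"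

definition ones_body :: prog where
  "ones_body =
     (IF Neq (Get AVal (Var Vi)) (Num 1)
      THEN Skip
      ELSE (Vt ::= Var Vt \<ominus> Num 1;;
            AOwn[Var Vi] ::= Var Vt;;
            AI[Var Vt] ::= Var Vi;;
            AD[Var Vt] ::= Num 1;;
            VL ::= Var VL \<oplus> Num 1;;
            ATime[Var VL] ::= Var Vt));;
     Vi ::= Var Vi \<oplus> Num 1"

definition ones_pass :: prog where
  "ones_pass =
     ATime[Num 0] ::= Var Vp;;
     VL ::= Num 0;;
     Vt ::= Var Vp;;
     Vi ::= Num 1;;
     WHILE Lt (Var Vi) (Var Vp) DO ones_body"

lemma wp_abs_step:
  "s Vv \<le> s Vp \<Longrightarrow>
   wp M N abs_step Q s H n \<longleftrightarrow> Q (s(Vv := absm (s Vp) (s Vv))) H (Suc (Suc n))"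
  by (auto simp: abs_step_def absm_def min_def)

lemma wp_argmax_step:
  "s Vu < N \<Longrightarrow> s Vv < N \<Longrightarrow>
   wp M N argmax_step Q s H n \<longleftrightarrow>
   Q (s(Vu := if H ACnt (s Vu) < H ACnt (s Vv) then s Vv else s Vu)) H (Suc (Suc n))"
  by (auto simp: argmax_step_def)

definition zeros :: "arr set \<Rightarrow> arr heap \<Rightarrow> bool" where
  "zeros Z H \<longleftrightarrow> (\<forall>A\<in>Z. H A = (\<lambda>_. 0))"

lemma zeros_upd [simp]: "A \<notin> Z \<Longrightarrow> zeros Z (H(A := f)) \<longleftrightarrow> zeros Z H"
  unfolding zeros_def by (metis fun_upd_other)

lemma zeros_mono: "zeros Z H \<Longrightarrow> Z' \<subseteq> Z \<Longrightarrow> zeros Z' H"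
  unfolding zeros_def by blast

lemma zerosD: "zeros Z H \<Longrightarrow> A \<in> Z \<Longrightarrow> H A i = 0"
  unfolding zeros_def by simp

lemma card_filter_Suc:
  assumes "0 < i"
  shows "card {j \<in> {1..<Suc i}. f j = v} = card {j \<in> {1..<i}. f j = v} + (if f i = v then 1 else 0)"
proof -
  have "{j \<in> {1..<Suc i}. f j = v} = {j \<in> {1..<i}. f j = v} \<union> (if f i = v then {i} else {})"
    using assms by (auto simp: less_Suc_eq)
  then show ?thesis
    by (auto simp: card_insert_if)
qed

text \<open>Array indices range below \<open>p * p\<close> because \<open>ASt\<close> reserves
  \<open>p\<close> cells for each of up to \<open>p\<close> buckets. The linear slack covers sums
  such as \<open>x + p\<close> and the small constants.\<close>

locale word_bounds =
  fixes p M :: nat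
  assumes p: "prime p" and M: "p * p + 60 * p + 60 < M"
begin

abbreviation "wpp \<equiv> wp M (p * p)"

lemma p2: "2 \<le> p"
  using p prime_ge_2_nat by blast

lemma index_bound: "x \<le> p \<Longrightarrow> x < p * p"
proof -
  assume "x \<le> p"
  moreover have "p * 2 \<le> p * p"
    using p2 by (intro mult_le_mono2)
  ultimately show ?thesis
    using p2 by linarith
qed

lemma prod_bound: "x < p \<Longrightarrow> y < p \<Longrightarrow> x * y < M"
  using mult_strict_mono[of x p y p] M by simp

end

section \<open>The most frequent class, its inverse, and scaling\<close>

locale input = word_bounds +
  fixes k :: nat and a :: "nat \<Rightarrow> nat"
  assumes k: "k < p" and a: "\<And>i. i \<in> {1..<p} \<Longrightarrow> 0 < a i \<and> a i < p"
begin

definition inp :: "arr heap \<Rightarrow> bool" where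
  "inp H \<longleftrightarrow> H AIn 0 = p \<and> H AIn 1 = k \<and> (\<forall>i\<in>{1..<p}. H AIn (Suc i) = a i)"

lemma inp_upd [simp]: "A \<noteq> AIn \<Longrightarrow> inp (H(A := f)) \<longleftrightarrow> inp H"
  by (simp add: inp_def)

lemma wp_count:
  assumes "inp H" and zero: "zeros (- {AIn}) H"
    and Q: "\<And>s' H' n'. s' Vp = p \<Longrightarrow> inp H' \<Longrightarrow> zeros (- {AIn, ACnt}) H'  \<Longrightarrow>
      0 < s' Vu \<Longrightarrow> s' Vu < p \<Longrightarrow>
      (\<And>v. card {i \<in> {1..<p}. absm p (a i) = v} \<le> card {i \<in> {1..<p}. absm p (a i) = absm p (s' Vu)}) \<Longrightarrow>
      n' \<le> n + 20 * p \<Longrightarrow> Q s' H' n'"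
  shows "wpp count_pass Q s H n"
proof -
  define cnt where "cnt i v = card {j \<in> {1..<i}. absm p (a j) = v}" for i v
  let ?I = "\<lambda>s' H' n'. s' Vp = p \<and> inp H' \<and> zeros (- {AIn, ACnt}) H'  \<and>
    0 < s' Vi \<and> s' Vi \<le> p \<and> (\<forall>v<p. H' ACnt v = cnt (s' Vi) v) \<and> 2 * s' Vu \<le> p \<and>
    (\<forall>v<p. cnt (s' Vi) v \<le> cnt (s' Vi) (s' Vu)) \<and> n' \<le> n + 10 * s' Vi"
  have body: "wpp count_body (\<lambda>s' H' n'. ?I s' H' n' \<and> p - s' Vi < p - s Vi) s H (Suc n')"
    if I: "?I s H n'" and "s Vi < p" for s H n'
  proof -
    have i: "s Vi \<in> {1..<p}"
      using that by simp
    have a': "0 < a (s Vi)" "a (s Vi) < p" "H AIn (Suc (s Vi)) = a (s Vi)"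
      using a[OF i] I i by (auto simp: inp_def)
    let ?v = "absm p (a (s Vi))"
    have v: "?v < p" "2 * ?v \<le> p" "s Vu < p"
      using absm_bounds[OF a'(1,2)] I p2 by auto
    have mx: "cnt (s Vi) x \<le> cnt (s Vi) (s Vu)" if "x < p" for x
      using I that by simp
    have cnt_Suc: "cnt (Suc (s Vi)) x = cnt (s Vi) x + (if ?v = x then 1 else 0)" for x
      using I unfolding cnt_def by (intro card_filter_Suc) simp
    have le: "cnt (s Vi) x \<le> p" for x
      using card_mono[of "{1..<s Vi}" "{j \<in> {1..<s Vi}. absm p (a j) = x}"] \<open>s Vi < p\<close>
      unfolding cnt_def by (auto simp del: atLeastLessThan_iff intro: order_trans)
    have less: "?v < p * p" "s Vu < p * p" "Suc (s Vi) < p * p" "cnt (s Vi) ?v + 1 < M" "Suc (s Vi) < M" "1 < M"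
      using index_bound v \<open>s Vi < p\<close> le[of ?v] M by auto
    show ?thesis
      using I a' v less \<open>s Vi < p\<close> unfolding count_body_def
      by (simp add: wp_abs_step wp_argmax_step cnt_Suc)
        (auto simp: diff_less_mono2 less_Suc_eq_le intro!: le_SucI intro: order_trans[OF mx])
  qed
  have loop: "wpp (WHILE Lt (Var Vi) (Var Vp) DO count_body) Q s H n'"
    if "?I s H n'" for s H n'
    using that
  proof (rule wp_While[where I = ?I and \<mu> = "\<lambda>s H. p - s Vi"])
    fix s H n'
    assume I: "?I s H n'" and "\<not> bval (Lt (Var Vi) (Var Vp)) s H"
    then have i: "s Vi = p"
      by simp
    let ?w = "absm p (a 1)"
    have "1 \<in> {1..<p}"
      using p2 by simp
    from a[OF this] have w: "2 * ?w \<le> p" "0 < ?w"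
      using absm_bounds by auto
    \<comment> \<open>\<open>Vu\<close> starts at 0, which is no class. Some class occurs, so the
      maximal count is positive, and it is attained by the class of an actual element.\<close>
    have "0 < cnt p ?w"
      using \<open>1 \<in> {1..<p}\<close> unfolding cnt_def by (subst card_gt_0_iff) auto
    also have "\<dots> \<le> cnt p (s Vu)"
      using I i w p2 by auto
    finally obtain j where j: "j \<in> {1..<p}" "absm p (a j) = s Vu"
      unfolding cnt_def by (auto simp: card_gt_0_iff)
    then have u: "0 < s Vu"
      using absm_bounds[of "a j" p] a[OF j(1)] by simp
    have absm_u: "absm p (s Vu) = s Vu"
      using I by (auto simp: absm_def)
    have "cnt p v \<le> cnt p (s Vu)" for v
    proof (cases "v < p")
      case False
      have "absm p (a j) < p" if "j \<in> {1..<p}" for j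
        using a[OF that] by (auto simp: absm_def)
      then have "{j \<in> {1..<p}. absm p (a j) = v} = {}"
        using False by auto
      then show ?thesis
        unfolding cnt_def by (metis card.empty le0)
    qed (use I i in auto)
    then show "Q s H (Suc n')"
      using I i u absm_u p2 by (intro Q) (auto simp: cnt_def)
  qed (use body in auto)
  show ?thesis
    unfolding count_pass_def using assms(1) zero p2 M zeros_mono[OF zero, of "- {AIn, ACnt}"] zerosD[OF zero, of ACnt]
    by (simp add: inp_def) (rule loop, auto simp: inp_def cnt_def)
qed

lemma wp_inverse:
  assumes "s Vp = p" "0 < s Vu" "s Vu < p"
    and Q: "\<And>r n'. r < p \<Longrightarrow> r * s Vu mod p = 1 \<Longrightarrow> n' \<le> n + 20 * p \<Longrightarrow> Q (s(Vr := r)) H n'"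
  shows "wpp inverse_pass Q s H n"
proof -
  have "coprime (s Vu) p"
    using p assms(2,3) by (metis coprime_commute nat_dvd_not_less prime_imp_coprime)
  then obtain e' where e': "[s Vu * e' = 1] (mod p)"
    using cong_solve_coprime_nat by auto
  \<comment> \<open>The reduced inverse bounds the search: the counter starts at 1 and cannot pass
    \<open>e\<close>.\<close>
  define e where "e = e' mod p"
  have e: "e * s Vu mod p = 1" "e < p"
    using e' p2 unfolding e_def by (auto simp: cong_def mult.commute mod_mult_right_eq)
  have "0 < e"
    using e(1) by (cases e) auto
  let ?I = "\<lambda>s' H' n'. s' = s(Vr := s' Vr) \<and> H' = H \<and> 0 < s' Vr \<and> s' Vr \<le> e \<and> n' \<le> n + 2 * s' Vr"
  have loop: "wpp (WHILE Lt (Num 1) (Var Vr \<otimes> Var Vu \<odot> Var Vp) DO Vr ::= Var Vr \<oplus> Num 1) Q s' H' n'"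
    if "?I s' H' n'" for s' H' n'
    using that
  proof (rule wp_While[where I = ?I and \<mu> = "\<lambda>s H. p - s Vr"])
    fix s' H' n'
    assume I: "?I s' H' n'"
    have eq: "s' = s(Vr := s' Vr)"
      using I by (rule conjunct1)
    have u: "s' Vu = s Vu" "s' Vp = p"
      using assms(1) by (subst eq, simp)+
    show "bok M (p * p) (Lt (Num 1) (Var Vr \<otimes> Var Vu \<odot> Var Vp)) s' H'"
      using prod_bound[of "s' Vr" "s Vu"] I e(2) assms(3) M u by simp
    show "wpp (Vr ::= Var Vr \<oplus> Num 1) (\<lambda>s'' H'' n''. ?I s'' H'' n'' \<and> p - s'' Vr < p - s' Vr) s' H' (Suc n')"
      if "bval (Lt (Num 1) (Var Vr \<otimes> Var Vu \<odot> Var Vp)) s' H'"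
    proof -
      have "s' Vr \<noteq> e"
        using that e u by auto
      then have "s' Vr < e"
        using I by simp
      moreover have "s'(Vr := x) = s(Vr := x)" for x
        using I by (metis fun_upd_upd)
      ultimately show ?thesis
        using I e(2) M by simp
    qed
    show "Q s' H' (Suc n')" if "\<not> bval (Lt (Num 1) (Var Vr \<otimes> Var Vu \<odot> Var Vp)) s' H'"
    proof -
      have "\<not> p dvd s' Vr" "\<not> p dvd s Vu"
        using I e(2) assms(2,3) by (auto dest!: dvd_imp_le)
      then have "\<not> p dvd s' Vr * s Vu"
        using p by (simp add: prime_dvd_mult_iff)
      then have "s' Vr * s Vu mod p = 1"
        using that u by (simp add: dvd_eq_mod_eq_0)
      then show ?thesis
        using Q[of "s' Vr" "Suc n'"] I e(2) by simp
    qed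
  qed
  show ?thesis
    unfolding inverse_pass_def using M \<open>0 < e\<close> by (auto intro!: loop[simplified])
qed

end

lemma wt_normal:
  assumes "0 < c i" "c i < p" "B i = (if p - c i < c i then 1 else 0)"
  shows "[wt c B i = int (absm p (c i))] (mod int p)"
  using assms unfolding wt_def absm_def by (auto simp: min_def cong_iff_dvd_diff of_nat_diff)

text \<open>Index 0 is no element. The value 0 there lets sums run over \<open>{..<p}\<close> and
  makes the flip of a missing second element harmless.\<close>

definition scaled :: "nat \<Rightarrow> (nat \<Rightarrow> nat) \<Rightarrow> nat \<Rightarrow> nat \<Rightarrow> nat" where
  "scaled p a r i = (if i = 0 then 0 else a i * r mod p)"

context input
begin

lemma wp_scale:
  assumes "s Vp = p" "inp H" "s Vr = r" "r < p" "r * u mod p = 1"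
    and zero: "zeros (- {AIn, ACnt}) H"
    and Q: "\<And>s' H' n'. s' Vp = p \<Longrightarrow> s' Vx = k * r mod p \<Longrightarrow>
      zeros (- {AIn, ACnt, AC, ABit, AVal}) H'  \<Longrightarrow>
      H' ABit 0 = 0 \<Longrightarrow>
      (\<And>i. 0 < i \<Longrightarrow> i < p \<Longrightarrow> H' AC i = scaled p a r i \<and> H' AVal i = absm p (scaled p a r i) \<and> H' ABit i \<le> 1 \<and>
        [wt (scaled p a r) (H' ABit) i = int (absm p (scaled p a r i))] (mod int p)) \<Longrightarrow>
      n' \<le> n + 20 * p \<Longrightarrow> Q s' H' n'"
  shows "wpp scale_pass Q s H n"
proof -
  define c where "c = scaled p a r"
  have c: "0 < c i" "c i < p" "c i = a i * r mod p" if "i \<in> {1..<p}" for i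
    using scaled_nonzero[OF p assms(5)] a[OF that] that by (auto simp: c_def scaled_def)
  let ?I = "\<lambda>s' H' n'. s' Vp = p \<and> s' Vx = k * r mod p \<and> s' Vr = r \<and> inp H' \<and>
    zeros (- {AIn, ACnt, AC, ABit, AVal}) H'  \<and>
    0 < s' Vi \<and> s' Vi \<le> p \<and> H' ABit 0 = 0 \<and>
    (\<forall>i. 0 < i \<longrightarrow> i < s' Vi \<longrightarrow> H' AC i = c i \<and> H' AVal i = absm p (c i) \<and>
       H' ABit i = (if p - c i < c i then 1 else 0)) \<and> n' \<le> n + 10 * s' Vi"
  have body: "wpp scale_body (\<lambda>s' H' n'. ?I s' H' n' \<and> p - s' Vi < p - s Vi) s H (Suc n')"
    if I: "?I s H n'" and "s Vi < p" for s H n'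
  proof -
    have i: "s Vi \<in> {1..<p}"
      using that by simp
    have a': "a (s Vi) < p" "H AIn (Suc (s Vi)) = a (s Vi)" "a (s Vi) * r mod p = c (s Vi)"
      using a[OF i] c[OF i] I i by (auto simp: inp_def)
    have less: "s Vi < p * p" "Suc (s Vi) < p * p" "Suc (s Vi) < M" "1 < M" "a (s Vi) * r < M" "c (s Vi) < p"
      using index_bound \<open>s Vi < p\<close> M prod_bound[OF a'(1) assms(4)] c[OF i] by auto
    have nonneg: "c (s Vi) \<le> p"
      using less by simp
    show ?thesis
      using I a' less nonneg \<open>s Vi < p\<close> unfolding scale_body_def
      by (simp add: absm_def min_def)
  qed
  have loop: "wpp (WHILE Lt (Var Vi) (Var Vp) DO scale_body) Q s H n'"
    if "?I s H n'" for s H n'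
    using that
  proof (rule wp_While[where I = ?I and \<mu> = "\<lambda>s H. p - s Vi"])
    fix s H n'
    assume I: "?I s H n'" and "\<not> bval (Lt (Var Vi) (Var Vp)) s H"
    then have i: "s Vi = p"
      by simp
    have "H AC i = c i \<and> H AVal i = absm p (c i) \<and> H ABit i \<le> 1 \<and>
        [wt c (H ABit) i = int (absm p (c i))] (mod int p)" if "0 < i" "i < p" for i
    proof -
      have "H AC i = c i \<and> H AVal i = absm p (c i) \<and> H ABit i = (if p - c i < c i then 1 else 0)"
        using I i that by simp
      then show ?thesis
        using wt_normal[of c i p "H ABit"] c[of i] that by auto
    qed
    then show "Q s H (Suc n')"
      using I i p2 unfolding c_def by (intro Q) auto
  qed (use body in auto)
  show ?thesis
    unfolding scale_pass_def using assms(1-5) zero p2 M index_bound[of 1] prod_bound[OF k, of r]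
      zeros_mono[OF zero, of "- {AIn, ACnt, AC, ABit, AVal}"] zerosD[OF zero, of ABit 0]
    by (simp add: inp_def) (rule loop, auto simp: inp_def)
qed

end

section \<open>Invariants after scaling, and the interval of the ones\<close>

locale normalised = word_bounds +
  fixes x0 :: nat and c :: "nat \<Rightarrow> nat"
  assumes x0: "x0 < p" and c0: "c 0 = 0" and c: "\<And>i. 0 < i \<Longrightarrow> i < p \<Longrightarrow> 0 < c i \<and> c i < p"
    and mult: "\<And>x. card {i \<in> {1..<p}. absm p (c i) = x} \<le> card {i \<in> {1..<p}. absm p (c i) = 1}"
begin

definition v :: "nat \<Rightarrow> nat" where
  "v i = absm p (c i)"

definition m :: nat where
  "m = card {i \<in> {1..<p}. v i = 1}"

definition base :: "var store \<Rightarrow> arr heap \<Rightarrow> bool" where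
  "base s H \<longleftrightarrow> s Vp = p \<and> s Vx = x0 \<and> (\<forall>i. 0 < i \<longrightarrow> i < p \<longrightarrow> H AVal i = v i \<and> H AC i = c i)"

definition mv :: "nat \<Rightarrow> arr heap \<Rightarrow> bool" where
  "mv t H \<longleftrightarrow> moves p c t (H ABit) (H AOwn) (H ATime) (H AI) (H AJ) (H AD)"

definition interval :: "nat \<Rightarrow> arr heap \<Rightarrow> bool" where
  "interval L H \<longleftrightarrow> L < p \<and> (\<forall>x<p. H ATime x \<noteq> 0 \<longleftrightarrow> x \<le> L)"

lemma base_store [simp]: "X \<noteq> Vp \<Longrightarrow> X \<noteq> Vx \<Longrightarrow> base (s(X := y)) H \<longleftrightarrow> base s H"
  by (simp add: base_def)

lemma base_heap [simp]: "A \<noteq> AVal \<Longrightarrow> A \<noteq> AC \<Longrightarrow> base s (H(A := f)) \<longleftrightarrow> base s H"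
  by (simp add: base_def)

lemma mv_heap [simp]:
  "A \<noteq> ABit \<Longrightarrow> A \<noteq> AOwn \<Longrightarrow> A \<noteq> ATime \<Longrightarrow> A \<noteq> AI \<Longrightarrow> A \<noteq> AJ \<Longrightarrow> A \<noteq> AD \<Longrightarrow>
   mv t (H(A := f)) \<longleftrightarrow> mv t H"
  by (simp add: mv_def)

lemma interval_heap [simp]: "A \<noteq> ATime \<Longrightarrow> interval L (H(A := f)) \<longleftrightarrow> interval L H"
  by (simp add: interval_def)

lemma v_bounds: "0 < i \<Longrightarrow> i < p \<Longrightarrow> 0 < v i" "0 < i \<Longrightarrow> i < p \<Longrightarrow> 2 * v i \<le> p"
  "0 < i \<Longrightarrow> i < p \<Longrightarrow> v i < p"
proof -
  assume i: "0 < i" "i < p"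
  show "0 < v i" "2 * v i \<le> p"
    using absm_bounds[of "c i" p] c[OF i] by (auto simp: v_def)
  then show "v i < p"
    using p2 by linarith
qed

lemma mv_init:
  assumes "zeros {AOwn, AI, AJ, AD, ATime} H" and "\<And>i. i < p \<Longrightarrow> H ABit i \<le> 1"
    and "\<And>i. 0 < i \<Longrightarrow> i < p \<Longrightarrow> [wt c (H ABit) i = int (absm p (c i))] (mod int p)"
  shows "mv p (H(ATime := (H ATime)(0 := p)))"
  using assms unfolding mv_def moves_def zeros_def by simp

lemma mv_single:
  assumes "mv t H" "0 < i" "i < p" "H AOwn i = 0" "0 < t" "t' = t - 1"
    and H': "H' = H(AOwn := (H AOwn)(i := t'), AI := (H AI)(t' := i), AD := (H AD)(t' := v i))"
  shows "0 < t'" "t' < p" "mv t' H'"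
proof -
  have "2 \<le> t"
    using moves_unused[OF assms(1)[unfolded mv_def], of i] assms(2-5) by simp
  moreover have "t \<le> p"
    using assms(1) unfolding mv_def moves_def by simp
  ultimately show t': "0 < t'" "t' < p"
    using assms by auto
  show "mv t' H'"
    using moves_single[OF assms(1)[unfolded mv_def] _ t'(1) assms(2-4) c0] assms(5,6) c[OF assms(2,3)]
    unfolding mv_def H' v_def by simp
qed

lemma mv_time:
  assumes "mv t H" "0 < t" "t < p" "0 < x" "x < p" "H ATime x = 0" "t < H ATime (shift p x (H AD t))"
  shows "mv t (H(ATime := (H ATime)(x := t)))"
  using moves_time[of p c t] assms unfolding mv_def by simp

lemma mv_time_ge: "mv t H \<Longrightarrow> x < p \<Longrightarrow> H ATime x \<noteq> 0 \<Longrightarrow> t \<le> H ATime x \<and> H ATime x \<le> p"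
  unfolding mv_def moves_def by (cases "x = 0") auto

lemma interval_unreached: "interval L H \<Longrightarrow> x < p \<Longrightarrow> H ATime x = 0 \<longleftrightarrow> L < x"
  unfolding interval_def by (metis not_le)

lemma interval_extend:
  assumes "interval L H" "Suc L < p" "0 < t"
  shows "interval (Suc L) (H(ATime := (H ATime)(Suc L := t)))"
  using assms unfolding interval_def by auto

lemma wp_ones:
  assumes "base s H" "zeros {AOwn, AI, AJ, AD, ATime, AH} H" "\<And>i. i < p \<Longrightarrow> H ABit i \<le> 1"
    and "\<And>i. 0 < i \<Longrightarrow> i < p \<Longrightarrow> [wt c (H ABit) i = int (absm p (c i))] (mod int p)"
    and Q: "\<And>s' H' n'. base s' H' \<Longrightarrow> mv (p - m) H' \<Longrightarrow> s' Vt = p - m \<Longrightarrow> s' VL = m \<Longrightarrow> m < p \<Longrightarrow>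
      interval m H' \<Longrightarrow> zeros {AH} H' \<Longrightarrow> (\<And>j. 0 < j \<Longrightarrow> j < p \<Longrightarrow> H' AOwn j \<noteq> 0 \<longleftrightarrow> v j = 1) \<Longrightarrow>
      n' \<le> n + 20 * p \<Longrightarrow> Q s' H' n'"
  shows "wpp ones_pass Q s H n"
proof -
  define cnt where "cnt i = card {j \<in> {1..<i}. v j = 1}" for i
  have cnt_Suc: "cnt (Suc i) = cnt i + (if v i = 1 then 1 else 0)" if "0 < i" for i
    unfolding cnt_def using card_filter_Suc[OF that] .
  have cnt_less: "cnt i < i" if "0 < i" for i
    using card_mono[of "{1..<i}" "{j \<in> {1..<i}. v j = 1}"] that unfolding cnt_def
    by (auto simp del: atLeastLessThan_iff intro: le_less_trans)
  let ?I = "\<lambda>s' H' n'. base s' H' \<and> mv (s' Vt) H' \<and> 0 < s' Vi \<and> s' Vi \<le> p \<and> s' VL = cnt (s' Vi) \<and>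
    s' Vt = p - s' VL \<and> interval (s' VL) H' \<and> zeros {AH} H' \<and>
    (\<forall>j. 0 < j \<longrightarrow> j < p \<longrightarrow> (H' AOwn j \<noteq> 0 \<longleftrightarrow> j < s' Vi \<and> v j = 1)) \<and> n' \<le> n + 10 * s' Vi"
  have body: "wpp ones_body (\<lambda>s' H' n'. ?I s' H' n' \<and> p - s' Vi < p - s Vi) s H (Suc n')"
    if I: "?I s H n'" and i: "s Vi < p" for s H n'
  proof -
    let ?i = "s Vi" and ?t = "s Vt - 1" and ?L = "s VL"
    have int: "interval ?L H"
      using I by blast
    have val: "H AVal ?i = v ?i"
      using I i by (simp add: base_def)
    have L: "?L < ?i"
      using I cnt_less by simp
    have less: "?i < p * p" "Suc ?i < M" "1 < M" "Suc ?L < M" "Suc ?L < p * p" "?t < p * p"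
      using i L M index_bound[of ?i] index_bound[of "Suc ?L"] index_bound[of ?t] I by auto
    have eq: "(0 < j \<and> j < p \<longrightarrow> (j < Suc ?i \<and> v j = 1) = (j < ?i \<and> v j = 1))" if "v ?i \<noteq> 1" for j
      using that by (auto simp: less_Suc_eq)
    show ?thesis
    proof (cases "v ?i = 1")
      case False
      have st: "s VL = cnt ?i" "s Vt = p - cnt ?i" "mv (p - cnt ?i) H" "interval (cnt ?i) H"
        using I by metis+
      show ?thesis
        using False I st val less i cnt_Suc[of ?i] eq unfolding ones_body_def by (simp add: diff_less_mono2)
    next
      case True
      let ?H1 = "H(AOwn := (H AOwn)(?i := ?t), AI := (H AI)(?t := ?i), AD := (H AD)(?t := v ?i))"
      have own: "H AOwn ?i = 0"
        using I i by auto
      have "0 < s Vt"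
        using I L i by simp
      moreover have "mv (s Vt) H" "0 < ?i"
        using I by blast+
      ultimately have t: "0 < ?t" "?t < p" and mv1: "mv ?t ?H1"
        using mv_single[of "s Vt" H ?i ?t ?H1] i own by blast+
      have tL: "H ATime ?L \<noteq> 0"
        using I L i by (auto simp: interval_def)
      then have "s Vt \<le> H ATime ?L"
        using mv_time_ge[of "s Vt" H ?L] I L i by auto
      \<comment> \<open>\<open>Suc ?L\<close> is entered from the end \<open>?L\<close> of the
        interval, whose number is larger than \<open>?t\<close>.\<close>
      moreover have "shift p (Suc ?L) (v ?i) = ?L"
        using shift_le[of 1 "Suc ?L" p] True L i by simp
      moreover have "H ATime (Suc ?L) = 0"
        using interval_unreached[OF int, of "Suc ?L"] L i by simp
      ultimately have mv2: "mv ?t (?H1(ATime := (H ATime)(Suc ?L := ?t)))"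
        using mv_time[OF mv1 t, of "Suc ?L"] t L i by simp
      have int2: "interval (Suc ?L) (?H1(ATime := (H ATime)(Suc ?L := ?t)))"
        using interval_extend[of ?L ?H1 ?t] int L i t by simp
      show ?thesis
        using I val less i cnt_Suc[of ?i] mv2 int2 True t unfolding ones_body_def
        by (simp add: diff_less_mono2) (auto simp: less_Suc_eq)
    qed
  qed
  have loop: "wpp (WHILE Lt (Var Vi) (Var Vp) DO ones_body) Q s H n'"
    if "?I s H n'" for s H n'
    using that
  proof (rule wp_While[where I = ?I and \<mu> = "\<lambda>s H. p - s Vi"])
    fix s H n'
    assume I: "?I s H n'" and "\<not> bval (Lt (Var Vi) (Var Vp)) s H"
    then have i: "s Vi = p"
      by (simp add: base_def)
    have "cnt p = m"
      by (simp add: cnt_def m_def)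
    then show "Q s H (Suc n')"
      using I i cnt_less[of p] p2 by (intro Q) auto
  next
    fix s H n'
    assume "?I s H n'" "bval (Lt (Var Vi) (Var Vp)) s H"
    then show "wpp ones_body (\<lambda>s' H' n'. ?I s' H' n' \<and> p - s' Vi < p - s Vi) s H (Suc n')"
      by (intro body) (auto simp: base_def)
  qed simp
  have "cnt 1 = 0"
    by (simp add: cnt_def)
  moreover have "s Vp = p"
    using assms(1) by (simp add: base_def)
  moreover have "interval 0 (H(ATime := (H ATime)(0 := p)))"
    using zerosD[OF assms(2), of ATime] p2 by (auto simp: interval_def)
  moreover have "zeros {AH} H" "\<And>i. H AOwn i = 0"
    using zeros_mono[OF assms(2)] zerosD[OF assms(2)] by auto
  ultimately show ?thesis
    unfolding ones_pass_def using assms(1) M mv_init[OF zeros_mono[OF assms(2)] assms(3,4)] p2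
    by simp (rule loop, auto)
qed

end

section \<open>Pairs within buckets\<close>

definition fill_loop :: prog where
  "fill_loop =
     WHILE Lt (Var VL) (Var Ve) DO (VL ::= Var VL \<oplus> Num 1;; ATime[Var VL] ::= Var Vt)"

text \<open>The partner is the top of the stack. The element of larger value becomes the first of
  the move, and the bit of the other is flipped in advance, so that \<open>Vd\<close> is
  positive.\<close>

definition pair_step :: prog where
  "pair_step =
     Vj ::= Get ASt (Var Vb \<otimes> Var Vp \<oplus> Var Vn \<ominus> Num 1);;
     AH[Var Vb] ::= Var Vn \<ominus> Num 1;;
     Vt ::= Var Vt \<ominus> Num 1;;
     AOwn[Var Vi] ::= Var Vt;;
     AOwn[Var Vj] ::= Var Vt;;
     (IF Lt (Get AVal (Var Vj)) (Var Vv)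
      THEN (AI[Var Vt] ::= Var Vi;;
            AJ[Var Vt] ::= Var Vj;;
            ABit[Var Vj] ::= Num 1 \<ominus> Get ABit (Var Vj);;
            Vd ::= Var Vv \<ominus> Get AVal (Var Vj))
      ELSE (AI[Var Vt] ::= Var Vj;;
            AJ[Var Vt] ::= Var Vi;;
            ABit[Var Vi] ::= Num 1 \<ominus> Get ABit (Var Vi);;
            Vd ::= Get AVal (Var Vj) \<ominus> Var Vv));;
     AD[Var Vt] ::= Var Vd;;
     Ve ::= Var VL \<oplus> Var Vd;;
     fill_loop"

definition push_step :: prog where
  "push_step =
     ASt[Var Vb \<otimes> Var Vp \<oplus> Var Vn] ::= Var Vi;;
     AH[Var Vb] ::= Var Vn \<oplus> Num 1"

text \<open>The elements waiting in a bucket share one value, so a new element either has that value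
  and joins them or can be paired with the top. The conjunction is evaluated from the left, since an
  empty stack has no top whose index could be formed.\<close>

definition pairs_body :: prog where
  "pairs_body =
     (IF Neq (Get AOwn (Var Vi)) (Num 0)
      THEN Skip
      ELSE (Vv ::= Get AVal (Var Vi);;
            Vb ::= Var Vv \<oslash> Var VW;;
            Vn ::= Get AH (Var Vb);;
            (IF And (Lt (Num 0) (Var Vn))
               (Neq (Get AVal (Get ASt (Var Vb \<otimes> Var Vp \<oplus> Var Vn \<ominus> Num 1))) (Var Vv))
             THEN pair_step ELSE push_step)));;
     Vi ::= Var Vi \<oplus> Num 1"

text \<open>The bucket width stays at \<open>m + 1\<close> while \<open>VL\<close> grows. Values in
  one bucket differ by at most \<open>m\<close>, so every difference fits the interval reached so
  far.\<close>

definition pairs_pass :: prog where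
  "pairs_pass =
     VW ::= Var VL \<oplus> Num 1;;
     Vi ::= Num 1;;
     WHILE And (Lt (Var Vi) (Var Vp)) (Lt (Var VL) (Var Vp \<oslash> Num 4)) DO pairs_body"

context normalised
begin

lemma wp_fill:
  assumes "mv t H" "0 < t" "t < p" "H AD t = d" "0 < d" "d \<le> Suc (s VL)" "s Vt = t"
    "s Ve = s VL + d" "s Ve < p" "interval (s VL) H" "\<And>x. x \<le> s VL \<Longrightarrow> t < H ATime x"
    and Q: "\<And>T n'. mv t (H(ATime := T)) \<Longrightarrow> interval (s VL + d) (H(ATime := T)) \<Longrightarrow>
      n' \<le> n + 3 * d + 1 \<Longrightarrow> Q (s(VL := s VL + d)) (H(ATime := T)) n'"
  shows "wpp fill_loop Q s H n"
  unfolding fill_loop_def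
proof -
  let ?L0 = "s VL"
  define I where "I s' H' n' \<longleftrightarrow> (\<exists>L T. s' = s(VL := L) \<and> H' = H(ATime := T) \<and> ?L0 \<le> L \<and> L \<le> ?L0 + d \<and>
    mv t H' \<and> interval L H' \<and> (\<forall>x\<le>?L0. t < T x) \<and> n' \<le> n + 3 * (L - ?L0))" for s' H' n'
  show "wpp (WHILE Lt (Var VL) (Var Ve) DO (VL ::= Var VL \<oplus> Num 1;; ATime[Var VL] ::= Var Vt)) Q s H n"
  proof (rule wp_While[where I = I and \<mu> = "\<lambda>s H. p - s VL"])
    show "I s H n"
      unfolding I_def using assms by (intro exI[of _ ?L0] exI[of _ "H ATime"]) simp
  next
    fix s' H' n'
    assume "I s' H' n'"
    then obtain L T where I: "s' = s(VL := L)" "H' = H(ATime := T)" "?L0 \<le> L" "L \<le> ?L0 + d"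
      "mv t H'" "interval L H'" "\<forall>x\<le>?L0. t < T x" "n' \<le> n + 3 * (L - ?L0)"
      unfolding I_def by blast
    show "bok M (p * p) (Lt (Var VL) (Var Ve)) s' H'"
      by simp
    show "wpp (VL ::= Var VL \<oplus> Num 1;; ATime[Var VL] ::= Var Vt)
        (\<lambda>s'' H'' n''. I s'' H'' n'' \<and> p - s'' VL < p - s' VL) s' H' (Suc n')"
      if "bval (Lt (Var VL) (Var Ve)) s' H'"
    proof -
      have L: "L < ?L0 + d" "Suc L < p"
        using that I(1) assms(8,9) by auto
      \<comment> \<open>Because \<open>d \<le> Suc ?L0\<close> and \<open>L < ?L0 + d\<close>, the
        predecessor \<open>Suc L - d\<close> lies in the interval as it was before this move, where
        all numbers exceed \<open>t\<close>.\<close>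
      have "shift p (Suc L) d = Suc L - d"
        using shift_le[of d "Suc L" p] assms(6) I(3) L(2) by simp
      then have "t < H' ATime (shift p (Suc L) (H' AD t))"
        using I(2,7) L(1) assms(4) by simp
      moreover have "H' ATime (Suc L) = 0"
        using interval_unreached[OF I(6) L(2)] by simp
      ultimately have "mv t (H'(ATime := (H' ATime)(Suc L := t)))"
        using mv_time[OF I(5) assms(2,3)] L(2) by simp
      moreover have "interval (Suc L) (H'(ATime := (H' ATime)(Suc L := t)))"
        using interval_extend[OF I(6) L(2) assms(2)] .
      ultimately have "I (s(VL := Suc L)) (H(ATime := T(Suc L := t))) (Suc (Suc (Suc n')))"
        unfolding I_def using I L by (intro exI[of _ "Suc L"] exI[of _ "T(Suc L := t)"]) auto
      then show ?thesis
        using I(1,2) L assms(7) M index_bound[of "Suc L"] by (simp add: diff_less_mono2)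
    qed
    show "Q s' H' (Suc n')" if "\<not> bval (Lt (Var VL) (Var Ve)) s' H'"
    proof -
      have "L = ?L0 + d"
        using that I(1,4) assms(8) by simp
      then show ?thesis
        using Q[of T "Suc n'"] I by simp
    qed
  qed
qed

lemma mv_pair:
  assumes "mv t H" "0 < i" "i < p" "H AOwn i = 0" "0 < j" "j < p" "H AOwn j = 0" "v j < v i" "0 < t" "t' = t - 1"
    and H': "H' ABit = (H ABit)(j := 1 - H ABit j)" "H' AOwn = (H AOwn)(j := t', i := t')"
      "H' ATime = H ATime" "H' AI = (H AI)(t' := i)" "H' AJ = (H AJ)(t' := j)" "H' AD = (H AD)(t' := v i - v j)"
  shows "mv t' H'"
proof -
  have "2 \<le> t"
    using moves_unused[OF assms(1)[unfolded mv_def], of i] assms(2-4,9) by simp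
  then have t': "0 < t'" "t = Suc t'"
    using assms(10) by auto
  show ?thesis
    using moves_pair[OF assms(1)[unfolded mv_def] t'(2,1) assms(2-7)] assms(8) c[OF assms(2,3)] H'
    unfolding mv_def v_def by simp
qed

lemma wp_pair:
  assumes "base s H" "mv (s Vt) H" "0 < s Vt" "s Vi = i" "0 < i" "i < p" "H AOwn i = 0"
    "s Vv = v i" "s Vb = b" "b < p" "s Vn = h" "0 < h" "h < p" "H ASt (b * p + (h - 1)) = j"
    "0 < j" "j < p" "H AOwn j = 0" "v i \<noteq> v j" "v i \<le> v j + s VL" "v j \<le> v i + s VL"
    "interval (s VL) H" "2 * s VL < p"
    and Q: "\<And>s' H' n' d. base s' H' \<Longrightarrow> mv (s Vt - 1) H' \<Longrightarrow> 2 \<le> s Vt \<Longrightarrow> interval (s VL + d) H' \<Longrightarrow>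
      s' Vt = s Vt - 1 \<Longrightarrow> s' VL = s VL + d \<Longrightarrow> 0 < d \<Longrightarrow> s' Vi = i \<Longrightarrow> s' VW = s VW \<Longrightarrow>
      H' AOwn = (H AOwn)(i := s Vt - 1, j := s Vt - 1) \<Longrightarrow> H' AH = (H AH)(b := h - 1) \<Longrightarrow> H' ASt = H ASt \<Longrightarrow>
      n' \<le> n + 20 + 3 * d \<Longrightarrow> Q s' H' n'"
  shows "wpp pair_step Q s H n"
proof -
  let ?t = "s Vt - 1"
  have t2: "2 \<le> s Vt"
    using moves_unused[OF assms(2)[unfolded mv_def], of i] assms(3,5-7) by simp
  have t: "0 < ?t" "?t < p"
    using t2 assms(2) unfolding mv_def moves_def by auto
  have vals: "H AVal j = v j" "s Vp = p"
    using assms(1,15,16) unfolding base_def by auto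
  have bit: "H ABit j \<le> 1" "H ABit i \<le> 1"
    using assms(2,6,16) unfolding mv_def moves_def by auto
  have bp: "b * p + p \<le> p * p"
    using mult_le_mono1[of "Suc b" p p] assms(10) by simp
  have less: "b * p + (h - 1) < p * p" "b * p + h < M" "b * p < M" "b < p * p" "?t < p * p" "i < p * p" "j < p * p" "1 < M"
    using bp assms(13) M index_bound assms(6,10,16) t by auto
  have ij: "i \<noteq> j" "j \<noteq> i"
    using assms(18) by auto
  have top: "H ASt (b * p + h - Suc 0) = j"
    using assms(12,14) by simp
  have vij: "v i < p" "v j < p"
    using v_bounds(3) assms(5,6,15,16) by auto
  have bounds: "b * p + h - Suc 0 < p * p" "Suc 0 \<le> b * p + h" "Suc 0 \<le> h" "Suc 0 \<le> s Vt" "Suc 0 < M"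
    "s Vt - Suc 0 < p * p" "H ABit i \<le> Suc 0" "H ABit j \<le> Suc 0" "s VL + v i - v j < M" "s VL + v j - v i < M" "v i - v j < M" "v j - v i < M" "s VL + (v i - v j) < M" "s VL + (v j - v i) < M"
    using less assms(12,22) t2 vij M bit by auto
  \<comment> \<open>Moves made so far carry numbers from \<open>s Vt\<close> on, so every residue of
    the interval is older than the new move \<open>?t\<close>.\<close>
  have old: "?t < H ATime x" if "x \<le> s VL" for x
  proof -
    have "x < p"
      using that assms(22) by simp
    then have "H ATime x \<noteq> 0"
      using interval_unreached[OF assms(21)] that by auto
    then show ?thesis
      using mv_time_ge[OF assms(2) \<open>x < p\<close>] t2 by linarith
  qed
  have fill: "wpp fill_loop Q s' H' n'"
    if "base s' H'" "mv ?t H'" "H' AD ?t = d" "0 < d" "d \<le> s VL" "s' VL = s VL" "s' Ve = s VL + d" "s' Vt = ?t"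
      "H' ATime = H ATime" "s' Vi = i" "s' VW = s VW"
      "H' AOwn = (H AOwn)(i := ?t, j := ?t)" "H' AH = (H AH)(b := h - 1)" "H' ASt = H ASt" "n' \<le> n + 14"
    for s' H' n' d
  proof (rule wp_fill[OF that(2) t that(3,4)])
    show "interval (s' VL) H'"
      using assms(21) that(6,9) by (simp add: interval_def)
    show "Q (s'(VL := s' VL + d)) (H'(ATime := T)) n''"
      if "mv ?t (H'(ATime := T))" "interval (s' VL + d) (H'(ATime := T))" "n'' \<le> n' + 3 * d + 1" for T n''
    proof -
      have "interval (s VL + d) (H'(ATime := T))"
        using that(2) \<open>s' VL = s VL\<close> by simp
      then show ?thesis
        by (rule Q[OF _ _ t2, rotated 2])
          (use that \<open>base s' H'\<close> \<open>0 < d\<close> \<open>s' VL = s VL\<close> \<open>s' Vt = ?t\<close> \<open>s' Vi = i\<close> \<open>s' VW = s VW\<close>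
            \<open>H' AOwn = _\<close> \<open>H' AH = _\<close> \<open>H' ASt = _\<close> \<open>n' \<le> n + 14\<close> in simp_all)
    qed
  qed (use that assms(22) old in auto)
  show ?thesis
  proof (cases "v j < v i")
    case True
    let ?H' = "H(AH := (H AH)(b := h - 1), AOwn := (H AOwn)(i := ?t, j := ?t), AI := (H AI)(?t := i), AJ := (H AJ)(?t := j),
       ABit := (H ABit)(j := 1 - H ABit j), AD := (H AD)(?t := v i - v j))"
    have "mv ?t ?H'"
      by (rule mv_pair[OF assms(2,5-7,15-17) True assms(3) refl]) (use ij in \<open>simp_all add: fun_upd_twist\<close>)
    then have "wpp fill_loop Q
        (s(Vj := j, Vt := ?t, Vd := v i - v j, Ve := s VL + (v i - v j))) ?H' (n + 12)"
      by (rule fill[rotated]) (use assms(1,4,18-20) True in auto)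
    then show ?thesis
      unfolding pair_step_def by (simp add: assms(4,8,9,11) less t True vals bit ij top bounds numeral_eq_Suc less_imp_le)
  next
    case False
    then have lt: "v i < v j"
      using assms(18) by simp
    let ?H' = "H(AH := (H AH)(b := h - 1), AOwn := (H AOwn)(i := ?t, j := ?t), AI := (H AI)(?t := j), AJ := (H AJ)(?t := i),
       ABit := (H ABit)(i := 1 - H ABit i), AD := (H AD)(?t := v j - v i))"
    have "mv ?t ?H'"
      by (rule mv_pair[OF assms(2,15-17,5-7) lt assms(3) refl]) simp_all
    then have "wpp fill_loop Q
        (s(Vj := j, Vt := ?t, Vd := v j - v i, Ve := s VL + (v j - v i))) ?H' (n + 12)"
      by (rule fill[rotated]) (use assms(1,4,18-20) False in auto)
    then show ?thesis
      unfolding pair_step_def by (simp add: assms(4,8,9,11) less t lt False vals bit ij top bounds numeral_eq_Suc less_imp_le)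
  qed
qed

definition bucket :: "nat \<Rightarrow> (nat \<Rightarrow> nat) \<Rightarrow> nat \<Rightarrow> nat set" where
  "bucket i W q = {j. 0 < j \<and> j < i \<and> W j = 0 \<and> v j div (m + 1) = q}"

text \<open>The second clause is what the pairing achieves: all elements waiting in a bucket have
  the same value. When the input is exhausted it becomes the hypothesis \<open>same\<close> of
  \<open>leftover_bound\<close>.\<close>

definition stacks :: "nat \<Rightarrow> (nat \<Rightarrow> nat) \<Rightarrow> (nat \<Rightarrow> nat) \<Rightarrow> (nat \<Rightarrow> nat) \<Rightarrow> bool" where
  "stacks i W H S \<longleftrightarrow>
     (\<forall>q<p. inj_on (\<lambda>s. S (q * p + s)) {..<H q} \<and> (\<lambda>s. S (q * p + s)) ` {..<H q} = bucket i W q) \<and>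
     (\<forall>q. \<forall>j\<in>bucket i W q. \<forall>j'\<in>bucket i W q. v j = v j')"

text \<open>Heights below \<open>p\<close> keep each stack inside its own \<open>p\<close> cells of
  \<open>ASt\<close>.\<close>

lemma stacks_height: "stacks i W H S \<Longrightarrow> q < p \<Longrightarrow> 0 < i \<Longrightarrow> H q < i"
proof -
  assume "stacks i W H S" "q < p" "0 < i"
  then have "card (bucket i W q) = H q"
    unfolding stacks_def by (metis card_image card_lessThan)
  moreover have "card (bucket i W q) \<le> card {1..<i}"
    unfolding bucket_def by (intro card_mono) auto
  ultimately show ?thesis
    using \<open>0 < i\<close> by simp
qed

lemma stacks_skip:
  assumes "stacks i W H S" "W i \<noteq> 0"
  shows "stacks (Suc i) W H S"
proof -
  have "bucket (Suc i) W = bucket i W"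
    using assms(2) unfolding bucket_def by (auto simp: less_Suc_eq)
  then show ?thesis
    using assms(1) unfolding stacks_def by metis
qed

text \<open>Comparing with the top is enough, because everything else in the bucket has the value of
  the top.\<close>

lemma stacks_push:
  assumes st: "stacks i W H S" and i: "0 < i" "i < p" "W i = 0" and q: "q = v i div (m + 1)" "q < p"
    and top: "H q = 0 \<or> v (S (q * p + (H q - 1))) = v i"
  shows "stacks (Suc i) W (H(q := H q + 1)) (S(q * p + H q := i))"
proof -
  have bucket: "bucket (Suc i) W q' = (if q' = q then insert i (bucket i W q) else bucket i W q')" for q'
    using i q unfolding bucket_def by (auto simp: less_Suc_eq)
  have h: "H q' < p" if "q' < p" for q'
    using stacks_height[OF st that i(1)] i(2) by simp
  have index: "q' * p + s = q * p + H q \<longleftrightarrow> q' = q \<and> s = H q" if "s < p" for q' s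
  proof
    assume eq: "q' * p + s = q * p + H q"
    have "q' = (q' * p + s) div p"
      using that by simp
    also have "\<dots> = q"
      using h[OF q(2)] eq by simp
    finally show "q' = q \<and> s = H q"
      using eq by simp
  qed simp
  have st': "inj_on (\<lambda>s. S (q' * p + s)) {..<H q'}" "(\<lambda>s. S (q' * p + s)) ` {..<H q'} = bucket i W q'"
    if "q' < p" for q'
    using st that unfolding stacks_def by auto
  let ?S = "S(q * p + H q := i)"
  have S: "?S (q' * p + s) = S (q' * p + s)" if "q' < p" "s < H q'" for q' s
    using index[of s q'] h[OF that(1)] that by auto
  have "inj_on (\<lambda>s. ?S (q' * p + s)) {..<(H(q := H q + 1)) q'} \<and>
      (\<lambda>s. ?S (q' * p + s)) ` {..<(H(q := H q + 1)) q'} = bucket (Suc i) W q'" if q': "q' < p" for q'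
  proof -
    have inj: "inj_on (\<lambda>s. ?S (q' * p + s)) {..<H q'}"
      using st'(1)[OF q'] S[OF q'] by (subst inj_on_cong[where g = "\<lambda>s. S (q' * p + s)"]) auto
    have img: "(\<lambda>s. ?S (q' * p + s)) ` {..<H q'} = bucket i W q'"
      using st'(2)[OF q'] S[OF q'] by (subst image_cong[where g = "\<lambda>s. S (q' * p + s)"]) auto
    show ?thesis
    proof (cases "q' = q")
      case True
      define f where "f s = ?S (q' * p + s)" for s
      have "f (H q) = i" "inj_on f {..<H q}" "f ` {..<H q} = bucket i W q"
        using inj img True unfolding f_def by simp_all
      moreover have "i \<notin> bucket i W q"
        unfolding bucket_def by simp
      ultimately have "inj_on f {..<Suc (H q)} \<and> f ` {..<Suc (H q)} = insert i (bucket i W q)"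
        by (simp add: lessThan_Suc)
      then show ?thesis
        using True bucket[of q] unfolding f_def by simp
    next
      case False
      then show ?thesis
        using inj img bucket[of q'] by simp
    qed
  qed
  moreover have "v j = v j'" if "j \<in> bucket (Suc i) W q'" "j' \<in> bucket (Suc i) W q'" for q' j j'
  proof -
    have same: "v j = v j'" if "j \<in> bucket i W q'" "j' \<in> bucket i W q'" for q' j j'
      using st that unfolding stacks_def by blast
    have top_same: "v j = v i" if "j \<in> bucket i W q" for j
    proof -
      have "H q \<noteq> 0"
        using that st'(2)[OF q(2)] by auto
      then have "S (q * p + (H q - 1)) \<in> bucket i W q"
        unfolding st'(2)[OF q(2), symmetric] by (intro imageI) simp
      then show ?thesis
        using same[OF that] top \<open>H q \<noteq> 0\<close> by auto
    qed
    show ?thesis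
    proof (cases "q' = q")
      case True
      then have "v j = v i" "v j' = v i"
        using that top_same unfolding bucket by auto
      then show ?thesis
        by simp
    next
      case False
      then show ?thesis
        using that same[of j q' j'] unfolding bucket by simp
    qed
  qed
  ultimately show ?thesis
    unfolding stacks_def by blast
qed

lemma stacks_pop:
  assumes st: "stacks i W H S" and i: "0 < i" "i < p" and q: "q < p" "0 < H q"
    and j: "j = S (q * p + (H q - 1))" and "t \<noteq> 0"
  shows "j \<in> bucket i W q" "stacks (Suc i) (W(i := t, j := t)) (H(q := H q - 1)) S"
proof -
  have st': "inj_on (\<lambda>s. S (q' * p + s)) {..<H q'}" "(\<lambda>s. S (q' * p + s)) ` {..<H q'} = bucket i W q'"
    if "q' < p" for q'
    using st that unfolding stacks_def by auto
  show jb: "j \<in> bucket i W q"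
    unfolding j st'(2)[OF q(1), symmetric] using q(2) by (intro imageI) simp
  have bucket: "bucket (Suc i) (W(i := t, j := t)) q' = bucket i W q' - {j}" for q'
    using \<open>t \<noteq> 0\<close> unfolding bucket_def by (auto simp: less_Suc_eq)
  have "inj_on (\<lambda>s. S (q' * p + s)) {..<(H(q := H q - 1)) q'} \<and>
      (\<lambda>s. S (q' * p + s)) ` {..<(H(q := H q - 1)) q'} = bucket i W q' - {j}" if q': "q' < p" for q'
  proof (cases "q' = q")
    case True
    have H: "{..<H q} = insert (H q - 1) {..<H q - 1}"
      using q(2) by auto
    define f where "f s = S (q * p + s)" for s
    have "inj_on f (insert (H q - 1) {..<H q - 1})" "f ` insert (H q - 1) {..<H q - 1} = bucket i W q"
      using st'[OF q(1)] unfolding H f_def by auto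
    moreover have "f (H q - 1) = j"
      unfolding f_def j ..
    moreover have "{..<H q - 1} - {H q - 1} = {..<H q - 1}"
      by simp
    ultimately have "inj_on f {..<H q - 1} \<and> f ` {..<H q - 1} = bucket i W q - {j}"
      by (metis Diff_insert_absorb image_insert inj_on_insert)
    then show ?thesis
      using True unfolding f_def by simp
  next
    case False
    then have "j \<notin> bucket i W q'"
      using jb unfolding bucket_def by simp
    then show ?thesis
      using False st'[OF q'] by simp
  qed
  moreover have "v j1 = v j2" if "j1 \<in> bucket i W q' - {j}" "j2 \<in> bucket i W q' - {j}" for q' j1 j2
    using st that unfolding stacks_def by blast
  ultimately show "stacks (Suc i) (W(i := t, j := t)) (H(q := H q - 1)) S"
    unfolding stacks_def bucket by blast
qed

definition used :: "(nat \<Rightarrow> nat) \<Rightarrow> nat" where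
  "used W = card {j \<in> {1..<p}. W j \<noteq> 0}"

lemma used_upd:
  assumes "0 < i" "i < p" "W i = 0" "t \<noteq> 0"
  shows "used (W(i := t)) = used W + 1"
proof -
  have "{j \<in> {1..<p}. (W(i := t)) j \<noteq> 0} = insert i {j \<in> {1..<p}. W j \<noteq> 0}"
    using assms by auto
  then show ?thesis
    using assms(3) unfolding used_def by simp
qed

text \<open>After P pairs, \<open>Vt\<close> is p - m - P and m + 2 P elements are used; the
  equation states this without P. Every move prolongs the interval by at least 1, hence
  \<open>p \<le> s VL + s Vt\<close>. The disjunction records that either no pair was made or, as
  the last pair was made below the threshold, m + P is at most \<open>p div 4\<close>. With all ones
  used, only values of at least 2 are left for the later steps.\<close>

definition pairs_inv :: "var store \<Rightarrow> arr heap \<Rightarrow> bool" where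
  "pairs_inv s H \<longleftrightarrow> base s H \<and> mv (s Vt) H \<and> 0 < s Vt \<and> interval (s VL) H \<and> m \<le> s VL \<and>
     used (H AOwn) + m + 2 * s Vt = 2 * p \<and> p \<le> s VL + s Vt \<and>
     (s Vt + m = p \<or> p \<le> s Vt + p div 4) \<and> (\<forall>j. 0 < j \<longrightarrow> j < p \<longrightarrow> v j = 1 \<longrightarrow> H AOwn j \<noteq> 0)"

lemma pairs_inv_store [simp]:
  "X \<noteq> Vp \<Longrightarrow> X \<noteq> Vx \<Longrightarrow> X \<noteq> Vt \<Longrightarrow> X \<noteq> VL \<Longrightarrow> pairs_inv (s(X := y)) H \<longleftrightarrow> pairs_inv s H"
  by (simp add: pairs_inv_def)

lemma pairs_inv_heap [simp]: "A \<in> {AH, ASt, ALo, AHi} \<Longrightarrow> pairs_inv s (H(A := f)) \<longleftrightarrow> pairs_inv s H"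
  by (auto simp: pairs_inv_def)

lemma wp_push:
  assumes "s Vb = b" "b < p" "s Vp = p" "s Vn = h" "h < p" "s Vi = i"
  shows "wpp push_step Q s H n \<longleftrightarrow>
    Q s (H(ASt := (H ASt)(b * p + h := i), AH := (H AH)(b := h + 1))) (Suc (Suc n))"
proof -
  have "b * p + p \<le> p * p"
    using mult_le_mono1[of "Suc b" p p] assms(2) by simp
  then have "b * p + h < p * p" "b * p + h < M" "b * p < M" "b < p * p" "Suc h < M" "1 < M"
    using assms M index_bound[of b] by auto
  then show ?thesis
    unfolding push_step_def using assms by simp
qed

lemma wp_pairs:
  assumes "base s H" "mv (p - m) H" "s Vt = p - m" "s VL = m" "m < p"
      "interval m H" "zeros {AH} H" and ones: "\<And>j. 0 < j \<Longrightarrow> j < p \<Longrightarrow> H AOwn j \<noteq> 0 \<longleftrightarrow> v j = 1"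
    and Q: "\<And>s' H' n'. pairs_inv s' H' \<Longrightarrow> p \<le> 4 * (s' VL + 1) \<Longrightarrow> n' \<le> n + 50 * p \<Longrightarrow> Q s' H' n'"
  shows "wpp pairs_pass Q s H n"
proof -
  \<comment> \<open>The filling loops are paid for by the growth of \<open>VL\<close>, which stays
    below \<open>p\<close>; everything else costs a constant per element.\<close>
  define I where "I s H n' \<longleftrightarrow> pairs_inv s H \<and> s VW = m + 1 \<and> 0 < s Vi \<and> s Vi \<le> p \<and>
    stacks (s Vi) (H AOwn) (H AH) (H ASt) \<and>
    n' \<le> n + 30 * s Vi + 3 * s VL" for s H n'
  have body: "wpp pairs_body (\<lambda>s' H' n'. I s' H' n' \<and> p - s' Vi < p - s Vi) s H (Suc n')"
    if I: "I s H n'" and i: "s Vi < p" and L: "s VL < p div 4" for s H n'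
  proof -
    let ?i = "s Vi"
    let ?b = "v ?i div (m + 1)"
    let ?h = "H AH ?b"
    have inv: "pairs_inv s H" and VW: "s VW = m + 1" and i0: "0 < ?i"
      and st: "stacks ?i (H AOwn) (H AH) (H ASt)" and n': "n' \<le> n + 30 * ?i + 3 * s VL"
      using I unfolding I_def by blast+
    have bs: "base s H" and mvt: "mv (s Vt) H" and t0: "0 < s Vt" and int: "interval (s VL) H" and mL: "m \<le> s VL"
      and us: "used (H AOwn) + m + 2 * s Vt = 2 * p" and pL: "p \<le> s VL + s Vt"
      and one: "\<forall>j. 0 < j \<longrightarrow> j < p \<longrightarrow> v j = 1 \<longrightarrow> H AOwn j \<noteq> 0"
      using inv unfolding pairs_inv_def by blast+
    have val: "H AVal ?i = v ?i" "s Vp = p"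
      using bs i i0 by (auto simp: base_def)
    have "?b < p"
      using v_bounds(3)[OF i0 i] by (rule le_less_trans[OF div_le_dividend])
    then have less: "?i < p * p" "Suc ?i < M" "1 < M" "?b < p" "?b < p * p"
      using i M index_bound[of ?i] index_bound[of ?b] by auto
    have h: "?h < ?i"
      using stacks_height[OF st less(4) i0] .
    show ?thesis
    proof (cases "H AOwn ?i = 0")
      case False
      have "I (s(Vi := Suc ?i)) H (Suc (Suc (Suc n')))"
        using inv VW i n' stacks_skip[OF st False] unfolding I_def by simp
      then show ?thesis
        unfolding pairs_body_def using False less i val by (simp add: diff_less_mono2)
    next
      case True
      let ?j = "H ASt (?b * p + (?h - 1))"
      let ?s = "s(Vv := v ?i, Vb := ?b, Vn := ?h)"
      have hp: "?b * p + p \<le> p * p"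
        using mult_le_mono1[of "Suc ?b" p p] less(4) by simp
      have ok: "?b * p + ?h < M" "?b * p < M" "?b * p + ?h - 1 < p * p"
        using hp h i M by auto
      have jb: "0 < ?j" "?j < ?i" "H AOwn ?j = 0" "v ?j div (m + 1) = ?b" if "0 < ?h"
        using stacks_pop(1)[OF st i0 i less(4) that refl, of 1] unfolding bucket_def by auto
      have valj: "H AVal ?j = v ?j" if "0 < ?h"
        using bs jb[OF that] i by (auto simp: base_def)
      have top: "H ASt (?b * p + ?h - Suc 0) = ?j" if "0 < ?h"
        using that by simp
      have ok0: "0 < ?h \<Longrightarrow> ?j < p * p" "?b * p + ?h - Suc 0 < p * p" "0 < M"
        using index_bound[of ?j] jb i ok less by auto
      show ?thesis
      proof (cases "0 < ?h \<and> v ?j \<noteq> v ?i")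
        case True
        note j = jb[OF conjunct1[OF True]]
        have near: "v ?i \<le> v ?j + s VL" "v ?j \<le> v ?i + s VL"
        proof -
          have "v ?i = (m + 1) * ?b + v ?i mod (m + 1)" "v ?j = (m + 1) * ?b + v ?j mod (m + 1)"
            using j(4) by (metis mult_div_mod_eq)+
          moreover have "v ?i mod (m + 1) \<le> m" "v ?j mod (m + 1) \<le> m"
            by (simp_all add: less_Suc_eq_le[symmetric])
          ultimately show "v ?i \<le> v ?j + s VL" "v ?j \<le> v ?i + s VL"
            using mL by linarith+
        qed
        let ?Q = "wpp (Vi ::= Var Vi \<oplus> Num (Suc 0))
          (\<lambda>s' H' n'. I s' H' n' \<and> p - s' Vi < p - s Vi)"
        have "wpp pair_step ?Q ?s H (Suc (Suc (Suc (Suc (Suc (Suc n'))))))"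
        proof (rule wp_pair[where i = ?i and b = ?b and h = ?h and j = ?j])
          fix s' H' n'' d
          assume *: "base s' H'" "mv (?s Vt - 1) H'" "2 \<le> ?s Vt" "interval (?s VL + d) H'"
            "s' Vt = ?s Vt - 1" "s' VL = ?s VL + d" "0 < d" "s' Vi = ?i" "s' VW = ?s VW"
            "H' AOwn = (H AOwn)(?i := ?s Vt - 1, ?j := ?s Vt - 1)" "H' AH = (H AH)(?b := ?h - 1)" "H' ASt = H ASt"
            "n'' \<le> Suc (Suc (Suc (Suc (Suc (Suc n'))))) + 20 + 3 * d"
          let ?t = "s Vt - 1"
          have t: "?t \<noteq> 0"
            using *(3) by simp
          have own: "H' AOwn = (H AOwn)(?i := ?t, ?j := ?t)"
            using *(10) by simp
          have u: "used (H' AOwn) = used (H AOwn) + 2"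
            unfolding own using used_upd[of ?j "(H AOwn)(?i := ?t)" ?t] used_upd[of ?i "H AOwn" ?t] j i i0 t
              \<open>H AOwn ?i = 0\<close> by simp
          have inv': "pairs_inv s' H'"
            unfolding pairs_inv_def
          proof (intro conjI)
            show "base s' H'"
              by fact
            show "mv (s' Vt) H'" "interval (s' VL) H'"
              using *(2,4-6) by simp_all
            show "0 < s' Vt" "used (H' AOwn) + m + 2 * s' Vt = 2 * p"
              using *(3,5) u us by auto
            show "m \<le> s' VL" "p \<le> s' VL + s' Vt" "s' Vt + m = p \<or> p \<le> s' Vt + p div 4"
              using *(3,5-7) mL pL L by auto
            show "\<forall>j. 0 < j \<longrightarrow> j < p \<longrightarrow> v j = 1 \<longrightarrow> H' AOwn j \<noteq> 0"
              using one own t by simp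
          qed
          have "stacks (Suc ?i) (H' AOwn) (H' AH) (H' ASt)"
            using stacks_pop(2)[OF st i0 i less(4) conjunct1[OF True] refl t] own *(11,12) by simp
          moreover have "Suc n'' \<le> n + 30 * Suc ?i + 3 * s' VL"
            using *(6,13) n' by simp
          moreover have "s' VW = m + 1"
            using *(9) VW by simp
          ultimately have "I (s'(Vi := Suc ?i)) H' (Suc n'')"
            using inv' i unfolding I_def by simp
          then show "?Q s' H' n''"
            using *(8) less i by (simp add: diff_less_mono2)
        qed (use bs mvt t0 i0 i \<open>H AOwn ?i = 0\<close> less h True j near int L in auto)
        moreover have "H AVal (H ASt (?b * p + ?h - Suc 0)) \<noteq> v ?i"
          using top valj True by metis
        ultimately show ?thesis
          using True \<open>H AOwn ?i = 0\<close> less ok0 ok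
          by (simp add: pairs_body_def val VW)
      next
        case False
        have "stacks (Suc ?i) (H AOwn) ((H AH)(?b := ?h + 1)) ((H ASt)(?b * p + ?h := ?i))"
          using stacks_push[OF st i0 i True refl less(4)] False by auto
        then have "I (?s(Vi := Suc ?i)) (H(ASt := (H ASt)(?b * p + ?h := ?i), AH := (H AH)(?b := ?h + 1)))
            (Suc (Suc (Suc (Suc (Suc (Suc (Suc (Suc (Suc n')))))))))"
          using inv VW i n' unfolding I_def by simp
        moreover have "H AVal (H ASt (?b * p + ?h - Suc 0)) = v ?i" if "0 < ?h"
          using top valj False that by metis
        ultimately show ?thesis
          using True h i less ok0 ok
          by (cases "?h = 0") (simp_all add: pairs_body_def val VW diff_less_mono2 wp_push)
      qed
    qed
  qed
  have loop: "wpp (WHILE And (Lt (Var Vi) (Var Vp)) (Lt (Var VL) (Var Vp \<oslash> Num 4)) DO pairs_body) Q s H n'"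
    if "I s H n'" for s H n'
    using that
  proof (rule wp_While[where I = I and \<mu> = "\<lambda>s H. p - s Vi"])
    fix s H n'
    assume I: "I s H n'"
    then have P: "s Vp = p" and inv: "pairs_inv s H"
      unfolding I_def pairs_inv_def base_def by blast+
    show "bok M (p * p) (And (Lt (Var Vi) (Var Vp)) (Lt (Var VL) (Var Vp \<oslash> Num 4))) s H"
      using M by simp
    show "wpp pairs_body (\<lambda>s' H' n'. I s' H' n' \<and> p - s' Vi < p - s Vi) s H (Suc n')"
      if "bval (And (Lt (Var Vi) (Var Vp)) (Lt (Var VL) (Var Vp \<oslash> Num 4))) s H"
      using body[OF I] that P by simp
    show "Q s H (Suc n')" if "\<not> bval (And (Lt (Var Vi) (Var Vp)) (Lt (Var VL) (Var Vp \<oslash> Num 4))) s H"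
    proof -
      have "p \<le> 4 * (s VL + 1)"
      proof (cases "p div 4 \<le> s VL")
        case True
        then show ?thesis
          by presburger
      next
        \<comment> \<open>The elements ran out before the threshold was met. With P pairs and U left
          over, m + 2 P = p - 1 - card U \<ge> p / 2 - 1 - m, so 4 (m + P) \<ge> p - 2, and
          \<open>s VL\<close> is at least m + P.\<close>
        case False
        then have i: "s Vi = p"
          using that P I unfolding I_def by simp
        have st: "stacks p (H AOwn) (H AH) (H ASt)"
          using I i unfolding I_def by metis
        let ?U = "{j \<in> {1..<p}. H AOwn j = 0}"
        have same: "v j = v j'" if "j \<in> ?U" "j' \<in> ?U" "v j div (m + 1) = v j' div (m + 1)" for j j'
        proof -
          have "j \<in> bucket p (H AOwn) (v j div (m + 1))" "j' \<in> bucket p (H AOwn) (v j div (m + 1))"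
            using that unfolding bucket_def by auto
          then show ?thesis
            using st unfolding stacks_def by blast
        qed
        define U where "U = ?U"
        have "2 * card U \<le> p + 2 * m"
          unfolding U_def by (rule leftover_bound[of _ p v]) (use v_bounds(2) mult same in \<open>auto simp: v_def m_def\<close>)
        moreover have "card U + used (H AOwn) + 1 = p"
        proof -
          have "card (?U \<union> {j \<in> {1..<p}. H AOwn j \<noteq> 0}) = card ?U + used (H AOwn)"
            unfolding used_def by (intro card_Un_disjoint) auto
          moreover have "?U \<union> {j \<in> {1..<p}. H AOwn j \<noteq> 0} = {1..<p}"
            by auto
          ultimately show ?thesis
            using p2 unfolding U_def by simp
        qed
        moreover have "used (H AOwn) + m + 2 * s Vt = 2 * p" "p \<le> s VL + s Vt"
          using inv unfolding pairs_inv_def by blast+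
        ultimately show ?thesis
          by simp
      qed
      moreover have "s VL < p" "s Vi \<le> p" "n' \<le> n + 30 * s Vi + 3 * s VL"
        using I inv unfolding I_def pairs_inv_def interval_def by blast+
      ultimately show ?thesis
        using inv p2 by (intro Q) auto
    qed
  qed
  have "used (H AOwn) = m"
    unfolding used_def m_def using ones by (intro arg_cong[of _ _ card]) auto
  moreover have "stacks 1 (H AOwn) (H AH) (H ASt)"
    using zerosD[OF assms(7)] unfolding stacks_def bucket_def by auto
  ultimately have "I (s(VW := Suc m, Vi := 1)) H (Suc (Suc n))"
    using assms ones p2 unfolding I_def pairs_inv_def by auto
  then show ?thesis
    unfolding pairs_pass_def using assms(4,5) M loop[of "s(VW := Suc m, Vi := 1)"] by simp
qed

end

section \<open>Single elements and the gaps of the reached set\<close>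

definition gaps_body :: prog where
  "gaps_body =
     ALo[Var VC] ::= Var Vg;;
     Vg ::= Var Vg \<oplus> Var VW;;
     (IF Lt (Var Vp) (Var Vg) THEN AHi[Var VC] ::= Var Vp ELSE AHi[Var VC] ::= Var Vg);;
     VC ::= Var VC \<oplus> Num 1"

definition gaps_pass :: prog where
  "gaps_pass =
     VW ::= Var VL \<oplus> Num 1;;
     VC ::= Num 0;;
     Vg ::= Var VW;;
     WHILE Lt (Var Vg) (Var Vp) DO gaps_body"

definition left_loop :: prog where
  "left_loop =
     WHILE And (Lt (Var Vlo) (Var Vhi))
       (Lt (Var Vt) (Get ATime ((Var Vlo \<oplus> Var Vp \<ominus> Var Vd) \<odot> Var Vp)))
     DO (ATime[Var Vlo] ::= Var Vt;; Vlo ::= Var Vlo \<oplus> Num 1)"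

definition right_loop :: prog where
  "right_loop =
     WHILE And (Lt (Var Vlo) (Var Vhi))
       (Lt (Var Vt) (Get ATime ((Var Vhi \<ominus> Num 1 \<oplus> Var Vp \<ominus> Var Vd) \<odot> Var Vp)))
     DO (Vhi ::= Var Vhi \<ominus> Num 1;; ATime[Var Vhi] ::= Var Vt)"

definition block_step :: prog where
  "block_step =
     Vlo ::= Get ALo (Var Vg);;
     Vhi ::= Get AHi (Var Vg);;
     left_loop;;
     right_loop;;
     ALo[Var Vg] ::= Var Vlo;;
     AHi[Var Vg] ::= Var Vhi"

definition blocks_loop :: prog where
  "blocks_loop =
     Vg ::= Num 0;;
     WHILE Lt (Var Vg) (Var VC) DO (block_step;; Vg ::= Var Vg \<oplus> Num 1)"

definition grow_body :: prog where
  "grow_body =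
     (IF Neq (Get AOwn (Var Vi)) (Num 0)
      THEN Skip
      ELSE (Vd ::= Get AVal (Var Vi);;
            Vt ::= Var Vt \<ominus> Num 1;;
            AOwn[Var Vi] ::= Var Vt;;
            AI[Var Vt] ::= Var Vi;;
            AD[Var Vt] ::= Var Vd;;
            blocks_loop));;
     Vi ::= Var Vi \<oplus> Num 1"

definition grow_pass :: prog where
  "grow_pass =
     Vi ::= Num 1;;
     WHILE Lt (Var Vi) (Var Vp) DO grow_body"

lemma wp_Seq_fun: "wp M N (c ;; c') Q = wp M N c (wp M N c' Q)"
  by (simp add: fun_eq_iff)

context normalised
begin

lemma wp_gaps:
  assumes inv: "pairs_inv s H" and L: "s VL = L" "p \<le> 4 * (L + 1)"
    and Q: "\<And>s' H' n'. pairs_inv s' H' \<Longrightarrow> s' VL = L \<Longrightarrow> s' VC < 4 \<Longrightarrow> p \<le> (s' VC + 1) * (L + 1) \<Longrightarrow>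
      (\<And>g. g < s' VC \<Longrightarrow> H' ALo g = (g + 1) * (L + 1) \<and> H' AHi g = min ((g + 2) * (L + 1)) p \<and> (g + 1) * (L + 1) < p) \<Longrightarrow>
      n' \<le> n + 50 * p \<Longrightarrow> Q s' H' n'"
  shows "wpp gaps_pass Q s H n"
proof -
  let ?W = "L + 1"
  have Lp: "L < p"
    using inv L(1) unfolding pairs_inv_def interval_def by blast
  define I where "I s H n' \<longleftrightarrow> pairs_inv s H \<and> s VL = L \<and> s VW = ?W \<and> s Vg = (s VC + 1) * ?W \<and> s VC * ?W < p \<and>
    (\<forall>g<s VC. H ALo g = (g + 1) * ?W \<and> H AHi g = min ((g + 2) * ?W) p \<and> (g + 1) * ?W < p) \<and> n' \<le> n + 4 + 6 * s VC"
    for s H n'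
  \<comment> \<open>The interval \<open>{0..L}\<close> already covers a quarter of the residues, so
    at most three blocks lie behind it.\<close>
  have C4: "C < 4" if "C * ?W < p" for C
  proof (rule ccontr)
    assume "\<not> C < 4"
    then have "4 * ?W \<le> C * ?W"
      by (intro mult_le_mono1) simp
    then show False
      using that L(2) by simp
  qed
  have loop: "wpp (WHILE Lt (Var Vg) (Var Vp) DO gaps_body) Q s H n'" if "I s H n'" for s H n'
    using that
  proof (rule wp_While[where I = I and \<mu> = "\<lambda>s H. p - s Vg"])
    fix s H n'
    assume I: "I s H n'"
    have inv: "pairs_inv s H" and s: "s VL = L" "s VW = ?W" "s Vg = (s VC + 1) * ?W" "s VC * ?W < p" "n' \<le> n + 4 + 6 * s VC"
      and g: "\<And>g. g < s VC \<Longrightarrow> H ALo g = (g + 1) * ?W \<and> H AHi g = min ((g + 2) * ?W) p \<and> (g + 1) * ?W < p"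
      using I unfolding I_def by blast+
    have P: "s Vp = p"
      using inv unfolding pairs_inv_def base_def by blast
    show "bok M (p * p) (Lt (Var Vg) (Var Vp)) s H"
      by simp
    show "wpp gaps_body (\<lambda>s' H' n'. I s' H' n' \<and> p - s' Vg < p - s Vg) s H (Suc n')"
      if "bval (Lt (Var Vg) (Var Vp)) s H"
    proof -
      let ?g = "s Vg" and ?C = "s VC"
      have gp: "?g < p"
        using that P by simp
      have C: "?C < 4"
        using C4 s(4) .
      have C': "?C < p"
        using gp s(3) by simp
      have less: "?C < p * p" "?g + ?W < M" "Suc ?C < M" "Suc 0 < M"
        using C C' index_bound[of ?C] gp Lp M by auto
      have nxt: "?g + ?W = (?C + 2) * ?W"
        using s(3) by simp
      let ?s = "s(Vg := ?g + ?W, VC := Suc ?C)"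
      let ?H = "\<lambda>h. H(ALo := (H ALo)(?C := ?g), AHi := (H AHi)(?C := h))"
      have "I ?s (?H (min (?g + ?W) p)) (Suc (Suc (Suc (Suc (Suc (Suc n'))))))"
        unfolding I_def using inv s g gp nxt by (simp add: less_Suc_eq)
      moreover have "min (?g + ?W) p = (if p < ?g + ?W then p else ?g + ?W)"
        by (simp add: min_def)
      moreover have "p - (?g + ?W) < p - ?g"
        using gp by simp
      ultimately show ?thesis
        using less s(2) P by (simp add: gaps_body_def split: if_splits)
    qed
    show "Q s H (Suc n')" if "\<not> bval (Lt (Var Vg) (Var Vp)) s H"
    proof (rule Q)
      show "s VC < 4"
        using C4 s(4) .
      then show "Suc n' \<le> n + 50 * p"
        using s(5) p2 by simp
    qed (use inv s g that P in auto)
  qed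
  have "I (s(VW := Suc L, VC := 0, Vg := Suc L)) H (Suc (Suc (Suc n)))"
    unfolding I_def using inv L p2 by simp
  then show ?thesis
    unfolding gaps_pass_def using L(1) Lp M loop by simp
qed

definition reached :: "arr heap \<Rightarrow> nat set" where
  "reached H = {x. x < p \<and> H ATime x \<noteq> 0}"

lemma wp_left:
  assumes mvt: "mv t H" and t: "0 < t" "t < p" and "H AD t = d" "d < p"
    and s: "s Vlo = lo" "s Vhi = hi" "s Vt = t" "s Vp = p" "s Vd = d" and lo: "0 < lo" "lo \<le> hi" "hi \<le> p"
    and S: "\<And>x. x < p \<Longrightarrow> t < H ATime x \<longleftrightarrow> x \<in> S" and zero: "\<And>x. lo \<le> x \<Longrightarrow> x < hi \<Longrightarrow> H ATime x = 0"
    and Q: "\<And>l T n'. lo \<le> l \<Longrightarrow> l \<le> hi \<Longrightarrow> (\<And>x. lo \<le> x \<Longrightarrow> x < l \<Longrightarrow> shift p x d \<in> S) \<Longrightarrow> l = hi \<or> shift p l d \<notin> S \<Longrightarrow>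
      T = (\<lambda>x. if lo \<le> x \<and> x < l then t else H ATime x) \<Longrightarrow> mv t (H(ATime := T)) \<Longrightarrow>
      n' \<le> n + 3 * (l - lo) + 1 \<Longrightarrow> Q (s(Vlo := l)) (H(ATime := T)) n'"
  shows "wpp left_loop Q s H n"
proof -
  define T where "T l = (\<lambda>x. if lo \<le> x \<and> x < l then t else H ATime x)" for l
  define I where "I s' H' n' \<longleftrightarrow> (\<exists>l. s' = s(Vlo := l) \<and> H' = H(ATime := T l) \<and> lo \<le> l \<and> l \<le> hi \<and>
    (\<forall>x. lo \<le> x \<longrightarrow> x < l \<longrightarrow> shift p x d \<in> S) \<and> mv t H' \<and> n' \<le> n + 3 * (l - lo))" for s' H' n'
  \<comment> \<open>Residues of the gap change their number from 0 to \<open>t\<close>, and neither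
    passes the test \<open>t < T x\<close>. Membership in the old set \<open>S\<close> can thus be
    read off throughout the scan.\<close>
  have TS: "t < T l x \<longleftrightarrow> x \<in> S" if "x < p" "l \<le> hi" for l x
    using S[OF that(1)] zero[of x] that(2) unfolding T_def by auto
  have I0: "I s H n"
    unfolding I_def T_def using s lo mvt by (intro exI[of _ lo]) (auto simp: fun_eq_iff)
  have p0: "0 < p"
    using p2 by simp
  show ?thesis
    unfolding left_loop_def
  proof (rule wp_While[where I = I and \<mu> = "\<lambda>s H. p - s Vlo", OF I0])
    fix s' H' n'
    assume "I s' H' n'"
    then obtain l where I: "s' = s(Vlo := l)" "H' = H(ATime := T l)" "lo \<le> l" "l \<le> hi"
      "\<forall>x. lo \<le> x \<longrightarrow> x < l \<longrightarrow> shift p x d \<in> S" "mv t H'" "n' \<le> n + 3 * (l - lo)"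
      unfolding I_def by blast
    let ?b = "And (Lt (Var Vlo) (Var Vhi)) (Lt (Var Vt) (Get ATime ((Var Vlo \<oplus> Var Vp \<ominus> Var Vd) \<odot> Var Vp)))"
    have val: "s' Vlo = l" "s' Vhi = hi" "s' Vt = t" "s' Vp = p" "s' Vd = d"
      using I(1) s by simp_all
    have shift: "(l + p - d) mod p = shift p l d" "shift p l d < p * p"
      using index_bound[OF less_imp_le[OF shift_less[OF p0]]] by (simp_all add: shift_def)
    have less: "l + p < M" "d \<le> l + p"
      using I(4) lo M assms(5) by auto
    have b: "bval ?b s' H' \<longleftrightarrow> l < hi \<and> shift p l d \<in> S"
      using TS[OF shift_less[OF p0], of l l d] I(2,4) by (simp add: val shift)
    show "bok M (p * p) ?b s' H'"
      using less by (simp add: val shift)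
    show "wpp (ATime[Var Vlo] ::= Var Vt;; Vlo ::= Var Vlo \<oplus> Num 1)
        (\<lambda>s'' H'' n''. I s'' H'' n'' \<and> p - s'' Vlo < p - s' Vlo) s' H' (Suc n')"
      if "bval ?b s' H'"
    proof -
      have l: "l < hi" "shift p l d \<in> S" "l < p"
        using that b lo by auto
      have T: "(T l)(l := t) = T (Suc l)"
        using I(3) unfolding T_def by (auto simp: fun_eq_iff)
      have "H' ATime l = 0"
        using zero[OF I(3) l(1)] I(2) unfolding T_def by simp
      moreover have "t < H' ATime (shift p l (H' AD t))"
        using l(2) TS[OF shift_less[OF p0], of l l d] I(2,4) assms(4) by simp
      ultimately have "mv t (H'(ATime := (H' ATime)(l := t)))"
        using mv_time[OF I(6) t, of l] I(3) lo l by simp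
      then have "mv t (H(ATime := T (Suc l)))"
        using I(2) T by simp
      then have "I (s(Vlo := Suc l)) (H(ATime := T (Suc l))) (Suc (Suc (Suc n')))"
        unfolding I_def using I(3,5,7) l by (intro exI[of _ "Suc l"]) (auto simp: less_Suc_eq)
      then show ?thesis
        using I(1,2) T l less index_bound[of l] M s(3) by (simp add: val diff_less_mono2)
    qed
    show "Q s' H' (Suc n')" if "\<not> bval ?b s' H'"
    proof -
      have "l = hi \<or> shift p l d \<notin> S"
        using that b I(4) by auto
      then show ?thesis
        unfolding I(1,2) using I by (intro Q) (auto simp: T_def)
    qed
  qed
qed

lemma wp_right:
  assumes mvt: "mv t H" and t: "0 < t" "t < p" and "H AD t = d" "d < p"
    and s: "s Vlo = lo" "s Vhi = hi" "s Vt = t" "s Vp = p" "s Vd = d" and lo: "0 < lo" "lo \<le> hi" "hi \<le> p"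
    and S: "\<And>x. x < p \<Longrightarrow> t < H ATime x \<longleftrightarrow> x \<in> S" and zero: "\<And>x. lo \<le> x \<Longrightarrow> x < hi \<Longrightarrow> H ATime x = 0"
    and Q: "\<And>h T n'. lo \<le> h \<Longrightarrow> h \<le> hi \<Longrightarrow> (\<And>x. h \<le> x \<Longrightarrow> x < hi \<Longrightarrow> shift p x d \<in> S) \<Longrightarrow>
      h = lo \<or> shift p (h - 1) d \<notin> S \<Longrightarrow>
      T = (\<lambda>x. if h \<le> x \<and> x < hi then t else H ATime x) \<Longrightarrow> mv t (H(ATime := T)) \<Longrightarrow>
      n' \<le> n + 3 * (hi - h) + 1 \<Longrightarrow> Q (s(Vhi := h)) (H(ATime := T)) n'"
  shows "wpp right_loop Q s H n"
proof -
  define T where "T h = (\<lambda>x. if h \<le> x \<and> x < hi then t else H ATime x)" for h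
  define I where "I s' H' n' \<longleftrightarrow> (\<exists>h. s' = s(Vhi := h) \<and> H' = H(ATime := T h) \<and> lo \<le> h \<and> h \<le> hi \<and>
    (\<forall>x. h \<le> x \<longrightarrow> x < hi \<longrightarrow> shift p x d \<in> S) \<and> mv t H' \<and> n' \<le> n + 3 * (hi - h))" for s' H' n'
  have TS: "t < T h x \<longleftrightarrow> x \<in> S" if "x < p" "lo \<le> h" for h x
    using S[OF that(1)] zero[of x] that(2) unfolding T_def by auto
  have I0: "I s H n"
    unfolding I_def T_def using s lo mvt by (intro exI[of _ hi]) (auto simp: fun_eq_iff)
  have p0: "0 < p"
    using p2 by simp
  show ?thesis
    unfolding right_loop_def
  proof (rule wp_While[where I = I and \<mu> = "\<lambda>s H. s Vhi", OF I0])
    fix s' H' n'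
    assume "I s' H' n'"
    then obtain h where I: "s' = s(Vhi := h)" "H' = H(ATime := T h)" "lo \<le> h" "h \<le> hi"
      "\<forall>x. h \<le> x \<longrightarrow> x < hi \<longrightarrow> shift p x d \<in> S" "mv t H'" "n' \<le> n + 3 * (hi - h)"
      unfolding I_def by blast
    let ?b = "And (Lt (Var Vlo) (Var Vhi)) (Lt (Var Vt) (Get ATime ((Var Vhi \<ominus> Num 1 \<oplus> Var Vp \<ominus> Var Vd) \<odot> Var Vp)))"
    have val: "s' Vlo = lo" "s' Vhi = h" "s' Vt = t" "s' Vp = p" "s' Vd = d"
      using I(1) s by simp_all
    have h0: "1 \<le> h"
      using I(3) lo by simp
    have shift: "(h - Suc 0 + p - d) mod p = shift p (h - 1) d" "shift p (h - 1) d < p * p"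
      using index_bound[OF less_imp_le[OF shift_less[OF p0]]] by (simp_all add: shift_def)
    have less: "h - Suc 0 + p < M" "d \<le> h - Suc 0 + p" "Suc 0 < M"
      using I(4) lo M assms(5) by auto
    have mods: "y mod p < p * p" for y
      using index_bound[of "y mod p"] p0 by simp
    have b: "bval ?b s' H' \<longleftrightarrow> lo < h \<and> shift p (h - 1) d \<in> S"
      using TS[OF shift_less[OF p0] I(3), of "h - 1" d] I(2) by (simp add: val shift)
    show "bok M (p * p) ?b s' H'"
      using less h0 by (simp add: val mods)
    show "wpp (Vhi ::= Var Vhi \<ominus> Num 1;; ATime[Var Vhi] ::= Var Vt)
        (\<lambda>s'' H'' n''. I s'' H'' n'' \<and> s'' Vhi < s' Vhi) s' H' (Suc n')"
      if "bval ?b s' H'"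
    proof -
      let ?h = "h - 1"
      have l: "lo \<le> ?h" "?h < hi" "shift p ?h d \<in> S" "?h < p" "?h < h"
        using that b lo I(4) by auto
      have T: "(T h)(?h := t) = T ?h"
        using I(4) l unfolding T_def by (auto simp: fun_eq_iff)
      have "H' ATime ?h = 0"
        using zero[OF l(1,2)] I(2) l(5) unfolding T_def by simp
      moreover have "t < H' ATime (shift p ?h (H' AD t))"
        using l(3) TS[OF shift_less[OF p0] I(3), of ?h d] I(2) assms(4) by simp
      ultimately have "mv t (H'(ATime := (H' ATime)(?h := t)))"
        using mv_time[OF I(6) t, of ?h] l lo by simp
      then have mv': "mv t (H(ATime := T ?h))"
        using I(2) T by simp
      have "I (s(Vhi := ?h)) (H(ATime := T ?h)) (Suc (Suc (Suc n')))"
        unfolding I_def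
      proof (intro exI[of _ ?h] conjI allI impI)
        show "shift p x d \<in> S" if "?h \<le> x" "x < hi" for x
          using I(5) l(3) that by (cases "x = ?h") auto
        show "Suc (Suc (Suc n')) \<le> n + 3 * (hi - ?h)"
          using I(4,7) h0 by auto
      qed (use mv' l in auto)
      then show ?thesis
        using I(1,2) T l less h0 index_bound[of ?h] s(3) by (simp add: val)
    qed
    show "Q s' H' (Suc n')" if "\<not> bval ?b s' H'"
    proof -
      have "h = lo \<or> shift p (h - 1) d \<notin> S"
        using that b I(3) by auto
      then show ?thesis
        unfolding I(1,2) using I by (intro Q) (auto simp: T_def)
    qed
  qed
qed

text \<open>The scans stop at residues \<open>l\<close> and \<open>h - 1\<close> that are not
  entered. By \<open>runs_gap\<close> nothing between them is entered either, so one gap remains.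
  The scanning time is charged to the amount by which the gap shrinks.\<close>

lemma wp_block:
  assumes mvt: "mv t H" and t: "0 < t" "t < p" and d: "H AD t = d" "d < p"
    and s: "s Vg = g" "s Vt = t" "s Vp = p" "s Vd = d" and g: "g < p" "H ALo g = lo" "H AHi g = hi"
    and lo: "0 < lo" "lo \<le> hi" "hi \<le> p" and W: "hi - lo \<le> W" "W \<le> p" "runs p W S"
    and S: "\<And>x. x < p \<Longrightarrow> t < H ATime x \<longleftrightarrow> x \<in> S" and zero: "\<And>x. lo \<le> x \<Longrightarrow> x < hi \<Longrightarrow> H ATime x = 0"
    and Q: "\<And>l h T n'. lo \<le> l \<Longrightarrow> l \<le> h \<Longrightarrow> h \<le> hi \<Longrightarrow>
      (\<And>x. lo \<le> x \<Longrightarrow> x < hi \<Longrightarrow> shift p x d \<in> S \<longleftrightarrow> x < l \<or> h \<le> x) \<Longrightarrow>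
      T = (\<lambda>x. if lo \<le> x \<and> x < l \<or> h \<le> x \<and> x < hi then t else H ATime x) \<Longrightarrow> mv t (H(ATime := T)) \<Longrightarrow>
      n' + 3 * (h - l) \<le> n + 6 + 3 * (hi - lo) \<Longrightarrow>
      Q (s(Vlo := l, Vhi := h)) (H(ATime := T, ALo := (H ALo)(g := l), AHi := (H AHi)(g := h))) n'"
  shows "wpp block_step Q s H n"
proof -
  let ?end = "wpp (ALo[Var Vg] ::= Var Vlo;; AHi[Var Vg] ::= Var Vhi) Q"
  let ?s = "s(Vlo := lo, Vhi := hi)"
  have gN: "g < p * p"
    using index_bound[of g] g(1) by simp
  have "wpp left_loop (wpp right_loop ?end) ?s H (Suc (Suc n))"
  proof (rule wp_left[OF mvt t d _ _ _ _ _ lo S zero])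
    fix l T1 n1
    assume l: "lo \<le> l" "l \<le> hi" "\<And>x. lo \<le> x \<Longrightarrow> x < l \<Longrightarrow> shift p x d \<in> S" "l = hi \<or> shift p l d \<notin> S"
      and T1: "T1 = (\<lambda>x. if lo \<le> x \<and> x < l then t else H ATime x)"
      and mv1: "mv t (H(ATime := T1))" and n1: "n1 \<le> Suc (Suc n) + 3 * (l - lo) + 1"
    have S1: "t < T1 x \<longleftrightarrow> x \<in> S" if "x < p" for x
      using S[OF that] zero[of x] l(2) unfolding T1 by auto
    have zero1: "T1 x = 0" if "l \<le> x" "x < hi" for x
      using zero[of x] that l(1) unfolding T1 by auto
    show "wpp right_loop ?end (?s(Vlo := l)) (H(ATime := T1)) n1"
    proof (rule wp_right[OF mv1 t _ d(2), where S = S and lo = l and hi = hi])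
      fix h T2 n2
      assume h: "l \<le> h" "h \<le> hi" "\<And>x. h \<le> x \<Longrightarrow> x < hi \<Longrightarrow> shift p x d \<in> S" "h = l \<or> shift p (h - 1) d \<notin> S"
        and T2: "T2 = (\<lambda>x. if h \<le> x \<and> x < hi then t else (H(ATime := T1)) ATime x)"
        and mv2: "mv t (H(ATime := T1, ATime := T2))" and n2: "n2 \<le> n1 + 3 * (hi - h) + 1"
      have gap: "shift p x d \<notin> S" if "l \<le> x" "x < h" for x
      proof (rule runs_gap[OF W(3,2) d(2) that])
        show "h \<le> p" "h - l \<le> W"
          using h l lo W by auto
        show "shift p l d \<notin> S" "shift p (h - 1) d \<notin> S"
          using l(4) h(1,2,4) that by auto
      qed
      have "shift p x d \<in> S \<longleftrightarrow> x < l \<or> h \<le> x" if "lo \<le> x" "x < hi" for x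
        using gap[of x] l(3)[of x] h(3)[of x] that by (meson not_le)
      moreover have "T2 = (\<lambda>x. if lo \<le> x \<and> x < l \<or> h \<le> x \<and> x < hi then t else H ATime x)"
        unfolding T2 T1 by (auto simp: fun_eq_iff)
      ultimately have "Q (s(Vlo := l, Vhi := h)) (H(ATime := T2, ALo := (H ALo)(g := l), AHi := (H AHi)(g := h))) (Suc (Suc n2))"
        using l h mv2 n1 n2 by (intro Q) auto
      then show "?end (?s(Vlo := l, Vhi := h)) (H(ATime := T1, ATime := T2)) n2"
        using gN s(1) by (simp add: fun_upd_twist)
    qed (use s d l lo S1 zero1 in simp_all)
  qed (use s in simp_all)
  then show ?thesis
    unfolding block_step_def wp_Seq_fun using gN s(1) g by simp
qed

text \<open>The numbering starts behind \<open>{..<W}\<close>, which is reached from the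
  outset.\<close>

definition blk :: "nat \<Rightarrow> nat \<Rightarrow> nat set" where
  "blk W g = {x. (g + 1) * W \<le> x \<and> x < (g + 2) * W \<and> x < p}"

lemma blk_div:
  assumes "x \<in> blk W g"
  shows "x div W = g + 1"
proof -
  have "W * (g + 1) \<le> x" "x < W * Suc (g + 1)"
    using assms unfolding blk_def by (auto simp: algebra_simps)
  then show ?thesis
    by (rule div_nat_eqI)
qed

lemma in_blk:
  assumes "x < p" "W \<le> x" "0 < W" "p \<le> (C + 1) * W"
  shows "\<exists>g<C. x \<in> blk W g"
proof -
  define g where "g = x div W - 1"
  have "0 < x div W"
    using assms by (simp add: div_greater_zero_iff)
  then have g: "x div W = g + 1"
    unfolding g_def by simp
  have "(x div W) * W \<le> x" "x < (x div W + 1) * W"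
    using div_times_less_eq_dividend[of x W] dividend_less_div_times[OF assms(3), of x] by (auto simp: algebra_simps)
  then have x: "(g + 1) * W \<le> x" "x < (g + 2) * W"
    using g by simp_all
  moreover have "(g + 1) * W < (C + 1) * W"
    using x(1) assms(1,4) by linarith
  then have "g < C"
    using mult_less_cancel2[of "g + 1" W "C + 1"] by simp
  ultimately show ?thesis
    using assms(1) unfolding blk_def by blast
qed

definition gap :: "nat \<Rightarrow> nat \<Rightarrow> nat set \<Rightarrow> arr heap \<Rightarrow> bool" where
  "gap W g S H \<longleftrightarrow> (g + 1) * W \<le> H ALo g \<and> H ALo g \<le> H AHi g \<and> H AHi g \<le> (g + 2) * W \<and> H AHi g \<le> p \<and>
     (\<forall>x\<in>blk W g. (x \<in> S \<longleftrightarrow> x < H ALo g \<or> H AHi g \<le> x) \<and> (H ATime x \<noteq> 0 \<longleftrightarrow> x \<in> S))"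

definition gaps :: "nat \<Rightarrow> nat \<Rightarrow> nat set \<Rightarrow> arr heap \<Rightarrow> bool" where
  "gaps W C S H \<longleftrightarrow> 0 < W \<and> W \<le> p \<and> C \<le> 4 \<and> p \<le> (C + 1) * W \<and> {..<W} \<subseteq> S \<and> runs p W S \<and> S = reached H \<and>
     (\<forall>g<C. gap W g S H)"

text \<open>The potential that pays for the scans: gaps never grow, so all steps together scan only
  linearly many residues beyond a constant number each.\<close>

definition gap_size :: "nat \<Rightarrow> arr heap \<Rightarrow> nat" where
  "gap_size C H = (\<Sum>g<C. H AHi g - H ALo g)"

lemma gap_size_upd:
  assumes "g < C"
  shows "gap_size C (H(ATime := T, ALo := (H ALo)(g := l), AHi := (H AHi)(g := h))) + (H AHi g - H ALo g) =
    gap_size C H + (h - l)"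
proof -
  have "gap_size C H' = (H' AHi g - H' ALo g) + (\<Sum>g'\<in>{..<C} - {g}. H' AHi g' - H' ALo g')" for H'
    unfolding gap_size_def using assms by (subst sum.remove[of _ g]) auto
  note this[of H] this[of "H(ATime := T, ALo := (H ALo)(g := l), AHi := (H AHi)(g := h))"]
  moreover have "(\<Sum>g'\<in>{..<C} - {g}. ((H AHi)(g := h)) g' - ((H ALo)(g := l)) g') =
    (\<Sum>g'\<in>{..<C} - {g}. H AHi g' - H ALo g')"
    by (intro sum.cong) auto
  ultimately show ?thesis
    by simp
qed

lemma wp_blocks:
  assumes mvt: "mv t H" and t: "0 < t" "t < p" and d: "H AD t = d" "d < p"
    and s: "s Vt = t" "s Vp = p" "s Vd = d" "s VC = C"
    and gaps: "gaps W C S H" and S: "\<And>x. x < p \<Longrightarrow> t < H ATime x \<longleftrightarrow> x \<in> S"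
    and Q: "\<And>s' H' n'. mv t H' \<Longrightarrow> gaps W C (grow p d S) H' \<Longrightarrow>
      (\<And>X. X \<noteq> Vg \<Longrightarrow> X \<noteq> Vlo \<Longrightarrow> X \<noteq> Vhi \<Longrightarrow> s' X = s X) \<Longrightarrow>
      (\<And>A. A \<noteq> ATime \<Longrightarrow> A \<noteq> ALo \<Longrightarrow> A \<noteq> AHi \<Longrightarrow> H' A = H A) \<Longrightarrow>
      n' + 3 * gap_size C H' \<le> n + 40 + 3 * gap_size C H \<Longrightarrow> Q s' H' n'"
  shows "wpp blocks_loop Q s H n"
proof -
  let ?G = "grow p d S"
  have W: "0 < W" "W \<le> p" and C: "C \<le> 4" "p \<le> (C + 1) * W" and SW: "{..<W} \<subseteq> S" and runs: "runs p W S"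
    and Sr: "S = reached H" and gap0: "\<And>g. g < C \<Longrightarrow> gap W g S H"
    using gaps unfolding gaps_def by blast+
  \<comment> \<open>During a pass the blocks before \<open>Vg\<close> describe the grown set and the
    others still the old one. The old set itself stays visible through the numbers above
    \<open>t\<close>.\<close>
  define I where "I s' H' n' \<longleftrightarrow> (\<forall>X. X \<noteq> Vg \<longrightarrow> X \<noteq> Vlo \<longrightarrow> X \<noteq> Vhi \<longrightarrow> s' X = s X) \<and>
    (\<forall>A. A \<noteq> ATime \<longrightarrow> A \<noteq> ALo \<longrightarrow> A \<noteq> AHi \<longrightarrow> H' A = H A) \<and> s' Vg \<le> C \<and> mv t H' \<and>
    (\<forall>x<p. t < H' ATime x \<longleftrightarrow> x \<in> S) \<and>
    (\<forall>g<C. gap W g (if g < s' Vg then ?G else S) H') \<and>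
    n' + 3 * gap_size C H' \<le> n + 9 * s' Vg + 1 + 3 * gap_size C H" for s' H' n'
  have loop: "wpp (WHILE Lt (Var Vg) (Var VC) DO (block_step;; Vg ::= Var Vg \<oplus> Num (Suc 0))) Q s' H' n'"
    if "I s' H' n'" for s' H' n'
    using that
  proof (rule wp_While[where I = I and \<mu> = "\<lambda>s H. C - s Vg"])
    fix s' H' n'
    assume I: "I s' H' n'"
    have fr: "\<And>X. X \<noteq> Vg \<Longrightarrow> X \<noteq> Vlo \<Longrightarrow> X \<noteq> Vhi \<Longrightarrow> s' X = s X"
      and fr': "\<And>A. A \<noteq> ATime \<Longrightarrow> A \<noteq> ALo \<Longrightarrow> A \<noteq> AHi \<Longrightarrow> H' A = H A"
      and gC: "s' Vg \<le> C" and mv': "mv t H'" and S': "\<And>x. x < p \<Longrightarrow> t < H' ATime x \<longleftrightarrow> x \<in> S"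
      and gap': "\<And>g. g < C \<Longrightarrow> gap W g (if g < s' Vg then ?G else S) H'"
      and n': "n' + 3 * gap_size C H' \<le> n + 9 * s' Vg + 1 + 3 * gap_size C H"
      using I unfolding I_def by blast+
    have val: "s' Vt = t" "s' Vp = p" "s' Vd = d" "s' VC = C" "H' AD t = d"
      using fr fr' s d by auto
    show "bok M (p * p) (Lt (Var Vg) (Var VC)) s' H'"
      by simp
    show "wpp (block_step;; Vg ::= Var Vg \<oplus> Num (Suc 0))
        (\<lambda>s'' H'' n''. I s'' H'' n'' \<and> C - s'' Vg < C - s' Vg) s' H' (Suc n')"
      if "bval (Lt (Var Vg) (Var VC)) s' H'"
    proof -
      let ?g = "s' Vg"
      have g: "?g < C"
        using that val by simp
      let ?lo = "H' ALo ?g" and ?hi = "H' AHi ?g"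
      have gg: "(?g + 1) * W \<le> ?lo" "?lo \<le> ?hi" "?hi \<le> (?g + 2) * W" "?hi \<le> p"
        "\<And>x. x \<in> blk W ?g \<Longrightarrow> x \<in> S \<longleftrightarrow> x < ?lo \<or> ?hi \<le> x" "\<And>x. x \<in> blk W ?g \<Longrightarrow> H' ATime x \<noteq> 0 \<longleftrightarrow> x \<in> S"
        using gap'[OF g] unfolding gap_def by auto
      have sub: "x \<in> blk W ?g" if "?lo \<le> x" "x < ?hi" for x
        using gg(1-4) that unfolding blk_def by simp
      have gp: "?g < p"
      proof -
        have "?g + 1 \<le> (?g + 1) * W"
          using mult_le_mono2[of 1 W "?g + 1"] W(1) by simp
        then show ?thesis
          using gg(1,2,4) by linarith
      qed
      show ?thesis
        unfolding wp_Seq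
      proof (rule wp_block[OF mv' t val(5) d(2) refl val(1-3) gp refl refl _ gg(2,4) _ W(2) runs S'])
        show "0 < ?lo"
          using gg(1) W(1) by (meson add_gr_0 less_le_trans nat_0_less_mult_iff zero_less_one)
        show "?hi - ?lo \<le> W"
          using gg(1,3) by (simp add: algebra_simps)
        show "H' ATime x = 0" if "?lo \<le> x" "x < ?hi" for x
          using gg(5,6)[OF sub[OF that]] that by auto
        fix l h T n2
        assume l: "?lo \<le> l" "l \<le> h" "h \<le> ?hi" and sh: "\<And>x. ?lo \<le> x \<Longrightarrow> x < ?hi \<Longrightarrow> shift p x d \<in> S \<longleftrightarrow> x < l \<or> h \<le> x"
          and T: "T = (\<lambda>x. if ?lo \<le> x \<and> x < l \<or> h \<le> x \<and> x < ?hi then t else H' ATime x)"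
          and mv2: "mv t (H'(ATime := T))" and n2: "n2 + 3 * (h - l) \<le> Suc n' + 6 + 3 * (?hi - ?lo)"
        let ?H = "H'(ATime := T, ALo := (H' ALo)(?g := l), AHi := (H' AHi)(?g := h))"
        let ?s = "s'(Vlo := l, Vhi := h, Vg := Suc ?g)"
        have ST: "t < T x \<longleftrightarrow> x \<in> S" if "x < p" for x
        proof (cases "?lo \<le> x \<and> x < ?hi")
          case True
          then have "x \<notin> S"
            using gg(5)[OF sub] by auto
          moreover have "\<not> t < H' ATime x"
            using S'[OF that] calculation by simp
          ultimately show ?thesis
            unfolding T by simp
        next
          case False
          then have "T x = H' ATime x"
            unfolding T using l by auto
          then show ?thesis
            using S'[OF that] by simp
        qed
        have here: "gap W ?g ?G ?H"
        proof -
          have "(x \<in> ?G \<longleftrightarrow> x < l \<or> h \<le> x) \<and> (T x \<noteq> 0 \<longleftrightarrow> x \<in> ?G)" if x: "x \<in> blk W ?g" for x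
          proof (cases "?lo \<le> x \<and> x < ?hi")
            case True
            then have "x \<notin> S" "x < p"
              using gg(5)[OF x] gg(4) by auto
            then have "x \<in> ?G \<longleftrightarrow> x < l \<or> h \<le> x"
              using sh[of x] True unfolding grow_def by auto
            moreover have "T x \<noteq> 0 \<longleftrightarrow> x < l \<or> h \<le> x"
              using True gg(6)[OF x] \<open>x \<notin> S\<close> t(1) unfolding T by auto
            ultimately show ?thesis
              by simp
          next
            case False
            then have "x \<in> S" "T x = H' ATime x" "x < l \<or> h \<le> x"
              using gg(5)[OF x] l unfolding T by auto
            then show ?thesis
              using gg(6)[OF x] unfolding grow_def by auto
          qed
          then show ?thesis
            using gg(1-4) l unfolding gap_def by auto
        qed
        have there: "gap W g (if g < ?g then ?G else S) ?H" if "g < C" "g \<noteq> ?g" for g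
        proof -
          have "T x = H' ATime x" if "x \<in> blk W g" for x
          proof -
            have "x \<notin> blk W ?g"
              using blk_div[OF that] blk_div[of x W ?g] \<open>g \<noteq> ?g\<close> by auto
            then show ?thesis
              using sub[of x] l unfolding T by auto
          qed
          then show ?thesis
            using gap'[OF that(1)] that(2) unfolding gap_def by simp
        qed
        have "gap W g (if g < Suc ?g then ?G else S) ?H" if "g < C" for g
          using here there[OF that] by (cases "g = ?g") (auto simp: less_Suc_eq)
        moreover have "gap_size C ?H + (?hi - ?lo) = gap_size C H' + (h - l)"
          using gap_size_upd[OF g] .
        moreover have "mv t ?H"
          using mv2 by simp
        ultimately have "I ?s ?H (Suc n2)"
          unfolding I_def using fr fr' g ST n' n2 by simp
        then show "wpp (Vg ::= Var Vg \<oplus> Num (Suc 0)) (\<lambda>s'' H'' n''. I s'' H'' n'' \<and> C - s'' Vg < C - ?g)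
            (s'(Vlo := l, Vhi := h)) ?H n2"
          using g C M by (simp add: diff_less_mono2)
      qed
    qed
    show "Q s' H' (Suc n')" if "\<not> bval (Lt (Var Vg) (Var VC)) s' H'"
    proof (rule Q)
      have g: "s' Vg = C"
        using that val gC by simp
      have "x \<in> ?G \<longleftrightarrow> x \<in> reached H'" for x
      proof (cases "x < p \<and> W \<le> x")
        case True
        then obtain g where "g < C" "x \<in> blk W g"
          using in_blk[OF _ _ W(1) C(2)] by blast
        then show ?thesis
          using gap'[of g] g True unfolding gap_def reached_def by auto
      next
        case False
        show ?thesis
        proof (cases "x < p")
          case True
          then have "x \<in> S"
            using False SW by auto
          moreover have "H' ATime x \<noteq> 0"
            using S'[OF True] \<open>x \<in> S\<close> by auto
          ultimately show ?thesis
            using True unfolding reached_def grow_def by simp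
        next
          case False
          then show ?thesis
            using Sr unfolding reached_def grow_def by simp
        qed
      qed
      then have "?G = reached H'"
        by blast
      moreover have "{..<W} \<subseteq> ?G"
        using SW unfolding grow_def by blast
      ultimately show "gaps W C ?G H'"
        using W C runs_grow[OF runs W(2) d(2)] gap' g unfolding gaps_def by simp
      show "Suc n' + 3 * gap_size C H' \<le> n + 40 + 3 * gap_size C H"
        using n' g C(1) by simp
    qed (use mv' fr fr' in auto)
  qed
  have "I (s(Vg := 0)) H (Suc n)"
    unfolding I_def using mvt S gap0 by simp
  then show ?thesis
    unfolding blocks_loop_def using loop M by simp
qed

lemma gaps_heap [simp]: "A \<noteq> ATime \<Longrightarrow> A \<noteq> ALo \<Longrightarrow> A \<noteq> AHi \<Longrightarrow> gaps W C S (H(A := f)) \<longleftrightarrow> gaps W C S H"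
  by (simp add: gaps_def gap_def reached_def)

lemma gap_size_heap [simp]: "A \<noteq> ALo \<Longrightarrow> A \<noteq> AHi \<Longrightarrow> gap_size C (H(A := f)) = gap_size C H"
  by (simp add: gap_size_def)

lemma gaps_init:
  assumes "interval L H" "C \<le> 4" "p \<le> (C + 1) * (L + 1)"
    and "\<And>g. g < C \<Longrightarrow> H ALo g = (g + 1) * (L + 1) \<and> H AHi g = min ((g + 2) * (L + 1)) p \<and> (g + 1) * (L + 1) < p"
  shows "reached H = {..<L + 1}" "gaps (L + 1) C {..<L + 1} H" "gap_size C H \<le> 4 * p"
proof -
  let ?W = "L + 1"
  have Lp: "L < p"
    using assms(1) unfolding interval_def by blast
  show r: "reached H = {..<?W}"
    using assms(1) unfolding reached_def interval_def by auto
  have "gap ?W g {..<?W} H" if "g < C" for g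
  proof -
    have g: "H ALo g = (g + 1) * ?W" "H AHi g = min ((g + 2) * ?W) p" "(g + 1) * ?W < p"
      using assms(4)[OF that] by blast+
    have "(x \<in> {..<?W} \<longleftrightarrow> x < H ALo g \<or> H AHi g \<le> x) \<and> (H ATime x \<noteq> 0 \<longleftrightarrow> x \<in> {..<?W})"
      if x: "x \<in> blk ?W g" for x
    proof -
      have "(g + 1) * ?W \<le> x" "x < (g + 2) * ?W" "x < p"
        using x unfolding blk_def by blast+
      moreover have "?W \<le> (g + 1) * ?W"
        by simp
      ultimately have "\<not> x < H ALo g" "\<not> H AHi g \<le> x" "x \<notin> {..<?W}" "x \<notin> reached H"
        using g unfolding r by auto
      then show ?thesis
        using \<open>x < p\<close> unfolding reached_def by simp
    qed
    then show ?thesis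
      using g unfolding gap_def by auto
  qed
  then show "gaps ?W C {..<?W} H"
    using assms(2,3) Lp r runs_interval[of ?W p] unfolding gaps_def by simp
  have "gap_size C H \<le> (\<Sum>g<C. p)"
    unfolding gap_size_def
  proof (rule sum_mono)
    fix g
    assume "g \<in> {..<C}"
    then have "H AHi g \<le> p"
      using assms(4)[of g] by simp
    then show "H AHi g - H ALo g \<le> p"
      by simp
  qed
  also have "\<dots> \<le> 4 * p"
    using assms(2) by simp
  finally show "gap_size C H \<le> 4 * p" .
qed

lemma wp_grow:
  assumes inv: "pairs_inv s H" and L: "s VL = L" and C: "s VC = C" "C < 4" "p \<le> (C + 1) * (L + 1)"
    and lohi: "\<And>g. g < C \<Longrightarrow> H ALo g = (g + 1) * (L + 1) \<and> H AHi g = min ((g + 2) * (L + 1)) p \<and> (g + 1) * (L + 1) < p"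
    and Q: "\<And>s' H' n'. base s' H' \<Longrightarrow> mv (s' Vt) H' \<Longrightarrow> (\<And>x. x < p \<Longrightarrow> H' ATime x \<noteq> 0) \<Longrightarrow>
      n' \<le> n + 100 * p \<Longrightarrow> Q s' H' n'"
  shows "wpp grow_pass Q s H n"
proof -
  have bs: "base s H" and mvt: "mv (s Vt) H" and t0: "0 < s Vt" and int: "interval L H" and mL: "m \<le> L"
    and us: "used (H AOwn) + m + 2 * s Vt = 2 * p" and pL: "p \<le> L + s Vt"
    and tt: "s Vt + m = p \<or> p \<le> s Vt + p div 4"
    and one: "\<forall>j. 0 < j \<longrightarrow> j < p \<longrightarrow> v j = 1 \<longrightarrow> H AOwn j \<noteq> 0"
    using inv L unfolding pairs_inv_def by metis+
  note init = gaps_init[OF int less_imp_le[OF C(2)] C(3) lohi]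
  have Lp: "L < p"
    using int unfolding interval_def by blast
  define t0 u0 where "t0 = s Vt" and "u0 = used (H AOwn)"
  \<comment> \<open>The initial potential, at most \<open>4 * p\<close>, bounds the total scanning
    time; apart from it each element costs a constant.\<close>
  define \<phi> where "\<phi> = gap_size C H"
  define I where "I s' H' n' \<longleftrightarrow> base s' H' \<and> mv (s' Vt) H' \<and> 0 < s' Vt \<and> s' Vt \<le> t0 \<and> 0 < s' Vi \<and> s' Vi \<le> p \<and>
    s' VC = C \<and> gaps (L + 1) C (reached H') H' \<and> big p L (t0 - s' Vt) (reached H') \<and>
    used (H' AOwn) + s' Vt = u0 + t0 \<and> (\<forall>j. 0 < j \<longrightarrow> j < p \<longrightarrow> v j = 1 \<longrightarrow> H' AOwn j \<noteq> 0) \<and>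
    (\<forall>j. 0 < j \<longrightarrow> j < s' Vi \<longrightarrow> H' AOwn j \<noteq> 0) \<and> n' + 3 * gap_size C H' \<le> n + 60 * s' Vi + 3 * \<phi>" for s' H' n'
  have body: "wpp grow_body (\<lambda>s' H' n'. I s' H' n' \<and> p - s' Vi < p - s Vi) s H (Suc n')"
    if I: "I s H n'" and i: "s Vi < p" for s H n'
  proof -
    let ?i = "s Vi" and ?S = "reached H"
    have bs: "base s H" and mvt: "mv (s Vt) H" and t: "0 < s Vt" "s Vt \<le> t0" and i0: "0 < ?i" and VC: "s VC = C"
      and gaps: "gaps (L + 1) C ?S H" and big: "big p L (t0 - s Vt) ?S"
      and us: "used (H AOwn) + s Vt = u0 + t0"
      and one: "\<forall>j. 0 < j \<longrightarrow> j < p \<longrightarrow> v j = 1 \<longrightarrow> H AOwn j \<noteq> 0"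
      and past: "\<forall>j. 0 < j \<longrightarrow> j < ?i \<longrightarrow> H AOwn j \<noteq> 0"
      and n': "n' + 3 * gap_size C H \<le> n + 60 * ?i + 3 * \<phi>"
      using I unfolding I_def by blast+
    have val: "H AVal ?i = v ?i" "s Vp = p"
      using bs i i0 by (auto simp: base_def)
    have less: "?i < p * p" "Suc ?i < M" "Suc 0 < M" "0 < M"
      using i M index_bound[of ?i] by auto
    show ?thesis
    proof (cases "H AOwn ?i = 0")
      case False
      then have "\<forall>j. 0 < j \<longrightarrow> j < Suc ?i \<longrightarrow> H AOwn j \<noteq> 0"
        using past by (auto simp: less_Suc_eq)
      then have "I (s(Vi := Suc ?i)) H (Suc (Suc (Suc n')))"
        using bs mvt t i VC gaps big us one n' unfolding I_def by simp
      then show ?thesis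
        unfolding grow_body_def using False less i by (simp add: diff_less_mono2)
    next
      case True
      let ?t = "s Vt - 1" and ?d = "v ?i"
      let ?H = "H(AOwn := (H AOwn)(?i := ?t), AI := (H AI)(?t := ?i), AD := (H AD)(?t := ?d))"
      let ?s = "s(Vd := ?d, Vt := ?t)"
      let ?G = "grow p ?d ?S"
      have t': "0 < ?t" "?t < p" and mv1: "mv ?t ?H"
        using mv_single[OF mvt i0 i True t(1) refl refl] by blast+
      \<comment> \<open>The ones were all spent earlier. This is why every single element gains at
        least 2 as long as the reached set is an interval.\<close>
      have d: "2 \<le> ?d" "2 * ?d \<le> p" "?d < p"
      proof -
        have "?d \<noteq> 1"
          using one i0 i True by blast
        then show "2 \<le> ?d" "2 * ?d \<le> p" "?d < p"
          using v_bounds[OF i0 i] by auto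
      qed
      have S: "?t < ?H ATime x \<longleftrightarrow> x \<in> ?S" if "x < p" for x
        using mv_time_ge[OF mvt that] t(1) that unfolding reached_def by auto
      have "0 \<in> ?S"
        using mvt p2 unfolding mv_def moves_def reached_def by simp
      then have big': "big p L (Suc (t0 - s Vt)) ?G"
        using big_grow[OF p d(1,2) _ _ big] unfolding reached_def by blast
      have gaps1: "gaps (L + 1) C ?S ?H"
        using gaps by simp
      have "wpp blocks_loop (wpp (Vi ::= Var Vi \<oplus> Num (Suc 0))
          (\<lambda>s' H' n'. I s' H' n' \<and> p - s' Vi < p - s Vi)) ?s ?H (n' + 7)"
      proof (rule wp_blocks[OF mv1 t' _ d(3) _ _ _ _ gaps1 S])
        fix s' H' n2
        assume mv2: "mv ?t H'" and gaps2: "gaps (L + 1) C ?G H'"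
          and fr: "\<And>X. X \<noteq> Vg \<Longrightarrow> X \<noteq> Vlo \<Longrightarrow> X \<noteq> Vhi \<Longrightarrow> s' X = ?s X"
          and fr': "\<And>A. A \<noteq> ATime \<Longrightarrow> A \<noteq> ALo \<Longrightarrow> A \<noteq> AHi \<Longrightarrow> H' A = ?H A"
          and n2: "n2 + 3 * gap_size C H' \<le> n' + 7 + 40 + 3 * gap_size C ?H"
        have G: "?G = reached H'"
          using gaps2 unfolding gaps_def by blast
        have own: "H' AOwn = (H AOwn)(?i := ?t)"
          using fr'[of AOwn] by simp
        have "base s' H'"
          using bs fr fr' unfolding base_def by simp
        moreover have st: "s' Vt = ?t" "s' VC = C" "s' Vi = ?i"
          using fr VC by simp_all
        moreover have "used (H' AOwn) + ?t = u0 + t0"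
          using us t(1) used_upd[OF i0 i, of "H AOwn" ?t] True t'(1) unfolding own by simp
        moreover have "big p L (t0 - ?t) (reached H')"
        proof -
          have "t0 - ?t = Suc (t0 - s Vt)"
            using t by simp
          then show ?thesis
            using big' G by simp
        qed
        moreover have "\<forall>j. 0 < j \<longrightarrow> j < p \<longrightarrow> v j = 1 \<longrightarrow> H' AOwn j \<noteq> 0"
          using one t'(1) unfolding own by simp
        moreover have "\<forall>j. 0 < j \<longrightarrow> j < Suc ?i \<longrightarrow> H' AOwn j \<noteq> 0"
          using past t'(1) unfolding own by (simp add: less_Suc_eq)
        moreover have "Suc n2 + 3 * gap_size C H' \<le> n + 60 * Suc ?i + 3 * \<phi>"
          using n2 n' by simp
        ultimately have "I (s'(Vi := Suc ?i)) H' (Suc n2)"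
          using mv2 gaps2 G t t' i unfolding I_def by simp
        then show "wpp (Vi ::= Var Vi \<oplus> Num (Suc 0))
            (\<lambda>s' H' n'. I s' H' n' \<and> p - s' Vi < p - s Vi) s' H' n2"
          using st less i by (simp add: diff_less_mono2)
      qed (use val VC in simp_all)
      moreover have "Suc 0 \<le> s Vt" "s Vt - Suc 0 < p * p"
        using t(1) index_bound[of ?t] t'(2) by auto
      ultimately show ?thesis
        using True less by (simp add: grow_body_def val numeral_eq_Suc)
    qed
  qed
  have loop: "wpp (WHILE Lt (Var Vi) (Var Vp) DO grow_body) Q s1 H1 n1" if "I s1 H1 n1" for s1 H1 n1
    using that
  proof (rule wp_While[where I = I and \<mu> = "\<lambda>s H. p - s Vi"])
    fix s' H' n'
    assume I: "I s' H' n'"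
    then have P: "s' Vp = p"
      unfolding I_def base_def by blast
    show "bok M (p * p) (Lt (Var Vi) (Var Vp)) s' H'"
      by simp
    show "wpp grow_body (\<lambda>s'' H'' n'. I s'' H'' n' \<and> p - s'' Vi < p - s' Vi) s' H' (Suc n')"
      if "bval (Lt (Var Vi) (Var Vp)) s' H'"
      using body[OF I] that P by simp
    show "Q s' H' (Suc n')" if "\<not> bval (Lt (Var Vi) (Var Vp)) s' H'"
    proof -
      have i: "s' Vi = p"
        using that P I unfolding I_def by simp
      have past: "\<forall>j. 0 < j \<longrightarrow> j < p \<longrightarrow> H' AOwn j \<noteq> 0" and us': "used (H' AOwn) + s' Vt = u0 + t0"
        and big: "big p L (t0 - s' Vt) (reached H')" and tle: "s' Vt \<le> t0"
        and n': "n' + 3 * gap_size C H' \<le> n + 60 * s' Vi + 3 * \<phi>"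
        and bs': "base s' H'" "mv (s' Vt) H'"
        using I i unfolding I_def by metis+
      define j where "j = t0 - s' Vt"
      have "{j \<in> {1..<p}. H' AOwn j \<noteq> 0} = {1..<p}"
        using past by auto
      then have "used (H' AOwn) + 1 = p"
        using p2 unfolding used_def by simp
      then have j: "j + p + 1 = 2 * t0 + m"
        using us' us tle unfolding u0_def t0_def[symmetric] j_def by linarith
      \<comment> \<open>These are the two budgets of \<open>big_full\<close>. The second follows
        from \<open>p \<le> L + t0\<close> and the value of \<open>j\<close> alone. The case
        distinction serves the first, where every pair counts against the supply of single
        elements.\<close>
      have "p \<le> L + 1 + 2 * j \<and> p \<le> 2 * L + 1 + j"
        using tt
      proof
        assume "s Vt + m = p"
        then have "t0 + m = p"
          unfolding t0_def .
        moreover have "0 < t0"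
          using t0 unfolding t0_def .
        ultimately show ?thesis
          using j pL mL Lp unfolding t0_def[symmetric] by linarith
      next
        assume "p \<le> s Vt + p div 4"
        then have "p \<le> t0 + p div 4" "t0 \<le> p"
          using mvt unfolding t0_def mv_def moves_def by auto
        then have "4 * p \<le> 4 * t0 + p"
          by linarith
        then show ?thesis
          using j pL p2 \<open>t0 \<le> p\<close> unfolding t0_def[symmetric] by linarith
      qed
      then have "reached H' = {..<p}"
        using big_full[OF big[folded j_def]] unfolding reached_def by blast
      then have "H' ATime x \<noteq> 0" if "x < p" for x
        using that unfolding reached_def by blast
      moreover have "Suc n' \<le> n + 100 * p"
        using n' i init(3) p2 unfolding \<phi>_def by simp
      ultimately show ?thesis
        using bs' by (intro Q) auto
    qed
  qed
  have "big p L 0 {..<L + 1}"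
    using Lp unfolding big_def by auto
  then have "I (s(Vi := 1)) H (Suc n)"
    unfolding I_def using bs mvt t0 C(1) init one p2 by (simp add: t0_def u0_def \<phi>_def)
  then show ?thesis
    unfolding grow_pass_def using M loop by simp
qed

end

section \<open>Tracing the target back to 0 and writing the output\<close>

definition rest_body :: prog where
  "rest_body =
     (IF Neq (Get ABit (Var Vi)) (Num 1)
      THEN Skip
      ELSE Vx ::= (Var Vx \<oplus> Var Vp \<ominus> Get AC (Var Vi)) \<odot> Var Vp);;
     Vi ::= Var Vi \<oplus> Num 1"

text \<open>Pairing still changes bits, so the sum of the base selection is taken off the target
  only now. The remainder is the residue that the moves have to add.\<close>

definition rest_pass :: prog where
  "rest_pass =
     Vi ::= Num 1;;
     WHILE Lt (Var Vi) (Var Vp) DO rest_body"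

text \<open>A move without a second element has 0 in \<open>AJ\<close> and flips \<open>ABit\<close>
  at index 0, which belongs to no element.\<close>

definition back_body :: prog where
  "back_body =
     Vt ::= Get ATime (Var Vx);;
     ABit[Get AI (Var Vt)] ::= Num 1 \<ominus> Get ABit (Get AI (Var Vt));;
     ABit[Get AJ (Var Vt)] ::= Num 1 \<ominus> Get ABit (Get AJ (Var Vt));;
     Vx ::= (Var Vx \<oplus> Var Vp \<ominus> Get AD (Var Vt)) \<odot> Var Vp"

definition back_pass :: prog where
  "back_pass = WHILE Lt (Num 0) (Var Vx) DO back_body"

definition output_body :: prog where
  "output_body =
     AIn[Var Vi \<oplus> Num 1] ::= Get ABit (Var Vi);;
     Vi ::= Var Vi \<oplus> Num 1"

definition output_pass :: prog where
  "output_pass =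
     Vi ::= Num 1;;
     WHILE Lt (Var Vi) (Var Vp) DO output_body"

definition main :: prog where
  "main = count_pass;; inverse_pass;; scale_pass;; ones_pass;; pairs_pass;; gaps_pass;; grow_pass;;
     rest_pass;; back_pass;; output_pass"

context normalised
begin

lemma wp_rest:
  assumes bs: "base s H" and mvt: "mv (s Vt) H"
    and Q: "\<And>s' n'. s' Vp = p \<Longrightarrow> s' Vx < p \<Longrightarrow> [int (s' Vx) + bsum p c (H ABit) = int x0] (mod int p) \<Longrightarrow>
      n' \<le> n + 20 * p \<Longrightarrow> Q s' H n'"
  shows "wpp rest_pass Q s H n"
proof -
  have C: "H AC i = c i" if "0 < i" "i < p" for i
    using bs that unfolding base_def by blast
  have B: "H ABit i = 0 \<or> H ABit i = 1" if "i < p" for i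
    using mvt that unfolding mv_def moves_def by (metis le_antisym less_one not_less)
  define I where "I s' H' n' \<longleftrightarrow> H' = H \<and> s' Vp = p \<and> s' Vx < p \<and> 0 < s' Vi \<and> s' Vi \<le> p \<and>
    [int (s' Vx) + bsum (s' Vi) c (H ABit) = int x0] (mod int p) \<and> n' \<le> n + 5 * s' Vi" for s' H' n'
  have loop: "wpp (WHILE Lt (Var Vi) (Var Vp) DO rest_body) Q s1 H1 n1" if "I s1 H1 n1" for s1 H1 n1
    using that
  proof (rule wp_While[where I = I and \<mu> = "\<lambda>s H. p - s Vi"])
    fix s' H' n'
    assume "I s' H' n'"
    then have I: "H' = H" "s' Vp = p" "s' Vx < p" "0 < s' Vi" "s' Vi \<le> p"
      "[int (s' Vx) + bsum (s' Vi) c (H ABit) = int x0] (mod int p)" "n' \<le> n + 5 * s' Vi"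
      unfolding I_def by blast+
    show "bok M (p * p) (Lt (Var Vi) (Var Vp)) s' H'"
      by simp
    show "Q s' H' (Suc n')" if "\<not> bval (Lt (Var Vi) (Var Vp)) s' H'"
    proof -
      have "s' Vi = p"
        using that I by simp
      then show ?thesis
        using I p2 by (auto intro!: Q)
    qed
    show "wpp rest_body (\<lambda>s'' H'' n''. I s'' H'' n'' \<and> p - s'' Vi < p - s' Vi) s' H' (Suc n')"
      if "bval (Lt (Var Vi) (Var Vp)) s' H'"
    proof -
      let ?i = "s' Vi" and ?x = "s' Vx"
      have i: "?i < p"
        using that I by simp
      have ci: "c ?i < p" "H AC ?i = c ?i"
        using c C I(4) i by auto
      have less: "?i < p * p" "?x + p < M" "Suc ?i < M" "Suc 0 < M" "c ?i \<le> ?x + p"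
        using index_bound[of ?i] i I(3) M ci by auto
      have bs: "bsum (Suc ?i) c (H ABit) = bsum ?i c (H ABit) + int (H ABit ?i) * int (c ?i)"
        unfolding bsum_def by simp
      show ?thesis
      proof (cases "H ABit ?i = 1")
        case True
        let ?y = "shift p ?x (c ?i)"
        have "[int ?y + bsum (Suc ?i) c (H ABit) = int ?x - int (c ?i) + bsum (Suc ?i) c (H ABit)] (mod int p)"
          using shift_cong[OF ci(1)] by (intro cong_add) auto
        also have "int ?x - int (c ?i) + bsum (Suc ?i) c (H ABit) = int ?x + bsum ?i c (H ABit)"
          using True bs by simp
        also note I(6)
        finally have "[int ?y + bsum (Suc ?i) c (H ABit) = int x0] (mod int p)" .
        then have "I (s'(Vx := ?y, Vi := Suc ?i)) H (Suc (Suc (Suc (Suc n'))))"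
          using I i shift_less[of p] p2 unfolding I_def by simp
        then show ?thesis
          using True less i by (simp add: rest_body_def I(1,2) ci shift_def diff_less_mono2)
      next
        case False
        then have "H ABit ?i = 0"
          using B[OF i] by simp
        then have "I (s'(Vi := Suc ?i)) H (Suc (Suc (Suc n')))"
          using I i bs unfolding I_def by simp
        then show ?thesis
          using \<open>H ABit ?i = 0\<close> less i by (simp add: rest_body_def I(1,2) diff_less_mono2)
      qed
    qed
  qed
  have "bsum (Suc 0) c (H ABit) = 0"
    unfolding bsum_def by (simp add: c0)
  then have "I (s(Vi := Suc 0)) H (Suc n)"
    unfolding I_def using bs x0 p2 by (simp add: base_def)
  then show ?thesis
    unfolding rest_pass_def using M loop by simp
qed

lemma wp_back:
  assumes mvt: "mv t0 H" and full: "\<And>x. x < p \<Longrightarrow> H ATime x \<noteq> 0"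
    and s: "s Vp = p" "s Vx < p" "[int (s Vx) + bsum p c (H ABit) = int x0] (mod int p)"
    and Q: "\<And>s' H' n'. s' Vp = p \<Longrightarrow> (\<And>i. i < p \<Longrightarrow> H' ABit i \<le> 1) \<Longrightarrow> [bsum p c (H' ABit) = int x0] (mod int p) \<Longrightarrow>
      n' \<le> n + 20 * p \<Longrightarrow> Q s' H' n'"
  shows "wpp back_pass Q s H n"
proof -
  let ?T = "H ATime"
  have mvs: "moves p c t0 (H ABit) (H AOwn) ?T (H AI) (H AJ) (H AD)"
    using mvt unfolding mv_def .
  define I where "I s' H' n' \<longleftrightarrow> (\<exists>B. H' = H(ABit := B) \<and> s' Vp = p \<and> s' Vx < p \<and> (\<forall>i<p. B i \<le> 1) \<and>
    (\<forall>i. 0 < i \<longrightarrow> i < p \<longrightarrow> ?T (s' Vx) \<le> H AOwn i \<longrightarrow> B i = H ABit i) \<and>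
    [int (s' Vx) + bsum p c B = int x0] (mod int p) \<and> n' \<le> n + 5 * ?T (s' Vx))" for s' H' n'
  have T_le: "?T x \<le> p" if "x < p" for x
    using mv_time_ge[OF mvt that full[OF that]] by simp
  \<comment> \<open>Numbers strictly increase along the trace, up to \<open>?T 0 = p\<close>. This
    gives termination and a linear number of rounds, with the time charged to
    \<open>?T (s' Vx)\<close>.\<close>
  show ?thesis
    unfolding back_pass_def
  proof (rule wp_While[where I = I and \<mu> = "\<lambda>s H'. p - ?T (s Vx)"])
    show "I s H n"
      unfolding I_def using mvs s by (intro exI[of _ "H ABit"]) (auto simp: moves_def)
  next
    fix s' H' n'
    assume "I s' H' n'"
    then obtain B where I: "H' = H(ABit := B)" "s' Vp = p" "s' Vx < p" "\<And>i. i < p \<Longrightarrow> B i \<le> 1"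
      "\<And>i. 0 < i \<Longrightarrow> i < p \<Longrightarrow> ?T (s' Vx) \<le> H AOwn i \<Longrightarrow> B i = H ABit i"
      "[int (s' Vx) + bsum p c B = int x0] (mod int p)" "n' \<le> n + 5 * ?T (s' Vx)"
      unfolding I_def by blast
    show "bok M (p * p) (Lt (Num 0) (Var Vx)) s' H'"
      using M by simp
    show "Q s' H' (Suc n')" if "\<not> bval (Lt (Num 0) (Var Vx)) s' H'"
    proof (rule Q)
      have "s' Vx = 0"
        using that by simp
      then show "[bsum p c (H' ABit) = int x0] (mod int p)"
        using I(1,6) by simp
      show "Suc n' \<le> n + 20 * p"
        using I(7) T_le[OF I(3)] p2 by simp
    qed (use I in auto)
    show "wpp back_body (\<lambda>s'' H'' n''. I s'' H'' n'' \<and> p - ?T (s'' Vx) < p - ?T (s' Vx)) s' H' (Suc n')"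
      if "bval (Lt (Num 0) (Var Vx)) s' H'"
    proof -
      let ?x = "s' Vx"
      define t where "t = ?T ?x"
      have x: "0 < ?x" "?T ?x = t" "t \<noteq> 0"
        using that full[OF I(3)] by (simp_all add: t_def)
      define i j B1 B2 x' where "i = H AI t" and "j = H AJ t" and "B1 = B(i := 1 - B i)" and "B2 = B1(j := 1 - B1 j)"
        and "x' = shift p ?x (H AD t)"
      have bk: "i < p" "j < p" "H AD t < p" "t < ?T x'" "x' < p"
        "[int x' + bsum p c B2 = int ?x + bsum p c B] (mod int p)"
        "\<And>k. k < p \<Longrightarrow> B2 k \<le> 1" "\<And>k. 0 < k \<Longrightarrow> k < p \<Longrightarrow> t < H AOwn k \<Longrightarrow> B2 k = H ABit k"
        using moves_backtrace[OF mvs x(1) I(3) x(2,3) c0 I(4) I(5)[folded t_def] B1_def[unfolded i_def] B2_def[unfolded j_def] x'_def]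
        unfolding i_def j_def by blast+
      have "t0 \<le> t" "t < p"
        using mvs x I(3) unfolding moves_def by auto
      then have "i \<noteq> j"
        using mvs unfolding moves_def i_def j_def by blast
      then have B2: "B2 = B(i := Suc 0 - B i, j := Suc 0 - B j)"
        unfolding B2_def B1_def by simp
      have B: "B i \<le> 1" "B j \<le> 1"
        using I(4) bk(1,2) by auto
      have tp: "t \<le> p"
        using T_le[OF I(3)] unfolding t_def .
      have less: "?x < p * p" "t < p * p" "i < p * p" "j < p * p" "Suc 0 < M" "?x + p < M" "H AD t \<le> ?x + p"
        using index_bound I(3) bk(1-3) tp M by auto
      have "[int x' + bsum p c B2 = int x0] (mod int p)"
        using bk(6) I(6) by (rule cong_trans)
      moreover have "Suc (Suc (Suc (Suc (Suc n')))) \<le> n + 5 * ?T x'"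
        using I(7) bk(4) unfolding t_def by simp
      ultimately have "I (s'(Vt := t, Vx := x')) (H(ABit := B2)) (Suc (Suc (Suc (Suc (Suc n')))))"
        unfolding I_def using I(2) bk(4,5,7,8) by (intro exI[of _ B2]) auto
      moreover have "p - ?T x' < p - ?T ?x"
        using bk(4) T_le[OF bk(5)] x(2) by simp
      moreover have "(?x + p - H AD t) mod p = x'"
        unfolding x'_def shift_def ..
      ultimately show ?thesis
        using less B x(2) \<open>i \<noteq> j\<close> by (simp add: back_body_def I(1,2) B2 i_def[symmetric] j_def[symmetric])
    qed
  qed
qed

end

context word_bounds
begin

lemma wp_output:
  assumes s: "s Vp = p"
    and Q: "\<And>s' H' n'. (\<And>i. 0 < i \<Longrightarrow> i < p \<Longrightarrow> H' AIn (i + 1) = H ABit i) \<Longrightarrow> n' \<le> n + 20 * p \<Longrightarrow> Q s' H' n'"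
  shows "wpp output_pass Q s H n"
proof -
  define I where "I s' H' n' \<longleftrightarrow> s' Vp = p \<and> 0 < s' Vi \<and> s' Vi \<le> p \<and> H' ABit = H ABit \<and>
    (\<forall>i. 0 < i \<longrightarrow> i < s' Vi \<longrightarrow> H' AIn (i + 1) = H ABit i) \<and> n' \<le> n + 5 * s' Vi" for s' H' n'
  have loop: "wpp (WHILE Lt (Var Vi) (Var Vp) DO output_body) Q s1 H1 n1" if "I s1 H1 n1" for s1 H1 n1
    using that
  proof (rule wp_While[where I = I and \<mu> = "\<lambda>s H. p - s Vi"])
    fix s' H' n'
    assume I: "I s' H' n'"
    show "bok M (p * p) (Lt (Var Vi) (Var Vp)) s' H'"
      by simp
    show "Q s' H' (Suc n')" if "\<not> bval (Lt (Var Vi) (Var Vp)) s' H'"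
      using that I p2 unfolding I_def by (intro Q) auto
    show "wpp output_body (\<lambda>s'' H'' n''. I s'' H'' n'' \<and> p - s'' Vi < p - s' Vi) s' H' (Suc n')"
      if "bval (Lt (Var Vi) (Var Vp)) s' H'"
    proof -
      have i: "s' Vi < p"
        using that I unfolding I_def by simp
      then have "s' Vi < p * p" "Suc (s' Vi) < p * p" "Suc (s' Vi) < M" "Suc 0 < M"
        using index_bound[of "s' Vi"] index_bound[of "Suc (s' Vi)"] M by auto
      then show ?thesis
        using I i unfolding I_def output_body_def by (simp add: diff_less_mono2 less_Suc_eq)
    qed
  qed
  have "I (s(Vi := Suc 0)) H (Suc n)"
    unfolding I_def using s p2 by simp
  then show ?thesis
    unfolding output_pass_def using M loop by simp
qed

end

context input
begin

lemma wp_main: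
  assumes "inp H" "zeros (- {AIn}) H"
  shows "wpp main (\<lambda>s' H' n'. n' \<le> 400 * p \<and>
    (\<exists>I. I \<subseteq> {1..p - 1} \<and> (\<forall>i\<in>{1..p - 1}. H' AIn (i + 1) = (if i \<in> I then 1 else 0)) \<and>
      [(\<Sum>i\<in>I. a i) = k] (mod p))) s H 0"
    (is "wpp _ ?Q _ _ _")
  unfolding main_def wp_Seq_fun
proof (rule wp_count[OF assms])
  let ?output = "wpp output_pass ?Q"
  let ?back = "wpp back_pass ?output"
  let ?rest = "wpp rest_pass ?back"
  let ?grow = "wpp grow_pass ?rest"
  let ?gaps = "wpp gaps_pass ?grow"
  let ?pairs = "wpp pairs_pass ?gaps"
  let ?ones = "wpp ones_pass ?pairs"
  let ?scale = "wpp scale_pass ?ones"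
  let ?inverse = "wpp inverse_pass ?scale"
  fix s1 H1 n1
  assume s1: "s1 Vp = p" "inp H1" "zeros (- {AIn, ACnt}) H1" "0 < s1 Vu" "s1 Vu < p" "n1 \<le> 0 + 20 * p"
    and max: "\<And>v. card {i \<in> {1..<p}. absm p (a i) = v} \<le> card {i \<in> {1..<p}. absm p (a i) = absm p (s1 Vu)}"
  show "?inverse s1 H1 n1"
  proof (rule wp_inverse[OF s1(1,4,5)])
    fix r n2
    assume r: "r < p" "r * s1 Vu mod p = 1" and n2: "n2 \<le> n1 + 20 * p"
    define c where "c = scaled p a r"
    interpret normalised p M "k * r mod p" c
    proof
      show "k * r mod p < p" "c 0 = 0"
        using p2 by (simp_all add: c_def scaled_def)
      show "0 < c i \<and> c i < p" if "0 < i" "i < p" for i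
        using scaled_nonzero[OF p r(2)] a[of i] that by (simp add: c_def scaled_def)
      have "{i \<in> {1..<p}. absm p (c i) = x} = {i \<in> {1..<p}. absm p (a i * r mod p) = x}" for x
        by (auto simp: c_def scaled_def)
      then show "card {i \<in> {1..<p}. absm p (c i) = x} \<le> card {i \<in> {1..<p}. absm p (c i) = 1}" for x
        using normalised_multiplicity[OF p r(2) s1(4,5) a max] by simp
    qed
    show "?scale (s1(Vr := r)) H1 n2"
    proof (rule wp_scale[OF _ s1(2) _ r s1(3), folded c_def])
      fix s3 H3 n3
      assume s3: "s3 Vp = p" "s3 Vx = k * r mod p" "zeros (- {AIn, ACnt, AC, ABit, AVal}) H3" "H3 ABit 0 = 0"
        and c3: "\<And>i. 0 < i \<Longrightarrow> i < p \<Longrightarrow> H3 AC i = c i \<and> H3 AVal i = absm p (c i) \<and> H3 ABit i \<le> 1 \<and>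
          [wt c (H3 ABit) i = int (absm p (c i))] (mod int p)"
        and n3: "n3 \<le> n2 + 20 * p"
      show "?ones s3 H3 n3"
      proof (rule wp_ones)
        show "base s3 H3"
          using s3 c3 unfolding base_def v_def by simp
        show "zeros {AOwn, AI, AJ, AD, ATime, AH} H3"
          using s3(3) by (rule zeros_mono) auto
        show "H3 ABit i \<le> 1" if "i < p" for i
          using c3[of i] s3(4) that by (cases "i = 0") auto
        show "[wt c (H3 ABit) i = int (absm p (c i))] (mod int p)" if "0 < i" "i < p" for i
          using c3[OF that] by blast
        fix s4 H4 n4
        assume s4: "base s4 H4" "mv (p - m) H4" "s4 Vt = p - m" "s4 VL = m" "m < p" "interval m H4" "zeros {AH} H4"
          "\<And>j. 0 < j \<Longrightarrow> j < p \<Longrightarrow> (H4 AOwn j \<noteq> 0) = (v j = 1)" and n4: "n4 \<le> n3 + 20 * p"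
        show "?pairs s4 H4 n4"
        proof (rule wp_pairs[OF s4])
          fix s5 H5 n5
          assume s5: "pairs_inv s5 H5" "p \<le> 4 * (s5 VL + 1)" and n5: "n5 \<le> n4 + 50 * p"
          show "?gaps s5 H5 n5"
          proof (rule wp_gaps[OF s5(1) refl s5(2)])
            fix s6 H6 n6
            assume s6: "pairs_inv s6 H6" "s6 VL = s5 VL" "s6 VC < 4" "p \<le> (s6 VC + 1) * (s5 VL + 1)"
              and g6: "\<And>g. g < s6 VC \<Longrightarrow> H6 ALo g = (g + 1) * (s5 VL + 1) \<and>
                H6 AHi g = min ((g + 2) * (s5 VL + 1)) p \<and> (g + 1) * (s5 VL + 1) < p"
              and n6: "n6 \<le> n5 + 50 * p"
            show "?grow s6 H6 n6"
            proof (rule wp_grow[OF s6(1,2) refl s6(3,4) g6])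
              fix s7 H7 n7
              assume s7: "base s7 H7" "mv (s7 Vt) H7" and full: "\<And>x. x < p \<Longrightarrow> H7 ATime x \<noteq> 0"
                and n7: "n7 \<le> n6 + 100 * p"
              show "?rest s7 H7 n7"
              proof (rule wp_rest[OF s7])
                fix s8 n8
                assume s8: "s8 Vp = p" "s8 Vx < p"
                  "[int (s8 Vx) + bsum p c (H7 ABit) = int (k * r mod p)] (mod int p)" and n8: "n8 \<le> n7 + 20 * p"
                show "?back s8 H7 n8"
                proof (rule wp_back[OF s7(2) full s8])
                  fix s9 H9 n9
                  assume s9: "s9 Vp = p" "\<And>i. i < p \<Longrightarrow> H9 ABit i \<le> 1"
                    "[bsum p c (H9 ABit) = int (k * r mod p)] (mod int p)" and n9: "n9 \<le> n8 + 20 * p"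
                  show "?output s9 H9 n9"
                  proof (rule wp_output)
                    show "s9 Vp = p"
                      by fact
                    fix s' H' n'
                    assume out: "\<And>i. 0 < i \<Longrightarrow> i < p \<Longrightarrow> H' AIn (i + 1) = H9 ABit i" and n': "n' \<le> n9 + 20 * p"
                    let ?B = "H9 ABit"
                    define I where "I = {i \<in> {1..p - 1}. ?B i = 1}"
                    have bit: "?B i = (if i \<in> I then 1 else 0)" if "0 < i" "i < p" for i
                      using s9(2)[OF that(2)] that unfolding I_def by (auto simp: le_Suc_eq)
                    have "bsum p c ?B = (\<Sum>i\<in>I. int (c i))"
                      unfolding bsum_def
                    proof (rule sum.mono_neutral_cong_right)
                      show "I \<subseteq> {..<p}"
                        using p2 unfolding I_def by auto
                      show "\<forall>i\<in>{..<p} - I. int (?B i) * int (c i) = 0"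
                      proof
                        fix i
                        assume "i \<in> {..<p} - I"
                        then show "int (?B i) * int (c i) = 0"
                          using bit[of i] by (cases "i = 0") (auto simp: c_def scaled_def)
                      qed
                    qed (auto simp: I_def)
                    also have "\<dots> = int (\<Sum>i\<in>I. a i * r mod p)"
                      by (simp add: I_def c_def scaled_def)
                    finally have eq: "bsum p c ?B = int (\<Sum>i\<in>I. a i * r mod p)" .
                    have "[(\<Sum>i\<in>I. a i * r mod p) = k * r mod p] (mod p)"
                      using s9(3) unfolding eq cong_int_iff .
                    then have "[(\<Sum>i\<in>I. a i * r mod p) = k * r] (mod p)"
                      by (simp add: cong_def)
                    then have "[(\<Sum>i\<in>I. a i) = k] (mod p)"
                      by (rule unscale_cong[OF r(2)])
                    \<comment> \<open>The bounds of the ten passes add up to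
                      \<open>340 * p\<close>.\<close>
                    moreover have "n' \<le> 400 * p"
                      using s1(6) n2 n3 n4 n5 n6 n7 n8 n9 n' by linarith
                    moreover have "\<forall>i\<in>{1..p - 1}. H' AIn (i + 1) = (if i \<in> I then 1 else 0)"
                      using out bit by auto
                    moreover have "I \<subseteq> {1..p - 1}"
                      unfolding I_def by blast
                    ultimately show "?Q s' H' n'"
                      by blast
                  qed
                qed
              qed
            qed
          qed
        qed
      qed
    qed (use s1 in simp_all)
  qed
qed

end

section \<open>The machine program and its running time\<close>

fun var_num :: "var \<Rightarrow> nat" where
  "var_num Vp = 0" | "var_num Vu = 1" | "var_num Vr = 2" | "var_num Vi = 3" | "var_num Vv = 4"
| "var_num VL = 5" | "var_num Vx = 6" | "var_num Vt = 7" | "var_num Vb = 8" | "var_num Vn = 9"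
| "var_num Vj = 10" | "var_num Vd = 11" | "var_num Ve = 12" | "var_num VW = 13" | "var_num VC = 14"
| "var_num Vg = 15" | "var_num Vlo = 16" | "var_num Vhi = 17"

text \<open>\<open>AIn\<close> has number 0, so it lies on the cells of input and output. All other
  arrays start at positive multiples of \<open>p * p\<close>, beyond the input, in memory that is
  initially zero.\<close>

fun arr_num :: "arr \<Rightarrow> nat" where
  "arr_num AIn = 0" | "arr_num ACnt = 1" | "arr_num AVal = 2" | "arr_num AC = 3" | "arr_num ABit = 4"
| "arr_num AOwn = 5" | "arr_num ATime = 6" | "arr_num AI = 7" | "arr_num AJ = 8" | "arr_num AD = 9"
| "arr_num AH = 10" | "arr_num ASt = 11" | "arr_num ALo = 12" | "arr_num AHi = 13"

lemma inj_var_num: "inj var_num"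
proof (rule injI)
  show "var_num x = var_num y \<Longrightarrow> x = y" for x y
    by (cases x; cases y) simp_all
qed

lemma inj_arr_num: "inj arr_num"
proof (rule injI)
  show "arr_num x = arr_num y \<Longrightarrow> x = y" for x y
    by (cases x; cases y) simp_all
qed

lemma arr_num_less: "arr_num A < 14"
  by (cases A) simp_all

text \<open>The prologue reads \<open>p\<close> from cell 0 and leaves the array distance
  \<open>p * p\<close> in register 0; register 1 is a temporary. Jump targets are absolute, hence
  the offset 3 of the compiled part.\<close>

definition ram_program :: program where
  "ram_program = [Set_Const 1 0, Load 1 1, Set_Op WMul 0 1 1] @ comp var_num arr_num 3 main"

lemma code_at_self: "code_at (pre @ cs @ post) (length pre) cs"
proof (induction cs arbitrary: pre)
  case (Cons i cs)
  from Cons[of "pre @ [i]"] show ?case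
    by simp
qed simp

text \<open>The triple logarithm tends to infinity, so it eventually exceeds 1, and a linear bound
  lies below the required one.\<close>

lemma linear_bigo: "(\<lambda>n. C * real n + D) \<in> O(\<lambda>n. real n * ln (ln (ln (real n))))"
proof (rule bigoI[where c = "\<bar>C\<bar> + \<bar>D\<bar>"])
  have "filterlim (\<lambda>n. ln (ln (ln (real n)))) at_top sequentially"
    by (intro filterlim_compose[OF ln_at_top] filterlim_real_sequentially)
  then have "eventually (\<lambda>n. 1 \<le> ln (ln (ln (real n)))) sequentially"
    by (simp add: filterlim_at_top)
  then show "\<forall>\<^sub>F n in sequentially.
      norm (C * real n + D) \<le> (\<bar>C\<bar> + \<bar>D\<bar>) * norm (real n * ln (ln (ln (real n))))"
    using eventually_ge_at_top[of 1]
  proof eventually_elim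
    case (elim n)
    have "norm (C * real n + D) \<le> \<bar>C\<bar> * real n + \<bar>D\<bar>"
      using abs_triangle_ineq[of "C * real n" D] by (simp add: abs_mult)
    also have "\<dots> \<le> \<bar>C\<bar> * real n + \<bar>D\<bar> * real n"
      using elim(2) mult_left_mono[of 1 "real n" "\<bar>D\<bar>"] by simp
    also have "\<dots> = (\<bar>C\<bar> + \<bar>D\<bar>) * (real n * 1)"
      by (simp add: distrib_right)
    also have "\<dots> \<le> (\<bar>C\<bar> + \<bar>D\<bar>) * (real n * ln (ln (ln (real n))))"
      using elim(1) by (intro mult_left_mono) auto
    also have "\<dots> = (\<bar>C\<bar> + \<bar>D\<bar>) * norm (real n * ln (ln (ln (real n))))"
      using elim by (simp add: abs_mult)
    finally show ?case .
  qed
qed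

text \<open>Of the ten factors, each larger than \<open>p\<close>, eight cover the constant
  \<open>2 ^ 8\<close> even for \<open>p = 2\<close> and two supply \<open>p * p\<close>. The
  constant leaves room for the fourteen arrays and for the slack of
  \<open>word_bounds\<close>.\<close>

lemma word_size:
  assumes "2 \<le> p" "w = 10 * floorlog 2 p"
  shows "256 * (p * p) \<le> 2 ^ w"
proof -
  have "p < 2 ^ floorlog 2 p"
    using floorlog_bounds[of p 2] assms(1) by simp
  then have "p ^ 10 \<le> (2 ^ floorlog 2 p) ^ 10"
    by (intro power_mono) auto
  also have "\<dots> = 2 ^ w"
    by (simp add: assms(2) power_mult mult.commute)
  finally have "p ^ 10 \<le> 2 ^ w" .
  moreover have "2 ^ 8 * p ^ 2 \<le> p ^ 8 * p ^ 2"
    using assms(1) by (intro mult_le_mono1 power_mono) auto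
  moreover have "p ^ 8 * p ^ 2 = p ^ 10"
    by (simp add: power_add[symmetric])
  ultimately have "2 ^ 8 * p ^ 2 \<le> (2 ^ w :: nat)"
    by linarith
  then show ?thesis
    by (simp add: power2_eq_square)
qed

lemma ram_program_correct:
  fixes p k :: nat and a :: "nat \<Rightarrow> nat"
  assumes p: "prime p" and k: "k < p" and a: "\<forall>i\<in>{1..p - 1}. a i < p \<and> a i \<noteq> 0"
  shows "\<exists>t s I. run (10 * floorlog 2 p) ram_program (input_config p k a) t s \<and>
    t \<le> clen main * (400 * p) + 3 \<and> outputs_subset p s I \<and> [(\<Sum>i\<in>I. a i) = k] (mod p)"
proof -
  define w where "w = 10 * floorlog 2 p"
  let ?M = "2 ^ w :: nat" and ?N = "p * p"
  have p2: "2 \<le> p"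
    using prime_ge_2_nat[OF p] .
  have size: "256 * ?N \<le> ?M"
    using word_size[OF p2 w_def] .
  have sq: "2 * p \<le> ?N"
    using p2 by simp
  have M: "p * p + 60 * p + 60 < ?M"
    using size sq p2 by linarith
  interpret input p ?M k a
    using p k a M by unfold_locales (auto simp: Suc_le_eq)
  interpret compiler w ?N var_num arr_num
  proof
    show "(arr_num A + 1) * ?N \<le> ?M" for A
      by (rule order_trans[OF mult_le_mono1 size]) (use arr_num_less[of A] in simp)
  qed (fact inj_var_num inj_arr_num)+
  let ?s0 = "input_config p k a"
  define H :: "arr heap" where "H A = (if A = AIn then mem ?s0 else (\<lambda>_. 0))" for A
  let ?s1 = "?s0\<lparr>pc := 3, regs := (\<lambda>_. 0)(1 := p, 0 := ?N)\<rparr>"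
  have "inp H"
    using a p2 unfolding inp_def H_def input_config_def by auto
  moreover have "zeros (- {AIn}) H"
    unfolding zeros_def H_def by simp
  ultimately have "wp ?M ?N main (\<lambda>S' H' n'. n' \<le> 400 * p \<and>
    (\<exists>I. I \<subseteq> {1..p - 1} \<and> (\<forall>i\<in>{1..p - 1}. H' AIn (i + 1) = (if i \<in> I then 1 else 0)) \<and>
      [(\<Sum>i\<in>I. a i) = k] (mod p))) (\<lambda>_. 0) H 0"
    by (rule wp_main)
  then obtain t S' H' I where ex: "exec ?M ?N main (\<lambda>_. 0) H t S' H'" and t: "t \<le> 400 * p"
    and I: "I \<subseteq> {1..p - 1}" "\<forall>i\<in>{1..p - 1}. H' AIn (i + 1) = (if i \<in> I then 1 else 0)" "[(\<Sum>i\<in>I. a i) = k] (mod p)"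
    unfolding wp_def by auto
  have small: "p < ?M" "?N < ?M"
    using M by auto
  have rel1: "rel (\<lambda>_. 0) H ?s1"
    unfolding rel_def
  proof (intro conjI allI impI)
    show "mem ?s1 (arr_num A * ?N + i) = H A i" if "i < ?N" for A i
    proof (cases "A = AIn")
      case False
      then have pos: "1 \<le> arr_num A"
        by (cases A) auto
      then have "?N \<le> arr_num A * ?N"
        using mult_le_mono1[of 1 "arr_num A" ?N] by simp
      then have "p < arr_num A * ?N + i"
        using sq p2 by linarith
      then show ?thesis
        using False pos p2 unfolding H_def input_config_def by simp
    qed (simp add: H_def)
    show "H A i < ?M" for A i
      using a k small p2 unfolding H_def input_config_def
      by (auto simp: Suc_le_eq intro: less_trans[of _ p])
  qed (auto simp: M)
  have code: "code_at ram_program 3 (comp var_num arr_num 3 main)"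
    using code_at_self[of "[Set_Const 1 0, Load 1 1, Set_Op WMul 0 1 1]" "comp var_num arr_num 3 main" "[]"]
    unfolding ram_program_def by (simp add: numeral_3_eq_3)
  have len: "length ram_program = 3 + clen main"
    unfolding ram_program_def by simp
  have init: "reaches w ram_program ?s0 3 ?s1"
  proof -
    have "reaches w ram_program ?s0 (Suc (Suc (Suc 0))) ?s1"
      using small p2
      by (auto intro!: reaches_step simp: ram_program_def input_config_def take_bit_eq_mod
          fun_upd_twist numeral_3_eq_3 intro: reaches_refl)
    then show ?thesis
      by (simp add: numeral_3_eq_3)
  qed
  from comp_correct[OF ex rel1, of ram_program "clen main"] code
  obtain s t' where s: "t' \<le> clen main * t" "reaches w ram_program ?s1 t' s" "rel S' H' s" "pc s = 3 + clen main"
    by auto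
  have "run w ram_program s 0 s"
    using s(4) len by (intro run.halt) simp
  then have "run w ram_program ?s0 (3 + t') s"
    using reaches_trans[OF init s(2)] unfolding reaches_def by fastforce
  moreover have "t' \<le> clen main * (400 * p)"
    using s(1) mult_le_mono2[OF t, of "clen main"] by linarith
  moreover have "outputs_subset p s I"
    unfolding outputs_subset_def
  proof (intro conjI ballI)
    fix i
    assume i: "i \<in> {1..p - 1}"
    then have "i + 1 < ?N"
      using p2 by (intro index_bound) auto
    then have "mem s (i + 1) = H' AIn (i + 1)"
      using relD(4)[OF s(3), of "i + 1" AIn] by simp
    then show "mem s (i + 1) = (if i \<in> I then 1 else 0)"
      using I(2) i by simp
  qed (fact I(1))
  ultimately show ?thesis
    using I(3) unfolding w_def by (intro exI[of _ "3 + t'"] exI[of _ s] exI[of _ I]) auto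
qed

theorem theorem4:
  shows "\<exists>(P :: program) (c :: nat) (T :: nat \<Rightarrow> real).
    c > 0 \<and>
    T \<in> O(\<lambda>n. real n * ln (ln (ln (real n)))) \<and>
    (\<forall>(p :: nat) (k :: nat) (a :: nat \<Rightarrow> nat).
       prime p \<longrightarrow> k < p \<longrightarrow> (\<forall>i\<in>{1..p - 1}. a i < p \<and> a i \<noteq> 0) \<longrightarrow>
       (\<exists>t s I. run (c * floorlog 2 p) P (input_config p k a) t s \<and>
          real t \<le> T p \<and>
          outputs_subset p s I \<and>
          [(\<Sum>i\<in>I. a i) = k] (mod p)))"
proof (rule exI[of _ ram_program], rule exI[of _ 10], rule exI[of _ "\<lambda>n. real (clen main * 400) * real n + 3"],
    intro conjI allI impI)
  show "(\<lambda>n. real (clen main * 400) * real n + 3) \<in> O(\<lambda>n. real n * ln (ln (ln (real n))))"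
    by (rule linear_bigo)
  fix p k :: nat and a :: "nat \<Rightarrow> nat"
  assume "prime p" "k < p" "\<forall>i\<in>{1..p - 1}. a i < p \<and> a i \<noteq> 0"
  from ram_program_correct[OF this] obtain t s I where
    "run (10 * floorlog 2 p) ram_program (input_config p k a) t s" "t \<le> clen main * (400 * p) + 3"
    "outputs_subset p s I" "[(\<Sum>i\<in>I. a i) = k] (mod p)"
    by blast
  moreover have "real t \<le> real (clen main * 400) * real p + 3"
    using of_nat_mono[OF calculation(2), where 'a = real] by (simp add: mult.assoc)
  ultimately show "\<exists>t s I. run (10 * floorlog 2 p) ram_program (input_config p k a) t s \<and>
      real t \<le> real (clen main * 400) * real p + 3 \<and> outputs_subset p s I \<and> [(\<Sum>i\<in>I. a i) = k] (mod p)"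
    by blast
qed simp

end
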